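(* Let $\ell\ge2$, $m=\lfloor\ell/2\rfloor$, $a\in\mathfrak o_\ell^\times$, and let $\bar a$ be the image of $a$ in $\mathfrak o_m$. (1) An irreducible representation $\pi$ of $\mathbf G(\mathfrak o_\ell)$ admits a $\theta_a$-Whittaker model if and only if $\pi$ is $\bar a$-regular. (2) Every irreducible representation of $\mathbf G(\mathfrak o_\ell)$ admits at most one $\theta_a$-Whittaker model.
   Context: $\mathfrak o$: ring of integers of a non-archimedean local field, uniformizer $\varpi$, residue field $\mathbb F_q$ of characteristic $p$; $\mathfrak o_r=\mathfrak o/\varpi^r\mathfrak o$. Either $\mathbf G={\rm GL}_n$ (any $p$), $\mathfrak g=M_n$, or $\mathbf G={\rm SL}_n$ with $p$ odd and $p\nmid n$, $\mathfrak g=\mathfrak{sl}_n$ (trace zero). $\mathbf U(\mathfrak o_\ell)$: upper unitriangular matrices in $\mathbf G(\mathfrak o_\ell)$. Fix a primitive character $\varphi$ of $(\mathfrak o_\ell,+)$ (nontrivial on $\varpi^{\ell-1}\mathfrak o_\ell$), and define $\theta_a((u_{ij}))=\varphi(a u_{12}+u_{23}+\dots+u_{n-1,n})$. $\pi$ admits a $\theta_a$-Whittaker model if $\mathrm{Hom}_{\mathbf G(\mathfrak o_\ell)}(\pi,\mathrm{Ind}_{\mathbf U(\mathfrak o_\ell)}^{\mathbf G(\mathfrak o_\ell)}\theta_a)\ne0$, at most one if this has dimension $\le1$. For $1\le i<\ell$, $K_\ell^i=\ker(\mathbf G(\mathfrak o_\ell)\to\mathbf G(\mathfrak o_i))$;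 for $i\ge\ell/2$, each $x\in\mathfrak g(\mathfrak o_{\ell-i})$ gives a character $\varphi_x(I+\varpi^iy)=\varphi(\varpi^i\mathrm{tr}(\hat xy))$ of $K_\ell^i$, $\hat x$ any lift of $x$ to $\mathfrak g(\mathfrak o_\ell)$. $x\in\mathfrak g(\mathfrak o_r)$ is regular if some $v$ has $v,xv,\dots,x^{n-1}v$ an $\mathfrak o_r$-basis of $\mathfrak o_r^{\oplus n}$. An irreducible $\rho$ is regular if $\rho|_{K_\ell^{\ell-1}}$ contains $\varphi_x$ with $x\in\mathfrak g(\mathbb F_q)$ regular. For $\alpha\in\mathfrak o_r^\times$, an $\alpha$-regular element of $\mathfrak g(\mathfrak o_r)$ is a matrix with $(2,1)$ entry $\alpha$, entries $(i+1,i)$ equal to $1$ for $2\le i\le n-1$, arbitrary last column, and all other entries $0$. A regular representation $\rho$ of $\mathbf G(\mathfrak o_\ell)$ is $\alpha$-regular ($\alpha\in\mathfrak o_m^\times$) if $\rho|_{K_\ell^{\lceil\ell/2\rceil}}$ contains $\varphi_x$ for some $\alpha$-regular $x\in\mathfrak g(\mathfrak o_m)$. *)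

theory Defs
  imports "Jordan_Normal_Form.Determinant" "HOL-Computational_Algebra.Primes"
begin

text \<open>o is modelled as an integral domain 'a together with a uniformizer w:
every nonzero element is a unit times a power of w, w is a nonzero non-unit,
o is separated and complete for the w-adic topology, and the residue field o/w is finite.
The truncations o_r = o / w^r o are handled through congruences modulo w^r.\<close>

definition local_int_ring :: "'a::idom \<Rightarrow> bool" where
  "local_int_ring w \<longleftrightarrow>
     w \<noteq> 0 \<and> \<not> w dvd 1 \<and>
     (\<forall>x. x \<noteq> 0 \<longrightarrow> (\<exists>u k. u dvd 1 \<and> x = u * w ^ k)) \<and>
     (\<forall>x. (\<forall>k. w ^ k dvd x) \<longrightarrow> x = 0) \<and>
     (\<forall>s::nat \<Rightarrow> 'a. (\<forall>k. w ^ k dvd s (Suc k) - s k) \<longrightarrow> (\<exists>y. \<forall>k. w ^ k dvd y - s k)) \<and>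
     (\<exists>S. finite S \<and> (\<forall>x. \<exists>s\<in>S. w dvd x - s))"

definition residue_char :: "'a::idom \<Rightarrow> nat \<Rightarrow> bool" where
  "residue_char w p \<longleftrightarrow> prime p \<and> w dvd of_nat p"

definition unit_mod :: "'a::idom \<Rightarrow> nat \<Rightarrow> 'a \<Rightarrow> bool" where
  "unit_mod w r a \<longleftrightarrow> (\<exists>b. w ^ r dvd a * b - 1)"

datatype grp_type = GL | SL

definition mtrace :: "'a::comm_ring_1 mat \<Rightarrow> 'a" where
  "mtrace A = (\<Sum>i<dim_row A. A $$ (i, i))"

definition Glift :: "'a::idom \<Rightarrow> grp_type \<Rightarrow> nat \<Rightarrow> nat \<Rightarrow> 'a mat \<Rightarrow> bool" where
  "Glift w g n l A \<longleftrightarrow> A \<in> carrier_mat n n \<and>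
     (case g of GL \<Rightarrow> unit_mod w l (det A) | SL \<Rightarrow> w ^ l dvd det A - 1)"

text \<open>Lifts to M_n(o) of elements of g(o_r) (all matrices for GL_n, trace zero for SL_n).\<close>
definition glift :: "'a::idom \<Rightarrow> grp_type \<Rightarrow> nat \<Rightarrow> nat \<Rightarrow> 'a mat \<Rightarrow> bool" where
  "glift w g n r X \<longleftrightarrow> X \<in> carrier_mat n n \<and> (g = SL \<longrightarrow> w ^ r dvd mtrace X)"

definition mcls :: "'a::idom \<Rightarrow> nat \<Rightarrow> nat \<Rightarrow> 'a mat \<Rightarrow> 'a mat set" where
  "mcls w n l A = {B \<in> carrier_mat n n. \<forall>i<n. \<forall>j<n. w ^ l dvd A $$ (i, j) - B $$ (i, j)}"

definition Grp :: "'a::idom \<Rightarrow> grp_type \<Rightarrow> nat \<Rightarrow> nat \<Rightarrow> 'a mat set monoid" where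
  "Grp w g n l =
     \<lparr> carrier = mcls w n l ` {A. Glift w g n l A},
       mult = (\<lambda>X Y. mcls w n l ((SOME A. A \<in> X) * (SOME B. B \<in> Y))),
       one = mcls w n l (1\<^sub>m n) \<rparr>"

definition Usub :: "'a::idom \<Rightarrow> nat \<Rightarrow> nat \<Rightarrow> 'a mat set set" where
  "Usub w n l = mcls w n l ` {A \<in> carrier_mat n n. \<forall>i<n. A $$ (i, i) = 1 \<and> (\<forall>j<i. A $$ (i, j) = 0)}"

text \<open>Primitive characters of (o_l,+), viewed as functions on o that factor through o_l.\<close>
definition primitive_char :: "'a::idom \<Rightarrow> nat \<Rightarrow> ('a \<Rightarrow> complex) \<Rightarrow> bool" where
  "primitive_char w l \<phi> \<longleftrightarrow>
     (\<forall>x y. \<phi> (x + y) = \<phi> x * \<phi> y) \<and>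
     (\<forall>x y. w ^ l dvd x - y \<longrightarrow> \<phi> x = \<phi> y) \<and>
     (\<exists>x. \<phi> (w ^ (l - 1) * x) \<noteq> 1)"

definition theta :: "nat \<Rightarrow> ('a::idom \<Rightarrow> complex) \<Rightarrow> 'a \<Rightarrow> 'a mat set \<Rightarrow> complex" where
  "theta n \<phi> a X = (let A = (SOME A. A \<in> X) in
      \<phi> (a * A $$ (0, 1) + (\<Sum>i\<in>{1..<n-1}. A $$ (i, i + 1))))"

definition is_rep :: "('g, 'b) monoid_scheme \<Rightarrow> nat \<Rightarrow> ('g \<Rightarrow> complex mat) \<Rightarrow> bool" where
  "is_rep G d \<rho> \<longleftrightarrow>
     (\<forall>x\<in>carrier G. \<rho> x \<in> carrier_mat d d) \<and> \<rho> \<one>\<^bsub>G\<^esub> = 1\<^sub>m d \<and>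
     (\<forall>x\<in>carrier G. \<forall>y\<in>carrier G. \<rho> (x \<otimes>\<^bsub>G\<^esub> y) = \<rho> x * \<rho> y)"

definition is_subspace :: "nat \<Rightarrow> complex vec set \<Rightarrow> bool" where
  "is_subspace d W \<longleftrightarrow> W \<subseteq> carrier_vec d \<and> 0\<^sub>v d \<in> W \<and>
     (\<forall>v\<in>W. \<forall>u\<in>W. v + u \<in> W) \<and> (\<forall>c. \<forall>v\<in>W. c \<cdot>\<^sub>v v \<in> W)"

definition irreducible_rep :: "('g, 'b) monoid_scheme \<Rightarrow> nat \<Rightarrow> ('g \<Rightarrow> complex mat) \<Rightarrow> bool" where
  "irreducible_rep G d \<rho> \<longleftrightarrow> is_rep G d \<rho> \<and> 0 < d \<and>
     (\<forall>W. is_subspace d W \<and> (\<forall>x\<in>carrier G. \<forall>v\<in>W. \<rho> x *\<^sub>v v \<in> W)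
          \<longrightarrow> W = {0\<^sub>v d} \<or> W = carrier_vec d)"

text \<open>Elements of Hom_G(rho, Ind_U^G theta): linear maps T from C^d to the space
 Ind_U^G theta = {f : G \<rightarrow> C. f(u x) = theta(u) f(x)} (G acting by right translation),
 normalised to be 0 outside their natural domains.\<close>
definition ind_hom ::
  "('g, 'b) monoid_scheme \<Rightarrow> 'g set \<Rightarrow> ('g \<Rightarrow> complex) \<Rightarrow> nat \<Rightarrow> ('g \<Rightarrow> complex mat)
     \<Rightarrow> (complex vec \<Rightarrow> 'g \<Rightarrow> complex) \<Rightarrow> bool" where
  "ind_hom G U \<theta> d \<rho> T \<longleftrightarrow>
     (\<forall>v. v \<notin> carrier_vec d \<longrightarrow> T v = (\<lambda>x. 0)) \<and>
     (\<forall>v x. x \<notin> carrier G \<longrightarrow> T v x = 0) \<and>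
     (\<forall>v\<in>carrier_vec d. \<forall>u\<in>carrier_vec d. T (v + u) = (\<lambda>x. T v x + T u x)) \<and>
     (\<forall>c. \<forall>v\<in>carrier_vec d. T (c \<cdot>\<^sub>v v) = (\<lambda>x. c * T v x)) \<and>
     (\<forall>v\<in>carrier_vec d. \<forall>u\<in>U. \<forall>x\<in>carrier G. T v (u \<otimes>\<^bsub>G\<^esub> x) = \<theta> u * T v x) \<and>
     (\<forall>v\<in>carrier_vec d. \<forall>g\<in>carrier G. \<forall>x\<in>carrier G. T (\<rho> g *\<^sub>v v) x = T v (x \<otimes>\<^bsub>G\<^esub> g))"

definition admits_whittaker where
  "admits_whittaker G U \<theta> d \<rho> \<longleftrightarrow> (\<exists>T. ind_hom G U \<theta> d \<rho> T \<and> T \<noteq> (\<lambda>v x. 0))"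

definition at_most_one_whittaker where
  "at_most_one_whittaker G U \<theta> d \<rho> \<longleftrightarrow>
     (\<forall>T1 T2. ind_hom G U \<theta> d \<rho> T1 \<and> ind_hom G U \<theta> d \<rho> T2 \<longrightarrow>
        (\<exists>c1 c2::complex. (c1, c2) \<noteq> (0, 0) \<and> (\<forall>v x. c1 * T1 v x + c2 * T2 v x = 0)))"

text \<open>rho restricted to K_l^i contains phi_x, where xh \<in> M_n(o) is a lift of x.
 Elements of K_l^i are the classes of lifts K = 1 + w^i Y, and
 phi_x(1 + w^i Y) = phi(w^i tr(xh Y)).\<close>
definition contains_char ::
  "'a::idom \<Rightarrow> grp_type \<Rightarrow> nat \<Rightarrow> nat \<Rightarrow> ('a \<Rightarrow> complex) \<Rightarrow> nat \<Rightarrow> ('a mat set \<Rightarrow> complex mat)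
     \<Rightarrow> nat \<Rightarrow> 'a mat \<Rightarrow> bool" where
  "contains_char w g n l \<phi> d \<rho> i xh \<longleftrightarrow>
     (\<exists>v\<in>carrier_vec d. v \<noteq> 0\<^sub>v d \<and>
        (\<forall>Y\<in>carrier_mat n n. Glift w g n l (1\<^sub>m n + w ^ i \<cdot>\<^sub>m Y) \<longrightarrow>
           \<rho> (mcls w n l (1\<^sub>m n + w ^ i \<cdot>\<^sub>m Y)) *\<^sub>v v = \<phi> (w ^ i * mtrace (xh * Y)) \<cdot>\<^sub>v v))"

text \<open>x \<in> g(o_r) (given by a lift xh) is regular: some v has v, xv, ..., x^(n-1)v an
 o_r-basis of o_r^n (spanning and linearly independent modulo w^r).\<close>
definition regular_elt :: "'a::idom \<Rightarrow> nat \<Rightarrow> nat \<Rightarrow> 'a mat \<Rightarrow> bool" where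
  "regular_elt w n r xh \<longleftrightarrow>
     (\<exists>v\<in>carrier_vec n.
        (\<forall>u\<in>carrier_vec n. \<exists>c::nat \<Rightarrow> 'a. \<forall>j<n.
            w ^ r dvd u $ j - (\<Sum>k<n. c k * ((xh ^\<^sub>m k) *\<^sub>v v) $ j)) \<and>
        (\<forall>c::nat \<Rightarrow> 'a. (\<forall>j<n. w ^ r dvd (\<Sum>k<n. c k * ((xh ^\<^sub>m k) *\<^sub>v v) $ j))
            \<longrightarrow> (\<forall>k<n. w ^ r dvd c k)))"

definition regular_rep where
  "regular_rep w g n l \<phi> d \<rho> \<longleftrightarrow>
     (\<exists>xh. glift w g n 1 xh \<and> regular_elt w n 1 xh \<and> contains_char w g n l \<phi> d \<rho> (l - 1) xh)"

definition alpha_regular_elt :: "'a::idom \<Rightarrow> grp_type \<Rightarrow> nat \<Rightarrow> nat \<Rightarrow> 'a \<Rightarrow> 'a mat \<Rightarrow> bool" where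
  "alpha_regular_elt w g n r \<alpha> xh \<longleftrightarrow> glift w g n r xh \<and>
     (\<forall>i<n. \<forall>j<n. j \<noteq> n - 1 \<longrightarrow>
        w ^ r dvd xh $$ (i, j) -
          (if i = 1 \<and> j = 0 then \<alpha> else if 2 \<le> i \<and> j = i - 1 then 1 else 0))"

definition alpha_regular_rep where
  "alpha_regular_rep w g n l \<phi> \<alpha> d \<rho> \<longleftrightarrow> regular_rep w g n l \<phi> d \<rho> \<and>
     (\<exists>xh. alpha_regular_elt w g n (l div 2) \<alpha> xh \<and>
        contains_char w g n l \<phi> d \<rho> ((l + 1) div 2) xh)"

end

theory Submission
  imports Defs "HOL-Computational_Algebra.Fundamental_Theorem_Algebra"
begin

text \<open>A Whittaker functional is a theta-equivariant vector, so everything is read off from the operator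
  E = sum over u in U of theta(u)^{-1} rho(u). Write theta(1 + e) = phi(tr(x0 e)) with x0 the
  matrix whose only nonzero entries are its subdiagonal (a, 1, ..., 1), and call x Hessenberg if it agrees with x0 below the diagonal.

  Uniqueness is a Gelfand trick over the ring o_l itself. If a double coset U h U supports
  E rho(h) E, then theta and its h-conjugate agree on a submodule, and extending linear functionals (o_l is
  self-injective) gives Hessenberg x, y with h x = y h mod w^l. The unitriangular group acts simply
  transitively on Hessenberg matrices annihilated by a given monic polynomial of degree n, since e_0 is
  cyclic for all of them; hence h is a polynomial in x up to U, and an anti-involution iota fixing theta
  also fixes the double coset. So the Hecke algebra E rho(G) E is commutative, and it acts
  irreducibly on the theta-equivariant vectors.

  For existence, a theta-equivariant vector decomposed under the abelian group K^i, i = ceil(l/2), has a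
  component with Hessenberg character x, and U moves x to companion form. Conversely, if v lies in the
  x-isotypic space then averaging k^{-1} E k v against the character x and over k in K^m returns a
  nonzero multiple of v: freeness of the U-action kills all u outside K^m, and nondegeneracy of
  tr([x, F] Y) kills those outside K^i.\<close>

section \<open>Square matrices modulo an element\<close>

text \<open>All matrices live over the domain o, and congruences modulo powers of \<open>w\<close>
  replace computation in o_l: inverses, unitriangular lifts and Krylov bases are then exact, and the
  level can change within one argument. This matters because odd l is the real obstacle. With m =
  floor(l/2) and i = ceil(l/2), the group K^m is then not abelian, while the characters phi_x live
  on K^i and see x only modulo w^m. The unitriangular u that preserve the x-isotypic space are those
  congruent to 1 modulo w^m, not only those in K^i, so theta and phi_x cannot be compared on all of
  them; the averaging over K^m closes this gap, and its error terms vanish because l \<le> 3m. For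
  SL_n the projection to trace zero needs n to be a unit, and elements of K^m must be corrected to
  determinant 1. Uniqueness uses no description of the irreducible representations and no structure
  theory of group algebras: commutativity is combined with one eigenvector, supplied by the
  fundamental theorem of algebra.\<close>

definition mcong :: "nat \<Rightarrow> 'a::comm_ring_1 \<Rightarrow> 'a mat \<Rightarrow> 'a mat \<Rightarrow> bool" where
  "mcong n q A B \<longleftrightarrow> A \<in> carrier_mat n n \<and> B \<in> carrier_mat n n \<and>
     (\<forall>i<n. \<forall>j<n. q dvd A $$ (i, j) - B $$ (i, j))"

lemma mcongI:
  "A \<in> carrier_mat n n \<Longrightarrow> B \<in> carrier_mat n n \<Longrightarrow>
   (\<And>i j. i < n \<Longrightarrow> j < n \<Longrightarrow> q dvd A $$ (i, j) - B $$ (i, j)) \<Longrightarrow> mcong n q A B"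
  by (auto simp: mcong_def)

lemma mcongD:
  assumes "mcong n q A B"
  shows "A \<in> carrier_mat n n" "B \<in> carrier_mat n n"
    "\<And>i j. i < n \<Longrightarrow> j < n \<Longrightarrow> q dvd A $$ (i, j) - B $$ (i, j)"
  using assms by (auto simp: mcong_def)

lemma mat_mult_entry:
  assumes "A \<in> carrier_mat n m" "B \<in> carrier_mat m k" "i < n" "j < k"
  shows "(A * B) $$ (i, j) = (\<Sum>t<m. A $$ (i, t) * B $$ (t, j))"
  using assms by (auto simp: scalar_prod_def atLeast0LessThan)

lemma mult_carrier_sq [simp]: "A \<in> carrier_mat n n \<Longrightarrow> B \<in> carrier_mat n n \<Longrightarrow> A * B \<in> carrier_mat n n"
  by (rule mult_carrier_mat)

lemma mult_one_sq [simp]: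
  fixes A :: "'a::comm_ring_1 mat" shows
  "A \<in> carrier_mat n n \<Longrightarrow> A * 1\<^sub>m n = A" "A \<in> carrier_mat n n \<Longrightarrow> 1\<^sub>m n * A = A"
  by simp_all

lemma mcong_refl: "A \<in> carrier_mat n n \<Longrightarrow> mcong n q A A"
  by (auto simp: mcong_def)

lemma mcong_sym: "mcong n q A B \<Longrightarrow> mcong n q B A"
  unfolding mcong_def by (metis dvd_minus_iff minus_diff_eq)

lemma mcong_trans [trans]: "mcong n q A B \<Longrightarrow> mcong n q B C \<Longrightarrow> mcong n q A C"
proof (rule mcongI)
  assume ab: "mcong n q A B" and bc: "mcong n q B C"
  show "A \<in> carrier_mat n n" "C \<in> carrier_mat n n" using ab bc by (auto simp: mcong_def)
  fix i j assume ij: "i < n" "j < n"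
  have "q dvd (A $$ (i, j) - B $$ (i, j)) + (B $$ (i, j) - C $$ (i, j))"
    by (rule dvd_add[OF mcongD(3)[OF ab ij] mcongD(3)[OF bc ij]])
  then show "q dvd A $$ (i, j) - C $$ (i, j)" by simp
qed

text \<open>Modulus 0 is allowed on purpose: each congruence lemma then specialises to an exact
  matrix identity, and intertwining arguments are carried out only once.\<close>

lemma mcong_0: "mcong n 0 A B \<Longrightarrow> A = B"
  by (auto simp: mcong_def intro!: eq_matI)

lemma mcong_dvd: "mcong n q A B \<Longrightarrow> r dvd q \<Longrightarrow> mcong n r A B"
  by (auto simp: mcong_def intro: dvd_trans)

lemma mcong_mult:
  assumes "mcong n q A B" "mcong n q C D"
  shows "mcong n q (A * C) (B * D)"
proof (rule mcongI)
  note a = mcongD[OF assms(1)] and c = mcongD[OF assms(2)]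
  show "A * C \<in> carrier_mat n n" "B * D \<in> carrier_mat n n" using a c by auto
  fix i j assume ij: "i < n" "j < n"
  have "(A * C) $$ (i, j) - (B * D) $$ (i, j)
     = (\<Sum>t<n. A $$ (i, t) * C $$ (t, j) - B $$ (i, t) * D $$ (t, j))"
    using mat_mult_entry[OF a(1) c(1) ij] mat_mult_entry[OF a(2) c(2) ij] by (simp add: sum_subtractf)
  also have "q dvd \<dots>"
  proof (rule dvd_sum)
    fix t assume "t \<in> {..<n}"
    then have "q dvd A $$ (i, t) - B $$ (i, t)" "q dvd C $$ (t, j) - D $$ (t, j)" using a(3) c(3) ij by auto
    then have "q dvd (A $$ (i, t) - B $$ (i, t)) * C $$ (t, j) + B $$ (i, t) * (C $$ (t, j) - D $$ (t, j))"
      by (intro dvd_add) auto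
    then show "q dvd A $$ (i, t) * C $$ (t, j) - B $$ (i, t) * D $$ (t, j)"
      by (simp add: algebra_simps)
  qed
  finally show "q dvd (A * C) $$ (i, j) - (B * D) $$ (i, j)" .
qed

lemma mcong_add:
  assumes "mcong n q A B" "mcong n q C D"
  shows "mcong n q (A + C) (B + D)"
proof (rule mcongI)
  note a = mcongD[OF assms(1)] and c = mcongD[OF assms(2)]
  show "A + C \<in> carrier_mat n n" "B + D \<in> carrier_mat n n" using a c by auto
  fix i j assume ij: "i < n" "j < n"
  have "q dvd (A $$ (i, j) - B $$ (i, j)) + (C $$ (i, j) - D $$ (i, j))" using a(3) c(3) ij by (intro dvd_add) auto
  then show "q dvd (A + C) $$ (i, j) - (B + D) $$ (i, j)" using a c ij by (simp add: algebra_simps)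
qed

lemma mcong_minus:
  assumes "mcong n q A B" "mcong n q C D"
  shows "mcong n q (A - C) (B - D)"
proof (rule mcongI)
  note a = mcongD[OF assms(1)] and c = mcongD[OF assms(2)]
  show "A - C \<in> carrier_mat n n" "B - D \<in> carrier_mat n n" using a c by auto
  fix i j assume ij: "i < n" "j < n"
  have "q dvd (A $$ (i, j) - B $$ (i, j)) - (C $$ (i, j) - D $$ (i, j))" by (rule dvd_diff[OF a(3)[OF ij] c(3)[OF ij]])
  then show "q dvd (A - C) $$ (i, j) - (B - D) $$ (i, j)" using a c ij by (simp add: algebra_simps)
qed

lemma mcong_add_cancel:
  assumes "A \<in> carrier_mat n n" "B \<in> carrier_mat n n" "C \<in> carrier_mat n n" "mcong n q (A + C) (B + C)"
  shows "mcong n q A B"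
  using assms by (auto simp: mcong_def)

text \<open>Scaling raises the modulus; this is how a congruence modulo \<open>w ^ mm\<close>
  becomes one modulo \<open>w ^ l\<close> after multiplication by \<open>w ^ ii\<close>.\<close>

lemma mcong_smult:
  assumes "mcong n q A B"
  shows "mcong n (c * q) (c \<cdot>\<^sub>m A) (c \<cdot>\<^sub>m B)"
proof (rule mcongI)
  note a = mcongD[OF assms]
  show "c \<cdot>\<^sub>m A \<in> carrier_mat n n" "c \<cdot>\<^sub>m B \<in> carrier_mat n n" using a by auto
  fix i j assume ij: "i < n" "j < n"
  have "c * q dvd c * (A $$ (i, j) - B $$ (i, j))" using a(3)[OF ij] by (intro mult_dvd_mono dvd_refl)
  then show "c * q dvd (c \<cdot>\<^sub>m A) $$ (i, j) - (c \<cdot>\<^sub>m B) $$ (i, j)"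
    using a ij by (simp add: right_diff_distrib)
qed

lemma mcong_smult': "mcong n q A B \<Longrightarrow> mcong n q (c \<cdot>\<^sub>m A) (c \<cdot>\<^sub>m B)"
  using mcong_smult[of n q A B c] by (rule mcong_dvd) auto

lemma mcong_transpose: "mcong n q A B \<Longrightarrow> mcong n q (transpose_mat A) (transpose_mat B)"
  by (auto simp: mcong_def)

lemma mcong_mult_left: "C \<in> carrier_mat n n \<Longrightarrow> mcong n q A B \<Longrightarrow> mcong n q (C * A) (C * B)"
  by (intro mcong_mult mcong_refl)

lemma mcong_mult_right: "C \<in> carrier_mat n n \<Longrightarrow> mcong n q A B \<Longrightarrow> mcong n q (A * C) (B * C)"
  by (intro mcong_mult mcong_refl)

lemma pow_carrier [simp]: "A \<in> carrier_mat n n \<Longrightarrow> A ^\<^sub>m k \<in> carrier_mat n n"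
  by simp

lemma pow_mat_comm:
  assumes A: "A \<in> carrier_mat n n" shows "A ^\<^sub>m k * A = A * A ^\<^sub>m k"
proof (induction k)
  case 0 then show ?case using A by simp
next
  case (Suc k)
  have "A ^\<^sub>m Suc k * A = A * A ^\<^sub>m k * A" using Suc by simp
  also have "\<dots> = A * (A ^\<^sub>m k * A)" using A by (intro assoc_mult_mat[of _ n n _ n _ n]) auto
  finally show ?case by simp
qed

lemma pow_mat_intertwine:
  assumes A: "A \<in> carrier_mat n n" "B \<in> carrier_mat n n" "M \<in> carrier_mat n n"
    and eq: "mcong n q (M * A) (B * M)"
  shows "mcong n q (M * A ^\<^sub>m k) (B ^\<^sub>m k * M)"
proof (induction k)
  case 0 then show ?case using A by (auto intro!: mcong_refl)
next
  case (Suc k)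
  note as = assoc_mult_mat[of _ n n _ n _ n]
  have "M * A ^\<^sub>m Suc k = (M * A ^\<^sub>m k) * A" using A by (simp add: as)
  also have "mcong n q \<dots> ((B ^\<^sub>m k * M) * A)" using Suc A by (intro mcong_mult_right)
  also have "(B ^\<^sub>m k * M) * A = B ^\<^sub>m k * (M * A)" using A by (simp add: as)
  also have "mcong n q \<dots> (B ^\<^sub>m k * (B * M))" using eq A by (intro mcong_mult_left) auto
  also have "B ^\<^sub>m k * (B * M) = B ^\<^sub>m Suc k * M" using A by (simp add: as)
  finally show ?case .
qed

section \<open>Finite sums of matrices\<close>

text \<open>Entrywise, so that an empty sum is the n by n zero matrix and the dimension never has to
  be recovered from the summands.\<close>

definition msum :: "nat \<Rightarrow> 'i set \<Rightarrow> ('i \<Rightarrow> 'a::comm_ring_1 mat) \<Rightarrow> 'a mat" where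
  "msum n R F = mat n n (\<lambda>(i, j). \<Sum>u\<in>R. F u $$ (i, j))"

lemma msum_carrier [simp]: "msum n R F \<in> carrier_mat n n"
  by (simp add: msum_def)

lemma msum_entry: "i < n \<Longrightarrow> j < n \<Longrightarrow> msum n R F $$ (i, j) = (\<Sum>u\<in>R. F u $$ (i, j))"
  by (simp add: msum_def)

lemma msum_left:
  assumes "A \<in> carrier_mat n n" "\<And>u. u \<in> R \<Longrightarrow> F u \<in> carrier_mat n n"
  shows "A * msum n R F = msum n R (\<lambda>u. A * F u)"
proof (rule eq_matI)
  fix i j assume "i < dim_row (msum n R (\<lambda>u. A * F u))" "j < dim_col (msum n R (\<lambda>u. A * F u))"
  then have ij: "i < n" "j < n" by (auto simp: msum_def)
  have "(A * msum n R F) $$ (i, j) = (\<Sum>t<n. A $$ (i, t) * (\<Sum>u\<in>R. F u $$ (t, j)))"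
    by (subst mat_mult_entry[of _ n n _ n]) (use assms ij in \<open>auto simp: msum_entry\<close>)
  also have "\<dots> = (\<Sum>u\<in>R. \<Sum>t<n. A $$ (i, t) * F u $$ (t, j))"
    by (simp add: sum_distrib_left sum.swap[of _ R])
  also have "\<dots> = (\<Sum>u\<in>R. (A * F u) $$ (i, j))"
    by (rule sum.cong[OF refl]) (use assms ij in \<open>auto simp: mat_mult_entry[of _ n n _ n] simp del: index_mult_mat\<close>)
  finally show "(A * msum n R F) $$ (i, j) = msum n R (\<lambda>u. A * F u) $$ (i, j)"
    using ij by (simp add: msum_entry)
qed (use assms in \<open>auto simp: msum_def\<close>)

lemma msum_right:
  assumes "A \<in> carrier_mat n n" "\<And>u. u \<in> R \<Longrightarrow> F u \<in> carrier_mat n n"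
  shows "msum n R F * A = msum n R (\<lambda>u. F u * A)"
proof (rule eq_matI)
  fix i j assume "i < dim_row (msum n R (\<lambda>u. F u * A))" "j < dim_col (msum n R (\<lambda>u. F u * A))"
  then have ij: "i < n" "j < n" by (auto simp: msum_def)
  have "(msum n R F * A) $$ (i, j) = (\<Sum>t<n. (\<Sum>u\<in>R. F u $$ (i, t)) * A $$ (t, j))"
    by (subst mat_mult_entry[of _ n n _ n]) (use assms ij in \<open>auto simp: msum_entry\<close>)
  also have "\<dots> = (\<Sum>u\<in>R. \<Sum>t<n. F u $$ (i, t) * A $$ (t, j))"
    by (simp add: sum_distrib_right sum.swap[of _ R])
  also have "\<dots> = (\<Sum>u\<in>R. (F u * A) $$ (i, j))"
    by (rule sum.cong[OF refl]) (use assms ij in \<open>auto simp: mat_mult_entry[of _ n n _ n] simp del: index_mult_mat\<close>)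
  finally show "(msum n R F * A) $$ (i, j) = msum n R (\<lambda>u. F u * A) $$ (i, j)"
    using ij by (simp add: msum_entry)
qed (use assms in \<open>auto simp: msum_def\<close>)

lemma msum_cong: "R = R' \<Longrightarrow> (\<And>u. u \<in> R' \<Longrightarrow> F u = H u) \<Longrightarrow> msum n R F = msum n R' H"
  unfolding msum_def by (auto intro!: eq_matI sum.cong)

lemma msum_smult:
  assumes "\<And>u. u \<in> R \<Longrightarrow> F u \<in> carrier_mat n n"
  shows "c \<cdot>\<^sub>m msum n R F = msum n R (\<lambda>u. c \<cdot>\<^sub>m F u)"
proof (rule eq_matI)
  fix i j assume "i < dim_row (msum n R (\<lambda>u. c \<cdot>\<^sub>m F u))" "j < dim_col (msum n R (\<lambda>u. c \<cdot>\<^sub>m F u))"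
  then have ij: "i < n" "j < n" by (auto simp: msum_def)
  have "(\<Sum>u\<in>R. c * F u $$ (i, j)) = (\<Sum>u\<in>R. (c \<cdot>\<^sub>m F u) $$ (i, j))"
    proof (rule sum.cong[OF refl])
    fix u assume "u \<in> R"
    then have "F u \<in> carrier_mat n n" by (rule assms)
    then show "c * F u $$ (i, j) = (c \<cdot>\<^sub>m F u) $$ (i, j)" using ij by auto
  qed
  then show "(c \<cdot>\<^sub>m msum n R F) $$ (i, j) = msum n R (\<lambda>u. c \<cdot>\<^sub>m F u) $$ (i, j)"
    using ij by (simp add: msum_def sum_distrib_left)
qed (auto simp: msum_def)

lemma msum_const:
  assumes "A \<in> carrier_mat n n"
  shows "msum n R (\<lambda>u. A) = of_nat (card R) \<cdot>\<^sub>m A"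
  by (rule eq_matI) (use assms in \<open>auto simp: msum_def\<close>)

lemma msum_mcong:
  assumes "\<And>u. u \<in> R \<Longrightarrow> mcong n q (F u) (H u)"
  shows "mcong n q (msum n R F) (msum n R H)"
  by (rule mcongI) (use assms in \<open>auto simp: msum_entry sum_subtractf[symmetric] mcong_def intro!: dvd_sum\<close>)

lemma msum_mult_vec:
  assumes "v \<in> carrier_vec n" "\<And>u. u \<in> R \<Longrightarrow> F u \<in> carrier_mat n n" "i < n"
  shows "(msum n R F *\<^sub>v v) $ i = (\<Sum>u\<in>R. (F u *\<^sub>v v) $ i)"
proof -
  have "(msum n R F *\<^sub>v v) $ i = (\<Sum>t<n. (\<Sum>u\<in>R. F u $$ (i, t)) * v $ t)"
    using assms by (auto simp: msum_def scalar_prod_def atLeast0LessThan)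
  also have "\<dots> = (\<Sum>u\<in>R. \<Sum>t<n. F u $$ (i, t) * v $ t)"
    by (simp add: sum_distrib_right sum.swap[of _ R])
  also have "\<dots> = (\<Sum>u\<in>R. (F u *\<^sub>v v) $ i)"
  proof (rule sum.cong[OF refl])
    fix u assume "u \<in> R"
    then have "F u \<in> carrier_mat n n" using assms by auto
    then show "(\<Sum>t<n. F u $$ (i, t) * v $ t) = (F u *\<^sub>v v) $ i"
      using assms by (auto simp: scalar_prod_def atLeast0LessThan)
  qed
  finally show ?thesis .
qed

section \<open>Trace and determinant\<close>

lemma mtrace_eq: "A \<in> carrier_mat n n \<Longrightarrow> mtrace A = (\<Sum>i<n. A $$ (i, i))"
  by (auto simp: mtrace_def)

lemma mtrace_mult:
  assumes "A \<in> carrier_mat n n" "B \<in> carrier_mat n n"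
  shows "mtrace (A * B) = (\<Sum>i<n. \<Sum>j<n. A $$ (i, j) * B $$ (j, i))"
proof -
  have "mtrace (A * B) = (\<Sum>i<n. (A * B) $$ (i, i))" using assms by (intro mtrace_eq) auto
  then show ?thesis using assms by (simp add: mat_mult_entry[of _ n n _ n] del: index_mult_mat)
qed

lemma mtrace_comm:
  assumes "A \<in> carrier_mat n n" "B \<in> carrier_mat n n"
  shows "mtrace (A * B) = mtrace (B * A)"
  unfolding mtrace_mult[OF assms] mtrace_mult[OF assms(2,1)]
  by (subst sum.swap) (simp add: mult.commute)

lemma mtrace_add:
  "A \<in> carrier_mat n n \<Longrightarrow> B \<in> carrier_mat n n \<Longrightarrow> mtrace (A + B) = mtrace A + mtrace B"
  by (auto simp: mtrace_def sum.distrib)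

lemma mtrace_minus:
  "A \<in> carrier_mat n n \<Longrightarrow> B \<in> carrier_mat n n \<Longrightarrow> mtrace (A - B) = mtrace A - mtrace B"
  by (auto simp: mtrace_def sum_subtractf)

lemma mtrace_smult: "A \<in> carrier_mat n n \<Longrightarrow> mtrace (c \<cdot>\<^sub>m A) = c * mtrace A"
  by (auto simp: mtrace_def sum_distrib_left)

lemma mtrace_one: "mtrace (1\<^sub>m n) = of_nat n"
  by (auto simp: mtrace_def)

lemma mtrace_uminus: "A \<in> carrier_mat n n \<Longrightarrow> mtrace (- A) = - mtrace (A :: 'a::comm_ring_1 mat)"
  by (auto simp: mtrace_def sum_negf)

lemma mtrace_mult_smult:
  assumes "A \<in> carrier_mat n n" "B \<in> carrier_mat n n"
  shows "mtrace (A * (c \<cdot>\<^sub>m B)) = c * mtrace (A * B)"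
  using assms by (subst mult_smult_distrib[of _ n n _ n]) (auto intro!: mtrace_smult[of _ n])

lemma mtrace_transpose: "A \<in> carrier_mat n n \<Longrightarrow> mtrace (transpose_mat A) = mtrace A"
  by (auto simp: mtrace_def)

lemma mtrace_mcong: "mcong n q A B \<Longrightarrow> q dvd mtrace A - mtrace B"
  unfolding mcong_def by (auto simp: mtrace_eq sum_subtractf[symmetric] intro!: dvd_sum)

lemma prod_one_plus_dvd:
  fixes s :: "'a::comm_ring_1"
  assumes "finite I"
  shows "s\<^sup>2 dvd (\<Prod>i\<in>I. 1 + s * y i) - (1 + s * (\<Sum>i\<in>I. y i))"
  using assms
proof (induction I rule: finite_induct)
  case empty then show ?case by simp
next
  case (insert x F)
  let ?P = "\<Prod>i\<in>F. 1 + s * y i" and ?S = "\<Sum>i\<in>F. y i"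
  have "(1 + s * y x) * ?P - (1 + s * (y x + ?S)) = (1 + s * y x) * (?P - (1 + s * ?S)) + s\<^sup>2 * (y x * ?S)"
    by (simp add: algebra_simps power2_eq_square)
  also have "s\<^sup>2 dvd \<dots>" using insert.IH by auto
  finally show ?case using insert.hyps by simp
qed

text \<open>Leibniz expansion: the identity permutation contributes the linear term up to
  \<open>s\<^sup>2\<close>, and any other permutation moves some i together with its image, which
  gives two off-diagonal factors, each divisible by \<open>s\<close>.\<close>

lemma det_one_plus:
  fixes s :: "'a::comm_ring_1"
  assumes Y: "Y \<in> carrier_mat n n"
  shows "s\<^sup>2 dvd det (1\<^sub>m n + s \<cdot>\<^sub>m Y) - (1 + s * mtrace Y)"
proof -
  let ?A = "1\<^sub>m n + s \<cdot>\<^sub>m Y"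
  let ?t = "\<lambda>p. signof p * (\<Prod>i = 0..<n. ?A $$ (i, p i))"
  let ?P = "{p. p permutes {0..<n}}"
  have A: "?A \<in> carrier_mat n n" using Y by auto
  have fin: "finite ?P" by (simp add: finite_permutations)
  have id: "id \<in> ?P" by (simp add: permutes_id)
  have "det ?A = (\<Sum>p\<in>?P. ?t p)" by (rule det_def'[OF A])
  also have "\<dots> = ?t id + (\<Sum>p\<in>?P - {id}. ?t p)" by (rule sum.remove[OF fin id])
  finally have d: "det ?A - (1 + s * mtrace Y) = (?t id - (1 + s * mtrace Y)) + (\<Sum>p\<in>?P - {id}. ?t p)"
    by simp
  have "?t id = (\<Prod>i = 0..<n. 1 + s * Y $$ (i, i))" using Y by (auto intro!: prod.cong)
  moreover have "mtrace Y = (\<Sum>i=0..<n. Y $$ (i, i))" using Y by (auto simp: mtrace_def atLeast0LessThan)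
  ultimately have 1: "s\<^sup>2 dvd ?t id - (1 + s * mtrace Y)"
    using prod_one_plus_dvd[of "{0..<n}" s "\<lambda>i. Y $$ (i, i)"] by simp
  have 2: "s\<^sup>2 dvd ?t p" if p: "p \<in> ?P - {id}" for p
  proof -
    from p have pp: "p permutes {0..<n}" and "p \<noteq> id" by auto
    then obtain i where i: "p i \<noteq> i" by (metis eq_id_iff ext)
    have inj: "inj p" using pp by (rule permutes_inj)
    have i2: "p (p i) \<noteq> p i" using i inj by (metis injD)
    have lt: "i < n" using i pp by (metis atLeastLessThan_iff not_le permutes_not_in zero_le)
    have lt2: "p i < n" using lt pp by (metis atLeastLessThan_iff permutes_in_image zero_le)
    have lt3: "p (p i) < n" using lt2 pp by (metis atLeastLessThan_iff permutes_in_image zero_le)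
    have "(\<Prod>j\<in>{i, p i}. ?A $$ (j, p j)) dvd (\<Prod>j = 0..<n. ?A $$ (j, p j))"
      using lt lt2 by (intro prod_dvd_prod_subset) auto
    moreover have "(\<Prod>j\<in>{i, p i}. ?A $$ (j, p j)) = s\<^sup>2 * (Y $$ (i, p i) * Y $$ (p i, p (p i)))"
      using i i2 lt lt2 lt3 Y by (auto simp: power2_eq_square algebra_simps)
    ultimately have "s\<^sup>2 dvd (\<Prod>j = 0..<n. ?A $$ (j, p j))" by (metis dvd_mult_left)
    then show ?thesis by simp
  qed
  show ?thesis unfolding d using 1 2 by (intro dvd_add dvd_sum) auto
qed

section \<open>Linear algebra over the truncations of a local ring\<close>

locale local_dvr =
  fixes w :: "'a::idom"
  assumes local_int: "local_int_ring w"
begin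

lemma w_nz: "w \<noteq> 0" and w_nonunit: "\<not> w dvd 1"
  using local_int by (auto simp: local_int_ring_def)

lemma unit_if_not_dvd: "\<not> w dvd x \<Longrightarrow> x dvd 1"
proof -
  assume nd: "\<not> w dvd x"
  then have "x \<noteq> 0" by auto
  then obtain u k where u: "u dvd 1" "x = u * w ^ k" using local_int by (auto simp: local_int_ring_def)
  with nd have "k = 0" by (cases k) auto
  with u show ?thesis by simp
qed

lemma not_dvd_pow_E:
  assumes "\<not> w ^ l dvd x"
  obtains u v k where "k < l" "x = u * w ^ k" "u * v = 1"
proof -
  from assms have "x \<noteq> 0" by auto
  then obtain u k where u: "u dvd 1" "x = u * w ^ k" using local_int by (auto simp: local_int_ring_def)
  then obtain v where "u * v = 1" by (metis dvdE)
  moreover have "k < l"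
  proof (rule ccontr)
    assume "\<not> k < l" then have "w ^ l dvd w ^ k" by (simp add: le_imp_power_dvd)
    with u assms show False by auto
  qed
  ultimately show ?thesis using u that by blast
qed

lemma unit_mod_imp_unit:
  assumes "unit_mod w l x" "0 < l" obtains y where "x * y = 1"
proof -
  from assms obtain b where b: "w ^ l dvd x * b - 1" by (auto simp: unit_mod_def)
  have "\<not> w dvd x"
  proof
    assume "w dvd x"
    then have "w dvd x * b" by auto
    moreover have "w dvd x * b - 1" using b assms(2) by (metis dvd_power dvd_trans)
    ultimately have "w dvd 1" by (metis diff_diff_eq2 add_diff_cancel_left' dvd_diff)
    then show False using w_nonunit by simp
  qed
  then show ?thesis using unit_if_not_dvd that by (metis dvdE)
qed

text \<open>Self-injectivity of o_l in matrix form: a linear system is solvable modulo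
  \<open>w ^ l\<close> as soon as every relation among its rows also annihilates the right-hand
  side. The induction eliminates one equation with a pivot of least valuation, since such a pivot
  divides every other entry.\<close>

lemma fredholm:
  assumes "finite J" "finite C"
    and "\<And>t. (\<forall>c\<in>C. w ^ l dvd (\<Sum>j\<in>J. t j * A j c)) \<Longrightarrow> w ^ l dvd (\<Sum>j\<in>J. t j * r j)"
  shows "\<exists>s. \<forall>j\<in>J. w ^ l dvd (\<Sum>c\<in>C. A j c * s c) - r j"
  using assms(1,3)
proof (induction "card J" arbitrary: J A r rule: less_induct)
  case less
  note fin = less.prems(1) and ann = less.prems(2)
  show ?case
  proof (cases "\<forall>j\<in>J. \<forall>c\<in>C. w ^ l dvd A j c")
    case True
    have "w ^ l dvd r j" if j: "j \<in> J" for j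
    proof -
      have "w ^ l dvd (\<Sum>i\<in>J. (if i = j then 1 else 0) * r i)"
        by (rule ann) (use True in \<open>auto intro!: dvd_sum\<close>)
      also have "(\<Sum>i\<in>J. (if i = j then 1 else 0) * r i) = (\<Sum>i\<in>J. if i = j then r i else 0)"
        by (rule sum.cong) auto
      finally show ?thesis using fin j by simp
    qed
    then show ?thesis by (intro exI[of _ "\<lambda>_. 0"]) simp
  next
    case False
    \<comment> \<open>Valuations occurring among the entries; the least one is below
      \<open>l\<close> because some entry is nonzero modulo \<open>w ^ l\<close>.\<close>
    define V where "V k \<longleftrightarrow> (\<exists>j\<in>J. \<exists>c\<in>C. \<exists>u v. A j c = u * w ^ k \<and> u * v = 1)" for k
    define k where "k = (LEAST k. V k)"
    obtain j1 c1 where jc1: "j1 \<in> J" "c1 \<in> C" "\<not> w ^ l dvd A j1 c1" using False by auto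
    obtain u1 v1 k1 where k1: "k1 < l" "A j1 c1 = u1 * w ^ k1" "u1 * v1 = 1" using not_dvd_pow_E[OF jc1(3)] .
    have V1: "V k1" using jc1 k1 by (auto simp: V_def)
    have Vk: "V k" unfolding k_def by (rule LeastI[of V, OF V1])
    have kl: "k < l" using Least_le[of V, OF V1] k1 by (simp add: k_def)
    obtain j0 c0 u v where j0: "j0 \<in> J" "c0 \<in> C" "A j0 c0 = u * w ^ k" "u * v = 1"
      using Vk by (auto simp: V_def)
    have dv: "w ^ k dvd A j c" if "j \<in> J" "c \<in> C" for j c
    proof (cases "w ^ l dvd A j c")
      case True then show ?thesis using kl by (metis dvd_trans le_imp_power_dvd less_imp_le)
    next
      case False
      obtain u' v' k' where k': "k' < l" "A j c = u' * w ^ k'" "u' * v' = 1" using not_dvd_pow_E[OF False] .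
      then have "V k'" using that by (auto simp: V_def)
      then have "k \<le> k'" unfolding k_def by (rule Least_le)
      then show ?thesis using k' by (simp add: le_imp_power_dvd)
    qed
    have "\<exists>q. A j c0 = q * A j0 c0" if jJ: "j \<in> J" for j
    proof -
      obtain e where "A j c0 = w ^ k * e" using dv[OF jJ j0(2)] by auto
      then have "A j c0 = (v * e) * A j0 c0" using j0 by (simp add: ac_simps)
      then show ?thesis by blast
    qed
    then obtain b where b: "\<And>j. j \<in> J \<Longrightarrow> A j c0 = b j * A j0 c0" by metis
    define A' where "A' j c = A j c - b j * A j0 c" for j c
    define r' where "r' j = r j - b j * r j0" for j
    let ?J = "J - {j0}"
    have fJ: "finite ?J" using fin by simp
    have sumJ: "sum f J = f j0 + sum f ?J" for f :: "_ \<Rightarrow> 'a" using fin j0 by (simp add: sum.remove)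
    have "\<exists>s. \<forall>j\<in>?J. w ^ l dvd (\<Sum>c\<in>C. A' j c * s c) - r' j"
    proof (rule less.hyps[OF _ fJ])
      show "card ?J < card J" using fin j0 by (intro card_Diff1_less)
      fix t' assume t': "\<forall>c\<in>C. w ^ l dvd (\<Sum>j\<in>?J. t' j * A' j c)"
      \<comment> \<open>The coefficient at the pivot row is forced: it turns a relation among the
        reduced rows into a relation among all rows with the same value on the right-hand
        side.\<close>
      define t where "t j = (if j = j0 then - (\<Sum>j\<in>?J. t' j * b j) else t' j)" for j
      have red: "(\<Sum>j\<in>J. t j * B j) = (\<Sum>j\<in>?J. t' j * (B j - b j * B j0))" for B :: "_ \<Rightarrow> 'a"
      proof -
        have "(\<Sum>j\<in>J. t j * B j) = t j0 * B j0 + (\<Sum>j\<in>?J. t j * B j)" by (rule sumJ)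
        also have "(\<Sum>j\<in>?J. t j * B j) = (\<Sum>j\<in>?J. t' j * B j)" by (rule sum.cong) (auto simp: t_def)
        also have "t j0 * B j0 = - (\<Sum>j\<in>?J. t' j * b j * B j0)" by (simp add: t_def sum_distrib_right)
        finally show ?thesis by (simp add: right_diff_distrib sum_subtractf mult.assoc)
      qed
      have "w ^ l dvd (\<Sum>j\<in>J. t j * r j)"
        by (rule ann) (use t' in \<open>simp add: red A'_def\<close>)
      then show "w ^ l dvd (\<Sum>j\<in>?J. t' j * r' j)" by (simp add: red r'_def)
    qed
    then obtain s' where s': "\<And>j. j \<in> ?J \<Longrightarrow> w ^ l dvd (\<Sum>c\<in>C. A' j c * s' c) - r' j" by auto
    have wl: "w ^ l = w ^ (l - k) * w ^ k" using kl by (simp add: power_add[symmetric])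
    \<comment> \<open>The multiple \<open>w ^ (l - k)\<close> of the pivot row vanishes modulo
      \<open>w ^ l\<close>, so this one-term relation forces \<open>r j0\<close> to be divisible by
      \<open>w ^ k\<close>, which is what solving for the pivot unknown requires.\<close>
    have "w ^ l dvd (\<Sum>j\<in>J. (if j = j0 then w ^ (l - k) else 0) * r j)"
    proof (rule ann, rule ballI)
      fix c assume c: "c \<in> C"
      have "(\<Sum>j\<in>J. (if j = j0 then w ^ (l - k) else 0) * A j c) = w ^ (l - k) * A j0 c"
        using fin j0 by (subst sumJ) (auto intro!: sum.neutral)
      moreover have "w ^ l dvd w ^ (l - k) * A j0 c" unfolding wl using dv[OF j0(1) c] by (rule mult_dvd_mono[OF dvd_refl])
      ultimately show "w ^ l dvd (\<Sum>j\<in>J. (if j = j0 then w ^ (l - k) else 0) * A j c)" by simp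
    qed
    also have "(\<Sum>j\<in>J. (if j = j0 then w ^ (l - k) else 0) * r j) = w ^ (l - k) * r j0"
      using fin j0 by (subst sumJ) (auto intro!: sum.neutral)
    finally have rk: "w ^ k dvd r j0" unfolding wl using w_nz by simp
    have "w ^ k dvd r j0 - (\<Sum>c\<in>C - {c0}. A j0 c * s' c)"
      using rk dv j0 by (intro dvd_diff dvd_sum) auto
    then obtain e where e: "r j0 - (\<Sum>c\<in>C - {c0}. A j0 c * s' c) = w ^ k * e" by auto
    \<comment> \<open>The pivot unknown solves its own equation exactly; the reduced equations do
      not see it, their coefficient in column \<open>c0\<close> being zero.\<close>
    define s where "s c = (if c = c0 then v * e else s' c)" for c
    have sumC: "sum f C = f c0 + sum f (C - {c0})" for f :: "_ \<Rightarrow> 'a" using assms(2) j0 by (simp add: sum.remove)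
    have eq0: "(\<Sum>c\<in>C. A j0 c * s c) = r j0"
    proof -
      have "(\<Sum>c\<in>C. A j0 c * s c) = A j0 c0 * (v * e) + (\<Sum>c\<in>C - {c0}. A j0 c * s c)"
        by (subst sumC) (simp add: s_def)
      also have "(\<Sum>c\<in>C - {c0}. A j0 c * s c) = (\<Sum>c\<in>C - {c0}. A j0 c * s' c)"
        by (rule sum.cong) (auto simp: s_def)
      also have "A j0 c0 * (v * e) = (u * v) * (w ^ k * e)" using j0 by (simp add: ac_simps)
      finally show ?thesis using e j0 by (simp add: algebra_simps)
    qed
    have "w ^ l dvd (\<Sum>c\<in>C. A j c * s c) - r j" if j: "j \<in> J" for j
    proof (cases "j = j0")
      case True then show ?thesis using eq0 by simp
    next
      case False
      then have jJ: "j \<in> ?J" using j by simp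
      have z: "A' j c0 = 0" using b[OF j] by (simp add: A'_def)
      have "(\<Sum>c\<in>C. A' j c * s c) = (\<Sum>c\<in>C. A' j c * s' c)"
        by (rule sum.cong) (use z in \<open>auto simp: s_def\<close>)
      moreover have "(\<Sum>c\<in>C. A' j c * s c) = (\<Sum>c\<in>C. A j c * s c) - b j * r j0"
        unfolding eq0[symmetric] by (simp add: A'_def left_diff_distrib sum_subtractf sum_distrib_left mult.assoc)
      ultimately have "(\<Sum>c\<in>C. A j c * s c) - r j = (\<Sum>c\<in>C. A' j c * s' c) - r' j"
        by (simp add: r'_def algebra_simps)
      then show ?thesis using s'[OF jJ] by simp
    qed
    then show ?thesis by blast
  qed
qed

lemma finite_residues: "\<exists>T. finite T \<and> (\<forall>x. \<exists>t\<in>T. w ^ l dvd x - t)"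
proof (induction l)
  case 0
  show ?case by (intro exI[of _ "{0}"]) auto
next
  case (Suc l)
  then obtain T where T: "finite T" "\<And>x. \<exists>t\<in>T. w ^ l dvd x - t" by auto
  obtain S where S: "finite S" "\<And>x. \<exists>s\<in>S. w dvd x - s" using local_int by (auto simp: local_int_ring_def)
  have "\<exists>t\<in>(\<lambda>(t, s). t + w ^ l * s) ` (T \<times> S). w ^ Suc l dvd x - t" for x
  proof -
    obtain t y where t: "t \<in> T" "x - t = w ^ l * y" using T(2)[of x] by (metis dvdE)
    obtain s z where s: "s \<in> S" "y - s = w * z" using S(2)[of y] by (metis dvdE)
    have "x - (t + w ^ l * s) = w ^ l * (y - s)" using t by (simp add: algebra_simps)
    then have "x - (t + w ^ l * s) = w ^ Suc l * z" using s by (simp add: ac_simps)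
    then have "w ^ Suc l dvd x - (t + w ^ l * s)" by simp
    then show ?thesis using t s by (intro bexI[of _ "t + w ^ l * s"]) auto
  qed
  then show ?case using T S by (intro exI[of _ "(\<lambda>(t, s). t + w ^ l * s) ` (T \<times> S)"]) auto
qed

end

section \<open>Representatives modulo congruence\<close>

text \<open>Sums over finite quotients are taken over matrices chosen inside \<open>B\<close>, one
  for each class meeting \<open>B\<close>, so that membership in \<open>B\<close> (unitriangularity,
  for instance) holds exactly for the summation variable.\<close>

definition mrep :: "nat \<Rightarrow> 'a::comm_ring_1 \<Rightarrow> 'a mat set \<Rightarrow> 'a mat \<Rightarrow> 'a mat" where
  "mrep n q B A = (SOME C. C \<in> B \<and> mcong n q A C)"

definition mreps :: "nat \<Rightarrow> 'a::comm_ring_1 \<Rightarrow> 'a mat set \<Rightarrow> 'a mat set" where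
  "mreps n q B = mrep n q B ` B"

lemma mrep:
  assumes "B \<subseteq> carrier_mat n n" "A \<in> B"
  shows "mrep n q B A \<in> B" "mcong n q A (mrep n q B A)"
proof -
  have "A \<in> B \<and> mcong n q A A" using assms by (auto intro: mcong_refl)
  then have "mrep n q B A \<in> B \<and> mcong n q A (mrep n q B A)" unfolding mrep_def by (rule someI)
  then show "mrep n q B A \<in> B" "mcong n q A (mrep n q B A)" by auto
qed

lemma mrep_eq: "mcong n q A A' \<Longrightarrow> mrep n q B A = mrep n q B A'"
proof -
  assume "mcong n q A A'"
  then have "mcong n q A C \<longleftrightarrow> mcong n q A' C" for C by (meson mcong_sym mcong_trans)
  then show ?thesis by (simp add: mrep_def)
qed

lemma mreps_subset: "B \<subseteq> carrier_mat n n \<Longrightarrow> mreps n q B \<subseteq> B"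
  using mrep by (auto simp: mreps_def)

lemma mreps_inj:
  assumes "B \<subseteq> carrier_mat n n" "A \<in> mreps n q B" "A' \<in> mreps n q B" "mcong n q A A'"
  shows "A = A'"
proof -
  from assms obtain C C' where C: "C \<in> B" "C' \<in> B" "A = mrep n q B C" "A' = mrep n q B C'"
    by (auto simp: mreps_def)
  have "mcong n q C C'" using mrep(2)[OF assms(1)] C assms(4) by (metis mcong_sym mcong_trans)
  then show ?thesis using C by (auto intro: mrep_eq)
qed

text \<open>The class of a matrix is determined by its entries reduced to a finite residue
  system.\<close>

lemma (in local_dvr) finite_mreps:
  assumes B: "B \<subseteq> carrier_mat n n" shows "finite (mreps n (w ^ l) B)"
proof -
  obtain T where T: "finite T" "\<And>x. \<exists>t\<in>T. w ^ l dvd x - t" using finite_residues by blast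
  then obtain f where f: "\<And>x. f x \<in> T" "\<And>x. w ^ l dvd x - f x" by metis
  define h where "h A = mat n n (\<lambda>ij. f (A $$ ij))" for A :: "'a mat"
  have c: "mcong n (w ^ l) A (h A)" if "A \<in> B" for A
    using that B f by (auto simp: mcong_def h_def)
  have "mreps n (w ^ l) B = mrep n (w ^ l) B ` h ` B"
    unfolding mreps_def image_image by (rule image_cong[OF refl]) (rule mrep_eq[OF c])
  moreover have "h ` B \<subseteq> mat n n ` (({..<n} \<times> {..<n}) \<rightarrow>\<^sub>E T)"
  proof
    fix X assume "X \<in> h ` B"
    then obtain A where A: "A \<in> B" "X = h A" by auto
    have "X = mat n n (restrict (\<lambda>ij. f (A $$ ij)) ({..<n} \<times> {..<n}))"
      unfolding A h_def by (rule cong_mat) auto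
    moreover have "restrict (\<lambda>ij. f (A $$ ij)) ({..<n} \<times> {..<n}) \<in> ({..<n} \<times> {..<n}) \<rightarrow>\<^sub>E T"
      using f by auto
    ultimately show "X \<in> mat n n ` (({..<n} \<times> {..<n}) \<rightarrow>\<^sub>E T)" by blast
  qed
  moreover have "finite (mat n n ` (({..<n} \<times> {..<n}) \<rightarrow>\<^sub>E T))"
    using T by (intro finite_imageI finite_PiE) auto
  ultimately show ?thesis by (metis finite_imageI finite_subset)
qed

text \<open>Change of variables on a finite quotient: a self-map that is injective on classes
  permutes the finite set of representatives.\<close>

lemma sum_mreps_reindex:
  assumes B: "B \<subseteq> carrier_mat n n" and fin: "finite (mreps n q B)"
    and f: "\<And>A. A \<in> B \<Longrightarrow> f A \<in> B"
    and f_inj: "\<And>A A'. A \<in> B \<Longrightarrow> A' \<in> B \<Longrightarrow> mcong n q (f A) (f A') \<Longrightarrow> mcong n q A A'"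
    and F: "\<And>A A'. A \<in> B \<Longrightarrow> A' \<in> B \<Longrightarrow> mcong n q A A' \<Longrightarrow> F A = F A'"
  shows "(\<Sum>A\<in>mreps n q B. F (f A)) = (\<Sum>A\<in>mreps n q B. F A)"
proof -
  let ?R = "mreps n q B"
  let ?h = "\<lambda>A. mrep n q B (f A)"
  note sub = mreps_subset[OF B, of q]
  have inj: "inj_on ?h ?R"
  proof (rule inj_onI)
    fix A A' assume A: "A \<in> ?R" "A' \<in> ?R" "?h A = ?h A'"
    have AB: "A \<in> B" "A' \<in> B" using A sub by auto
    have "mcong n q (f A) (?h A)" "mcong n q (f A') (?h A')" using mrep(2)[OF B] f AB by auto
    then have "mcong n q (f A) (f A')" using A(3) by (metis mcong_sym mcong_trans)
    then have "mcong n q A A'" using f_inj AB by auto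
    then show "A = A'" using mreps_inj[OF B A(1,2)] by simp
  qed
  have "?h ` ?R \<subseteq> ?R" using sub f by (auto simp: mreps_def)
  then have img: "?h ` ?R = ?R" using inj fin by (simp add: endo_inj_surj)
  have "(\<Sum>A\<in>?R. F A) = (\<Sum>A\<in>?R. F (?h A))" by (subst img[symmetric], subst sum.reindex[OF inj]) simp
  also have "\<dots> = (\<Sum>A\<in>?R. F (f A))"
  proof (rule sum.cong[OF refl])
    fix A assume "A \<in> ?R"
    then have "A \<in> B" using sub by auto
    then show "F (?h A) = F (f A)" using mrep[OF B f] F f by (metis mcong_sym)
  qed
  finally show ?thesis by simp
qed

text \<open>Translating the summation variable by \<open>Z\<close> multiplies the sum by
  \<open>\<chi> Z\<close>, which differs from 1.\<close>

lemma sum_character_eq_0: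
  fixes \<chi> :: "'a::comm_ring_1 mat \<Rightarrow> complex"
  assumes fin: "finite (mreps n q (carrier_mat n n))"
    and add: "\<And>Y Z. Y \<in> carrier_mat n n \<Longrightarrow> Z \<in> carrier_mat n n \<Longrightarrow> \<chi> (Y + Z) = \<chi> Y * \<chi> Z"
    and per: "\<And>Y Z. mcong n q Y Z \<Longrightarrow> \<chi> Y = \<chi> Z"
    and Z: "Z \<in> carrier_mat n n" "\<chi> Z \<noteq> 1"
  shows "(\<Sum>Y\<in>mreps n q (carrier_mat n n). \<chi> Y) = 0"
proof -
  let ?R = "mreps n q (carrier_mat n n)"
  have sub: "?R \<subseteq> carrier_mat n n" using mreps_subset[of "carrier_mat n n" n q] by auto
  have "(\<Sum>Y\<in>?R. \<chi> (Y + Z)) = (\<Sum>Y\<in>?R. \<chi> Y)"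
  proof (rule sum_mreps_reindex[OF _ fin])
    fix A A' assume A: "A \<in> carrier_mat n n" "A' \<in> carrier_mat n n" "mcong n q (A + Z) (A' + Z)"
    then show "mcong n q A A'" using mcong_add_cancel[OF _ _ Z(1)] by blast
  qed (use Z per in auto)
  moreover have "(\<Sum>Y\<in>?R. \<chi> (Y + Z)) = (\<Sum>Y\<in>?R. \<chi> Y) * \<chi> Z"
    unfolding sum_distrib_right by (rule sum.cong) (use add Z sub in auto)
  ultimately have "(\<Sum>Y\<in>?R. \<chi> Y) * (\<chi> Z - 1) = 0" by (simp add: algebra_simps)
  then show ?thesis using Z by simp
qed

section \<open>Unitriangular and Hessenberg matrices\<close>

text \<open>Lifts of the unitriangular group to o. The diagonal and lower entries are exact, so that
  the determinant is 1 and inverses exist over o.\<close>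

definition uni :: "nat \<Rightarrow> 'a::comm_ring_1 mat set" where
  "uni n = {A \<in> carrier_mat n n. \<forall>i<n. A $$ (i, i) = 1 \<and> (\<forall>j<i. A $$ (i, j) = 0)}"

definition strict_upper :: "nat \<Rightarrow> 'a::comm_ring_1 mat set" where
  "strict_upper n = {A \<in> carrier_mat n n. \<forall>i<n. \<forall>j\<le>i. A $$ (i, j) = 0}"

lemma uni_carrier: "A \<in> uni n \<Longrightarrow> A \<in> carrier_mat n n"
  by (auto simp: uni_def)

lemma uni_one: "1\<^sub>m n \<in> uni n"
  by (auto simp: uni_def)

lemma uni_sub: "uni n \<subseteq> carrier_mat n n"
  by (auto simp: uni_def)

lemma uni_mult_entry:
  assumes "A \<in> uni n" "B \<in> carrier_mat n n" "i < n" "j < n"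
  shows "(A * B) $$ (i, j) = B $$ (i, j) + (\<Sum>t\<in>{i<..<n}. A $$ (i, t) * B $$ (t, j))"
proof -
  have "(A * B) $$ (i, j) = (\<Sum>t<n. A $$ (i, t) * B $$ (t, j))"
    using assms by (intro mat_mult_entry) (auto simp: uni_def)
  also have "{..<n} = {..<i} \<union> ({i} \<union> {i<..<n})" using assms by auto
  also have "(\<Sum>t\<in>{..<i} \<union> ({i} \<union> {i<..<n}). A $$ (i, t) * B $$ (t, j))
      = (\<Sum>t<i. A $$ (i, t) * B $$ (t, j)) + (A $$ (i, i) * B $$ (i, j) + (\<Sum>t\<in>{i<..<n}. A $$ (i, t) * B $$ (t, j)))"
    by (subst sum.union_disjoint, simp, simp, force) (subst sum.union_disjoint, auto)
  also have "(\<Sum>t<i. A $$ (i, t) * B $$ (t, j)) = 0"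
    using assms by (intro sum.neutral) (auto simp: uni_def)
  finally show ?thesis using assms by (simp add: uni_def)
qed

lemma uni_mult:
  assumes "A \<in> uni n" "B \<in> uni n" shows "A * B \<in> uni n"
proof -
  have c: "A \<in> carrier_mat n n" "B \<in> carrier_mat n n" using assms by (auto simp: uni_def)
  have "(A * B) $$ (i, j) = B $$ (i, j)" if "i < n" "j \<le> i" for i j
    unfolding uni_mult_entry[OF assms(1) c(2) that(1) le_less_trans[OF that(2,1)]]
    using assms(2) that by (auto simp: uni_def intro!: sum.neutral)
  then show ?thesis using assms c by (auto simp: uni_def)
qed

lemma det_uni: "A \<in> uni n \<Longrightarrow> det A = 1"
proof -
  assume A: "A \<in> uni n"
  then have c: "A \<in> carrier_mat n n" by (auto simp: uni_def)
  have "det A = prod_list (diag_mat A)"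
    using A by (intro det_upper_triangular[OF _ c]) (auto simp: uni_def upper_triangular_def)
  also have "diag_mat A = map (\<lambda>i. 1) [0..<n]" using A by (auto simp: diag_mat_def uni_def)
  finally show ?thesis by (simp add: map_replicate_const)
qed

lemma inverse_mat_exists:
  fixes A :: "'a::comm_ring_1 mat"
  assumes A: "A \<in> carrier_mat n n" and d: "det A * e = 1"
  obtains B where "B \<in> carrier_mat n n" "A * B = 1\<^sub>m n" "B * A = 1\<^sub>m n"
proof
  let ?B = "e \<cdot>\<^sub>m adj_mat A"
  note ad = adj_mat[OF A]
  show "?B \<in> carrier_mat n n" using ad by auto
  have "A * ?B = e \<cdot>\<^sub>m (A * adj_mat A)" using A ad by (intro mult_smult_distrib)
  then show "A * ?B = 1\<^sub>m n" using ad d by (auto simp: ac_simps intro!: eq_matI)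
  have "?B * A = e \<cdot>\<^sub>m (adj_mat A * A)" using A ad by (intro mult_smult_assoc_mat)
  then show "?B * A = 1\<^sub>m n" using ad d by (auto simp: ac_simps intro!: eq_matI)
qed

text \<open>Column by column: in column k the entries of \<open>V\<close> further left already
  vanish in row i and the lower entries of \<open>A\<close> are zero, so only
  \<open>V $$ (i, k) * A $$ (k, k)\<close> remains, and a nonzero diagonal entry can be cancelled in
  a domain.\<close>

lemma upper_quotient_uni:
  fixes A :: "'a::idom mat"
  assumes c: "A \<in> carrier_mat n n" "C \<in> carrier_mat n n" "V \<in> carrier_mat n n"
    and up: "\<And>i j. i < n \<Longrightarrow> j < i \<Longrightarrow> A $$ (i, j) = 0" "\<And>i j. i < n \<Longrightarrow> j < i \<Longrightarrow> C $$ (i, j) = 0"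
    and dg: "\<And>i. i < n \<Longrightarrow> A $$ (i, i) = C $$ (i, i)" "\<And>i. i < n \<Longrightarrow> A $$ (i, i) \<noteq> 0"
    and VA: "V * A = C"
  shows "V \<in> uni n"
proof -
  have main: "\<forall>i<n. k \<le> i \<longrightarrow> V $$ (i, k) = (if i = k then 1 else 0)" if "k < n" for k
    using that
  proof (induction k rule: less_induct)
    case (less k)
    show ?case
    proof (intro allI impI)
      fix i assume i: "i < n" "k \<le> i"
      have "C $$ (i, k) = (\<Sum>t<n. V $$ (i, t) * A $$ (t, k))"
        unfolding VA[symmetric] using c i less.prems by (intro mat_mult_entry) auto
      also have "\<dots> = (\<Sum>t\<in>{k}. V $$ (i, t) * A $$ (t, k))"
      proof (rule sum.mono_neutral_right)
        show "\<forall>t\<in>{..<n} - {k}. V $$ (i, t) * A $$ (t, k) = 0"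
        proof
          fix t assume t: "t \<in> {..<n} - {k}"
          show "V $$ (i, t) * A $$ (t, k) = 0"
          proof (cases "t < k")
            case True then show ?thesis using less.IH[of t] i less.prems by auto
          next
            case False then show ?thesis using up(1)[of t k] t by auto
          qed
        qed
      qed (use less.prems in auto)
      finally have e: "C $$ (i, k) = V $$ (i, k) * A $$ (k, k)" by simp
      show "V $$ (i, k) = (if i = k then 1 else 0)"
      proof (cases "i = k")
        case True then show ?thesis using e dg[of k] less.prems by simp
      next
        case False then show ?thesis using e up(2)[of i k] i dg(2)[of k] less.prems by simp
      qed
    qed
  qed
  show ?thesis using main c by (auto simp: uni_def)
qed

lemma uni_inverse:
  fixes A :: "'a::idom mat"
  assumes A: "A \<in> uni n"
  obtains B where "B \<in> uni n" "A * B = 1\<^sub>m n" "B * A = 1\<^sub>m n"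
proof -
  have c: "A \<in> carrier_mat n n" using A by (auto simp: uni_def)
  obtain B where B: "B \<in> carrier_mat n n" "A * B = 1\<^sub>m n" "B * A = 1\<^sub>m n"
    using inverse_mat_exists[OF c, of 1] det_uni[OF A] by auto
  have "B \<in> uni n" by (rule upper_quotient_uni[OF c one_carrier_mat B(1) _ _ _ _ B(3)]) (use A in \<open>auto simp: uni_def\<close>)
  then show ?thesis using that B by blast
qed

lemma uni_one_plus: "E \<in> strict_upper n \<Longrightarrow> 1\<^sub>m n + E \<in> uni n"
  by (auto simp: uni_def strict_upper_def)

lemma strict_upper_smult: "E \<in> strict_upper n \<Longrightarrow> c \<cdot>\<^sub>m E \<in> strict_upper n"
  by (auto simp: strict_upper_def)

section \<open>Polynomials of degree below n in a matrix\<close>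

definition pl :: "nat \<Rightarrow> (nat \<Rightarrow> 'a::comm_ring_1) \<Rightarrow> 'a mat \<Rightarrow> 'a mat" where
  "pl n c x = msum n {..<n} (\<lambda>k. c k \<cdot>\<^sub>m x ^\<^sub>m k)"

lemma pl_carrier [simp]: "pl n c x \<in> carrier_mat n n"
  by (simp add: pl_def)

lemma pl_intertwine:
  assumes x: "x \<in> carrier_mat n n" "y \<in> carrier_mat n n" "g \<in> carrier_mat n n"
    and e: "mcong n q (g * x) (y * g)"
  shows "mcong n q (g * pl n c x) (pl n c y * g)"
proof -
  have "g * pl n c x = msum n {..<n} (\<lambda>k. g * (c k \<cdot>\<^sub>m x ^\<^sub>m k))"
    unfolding pl_def using x by (intro msum_left) auto
  also have "\<dots> = msum n {..<n} (\<lambda>k. c k \<cdot>\<^sub>m (g * x ^\<^sub>m k))"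
    using x by (intro msum_cong refl mult_smult_distrib) auto
  also have "mcong n q \<dots> (msum n {..<n} (\<lambda>k. c k \<cdot>\<^sub>m (y ^\<^sub>m k * g)))"
    by (intro msum_mcong mcong_smult' pow_mat_intertwine x e)
  also have "msum n {..<n} (\<lambda>k. c k \<cdot>\<^sub>m (y ^\<^sub>m k * g)) = msum n {..<n} (\<lambda>k. (c k \<cdot>\<^sub>m y ^\<^sub>m k) * g)"
    using x by (intro msum_cong refl) (subst mult_smult_assoc_mat[of _ n n _ n], auto)
  also have "\<dots> = pl n c y * g"
    unfolding pl_def using x by (intro msum_right[symmetric]) auto
  finally show ?thesis .
qed

lemma pl_comm: "x \<in> carrier_mat n n \<Longrightarrow> x * pl n c x = pl n c x * x"
  by (intro mcong_0[of n] pl_intertwine mcong_refl) auto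

lemma transpose_pow:
  fixes x :: "'a::comm_ring_1 mat"
  assumes "x \<in> carrier_mat n n"
  shows "transpose_mat (x ^\<^sub>m k) = (transpose_mat x) ^\<^sub>m k"
proof (induction k)
  case 0 then show ?case using assms by simp
next
  case (Suc k)
  have "transpose_mat (x ^\<^sub>m Suc k) = transpose_mat (x * x ^\<^sub>m k)" using pow_mat_comm[OF assms] by simp
  also have "\<dots> = transpose_mat (x ^\<^sub>m k) * transpose_mat x"
    by (rule transpose_mult) (use assms in auto)
  finally show ?case using Suc by simp
qed

lemma transpose_pl:
  assumes "x \<in> carrier_mat n n"
  shows "transpose_mat (pl n c x) = pl n c (transpose_mat x)"
proof (rule eq_matI)
  fix i j assume "i < dim_row (pl n c (transpose_mat x))" "j < dim_col (pl n c (transpose_mat x))"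
  then have ij: "i < n" "j < n" by (auto simp: pl_def msum_def)
  have "(x ^\<^sub>m k) $$ (j, i) = (transpose_mat x ^\<^sub>m k) $$ (i, j)" for k
    using assms ij by (simp add: transpose_pow[symmetric])
  then show "transpose_mat (pl n c x) $$ (i, j) = pl n c (transpose_mat x) $$ (i, j)"
    using ij assms by (simp add: pl_def msum_def)
qed (auto simp: pl_def msum_def)

section \<open>Hessenberg matrices and their cyclic vector\<close>

locale hessenberg =
  fixes n :: nat and a b :: "'a::idom"
  assumes n2: "2 \<le> n" and ab: "a * b = 1"
begin

definition x0 :: "'a mat" where
  "x0 = mat n n (\<lambda>(i, j). if i = Suc j then (if j = 0 then a else 1) else 0)"

text \<open>Agreement below the diagonal is exact; matrices that are Hessenberg only modulo a power
  of \<open>w\<close> are first replaced by such a representative.\<close>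

definition hess :: "'a mat set" where
  "hess = {x \<in> carrier_mat n n. \<forall>i<n. \<forall>j<i. x $$ (i, j) = x0 $$ (i, j)}"

text \<open>The change of basis to e_0, x e_0, ..., x^(n-1) e_0, where e_0 is the first basis
  vector; for Hessenberg \<open>x\<close> it is upper triangular with units on the diagonal.\<close>

definition krylov :: "'a mat \<Rightarrow> 'a mat" where
  "krylov x = mat n n (\<lambda>(i, k). (x ^\<^sub>m k) $$ (i, 0))"

lemma a_nz: "a \<noteq> 0" using ab by auto

lemma x0_carrier [simp]: "x0 \<in> carrier_mat n n" by (simp add: x0_def)
lemma krylov_carrier [simp]: "krylov x \<in> carrier_mat n n" by (simp add: krylov_def)
lemma hess_carrier: "x \<in> hess \<Longrightarrow> x \<in> carrier_mat n n" by (simp add: hess_def)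

text \<open>Each application of \<open>x\<close> pushes the leading entry one step down and
  multiplies it by a subdiagonal entry of \<open>x\<close>. Only the first of these is
  \<open>a\<close>, so the leading entry is \<open>a\<close> from k = 1 on.\<close>

lemma hess_pow:
  assumes x: "x \<in> hess" and i: "i < n" "k \<le> i"
  shows "(x ^\<^sub>m k) $$ (i, 0) = (if i = k then if k = 0 then 1 else a else 0)"
  using i
proof (induction k arbitrary: i)
  case 0 then show ?case using x by (auto simp: hess_def)
next
  case (Suc k)
  have c: "x \<in> carrier_mat n n" using x by (simp add: hess_def)
  have "(x ^\<^sub>m Suc k) $$ (i, 0) = (x * x ^\<^sub>m k) $$ (i, 0)" using pow_mat_comm[OF c] by simp
  also have "\<dots> = (\<Sum>t<n. x $$ (i, t) * (x ^\<^sub>m k) $$ (t, 0))"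
    using c Suc.prems by (intro mat_mult_entry) auto
  also have "\<dots> = (\<Sum>t\<in>{k}. x $$ (i, t) * (x ^\<^sub>m k) $$ (t, 0))"
  proof (rule sum.mono_neutral_right)
    show "\<forall>t\<in>{..<n} - {k}. x $$ (i, t) * (x ^\<^sub>m k) $$ (t, 0) = 0"
    proof
      fix t assume t: "t \<in> {..<n} - {k}"
      show "x $$ (i, t) * (x ^\<^sub>m k) $$ (t, 0) = 0"
      proof (cases "t < k")
        case True then show ?thesis using x Suc.prems by (auto simp: hess_def x0_def)
      next
        case False then show ?thesis using Suc.IH[of t] t by auto
      qed
    qed
  qed (use Suc.prems in auto)
  also have "\<dots> = x $$ (i, k) * (if k = 0 then 1 else a)" using Suc.IH[of k] Suc.prems by simp
  also have "x $$ (i, k) = x0 $$ (i, k)" using x Suc.prems by (auto simp: hess_def)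
  finally show ?case using Suc.prems by (auto simp: x0_def)
qed

lemma krylov_inverse:
  assumes x: "x \<in> hess"
  obtains K where "K \<in> carrier_mat n n" "krylov x * K = 1\<^sub>m n" "K * krylov x = 1\<^sub>m n"
proof -
  have "det (krylov x) = prod_list (diag_mat (krylov x))"
    using hess_pow[OF x] by (intro det_upper_triangular[of _ n]) (auto simp: upper_triangular_def krylov_def)
  also have "diag_mat (krylov x) = map (\<lambda>i. if i = 0 then 1 else a) [0..<n]"
    using hess_pow[OF x] by (auto simp: diag_mat_def krylov_def)
  also have "[0..<n] = 0 # [1..<n]" using n2 by (simp add: upt_conv_Cons)
  also have "prod_list (map (\<lambda>i. if i = 0 then 1 else a) (0 # [1..<n])) = a ^ (n - 1)"
  proof -
    have "map (\<lambda>i. if i = 0 then 1 else a) [1..<n] = map (\<lambda>i. a) [1..<n]" by (rule map_cong) auto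
    then show ?thesis by (simp add: map_replicate_const)
  qed
  finally have "det (krylov x) * b ^ (n - 1) = 1" by (simp add: power_mult_distrib[symmetric] ab)
  then show ?thesis using inverse_mat_exists[OF krylov_carrier] that by blast
qed

lemma krylov_mult_entry:
  assumes x: "x \<in> carrier_mat n n" and M: "M \<in> carrier_mat n n" and "i < n" "k < n"
  shows "(M * krylov x) $$ (i, k) = (M * x ^\<^sub>m k) $$ (i, 0)"
proof -
  have "(M * krylov x) $$ (i, k) = (\<Sum>t<n. M $$ (i, t) * krylov x $$ (t, k))"
    using assms by (intro mat_mult_entry) auto
  also have "\<dots> = (\<Sum>t<n. M $$ (i, t) * (x ^\<^sub>m k) $$ (t, 0))"
    using assms by (auto simp: krylov_def)
  also have "\<dots> = (M * x ^\<^sub>m k) $$ (i, 0)"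
    using assms n2 by (intro mat_mult_entry[symmetric]) auto
  finally show ?thesis .
qed

lemma krylov_cancel:
  assumes x: "x \<in> hess" and M: "M \<in> carrier_mat n n" "N \<in> carrier_mat n n"
    and e: "mcong n q (M * krylov x) (N * krylov x)"
  shows "mcong n q M N"
proof -
  obtain K where K: "K \<in> carrier_mat n n" "krylov x * K = 1\<^sub>m n" using krylov_inverse[OF x] by metis
  have "M = M * krylov x * K" using M K by (simp add: assoc_mult_mat[of M n n _ n _ n])
  also have "mcong n q \<dots> (N * krylov x * K)" by (rule mcong_mult_right[OF K(1) e])
  also have "N * krylov x * K = N" using M K by (simp add: assoc_mult_mat[of _ n n _ n _ n])
  finally show ?thesis .
qed

text \<open>An intertwiner is determined by its value on the cyclic vector, because \<open>M\<close>
  sends x^k e_0 to y^k M e_0. Freeness of the unitriangular action reduces to this, since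
  unitriangular matrices fix e_0.\<close>

lemma cyclic_unique:
  assumes x: "x \<in> hess" and c: "y \<in> carrier_mat n n" "M \<in> carrier_mat n n" "N \<in> carrier_mat n n"
    and M: "mcong n q (M * x) (y * M)" and N: "mcong n q (N * x) (y * N)"
    and e0: "\<And>i. i < n \<Longrightarrow> q dvd M $$ (i, 0) - N $$ (i, 0)"
  shows "mcong n q M N"
proof (rule krylov_cancel[OF x c(2,3)], rule mcongI)
  note xc = hess_carrier[OF x]
  show "M * krylov x \<in> carrier_mat n n" "N * krylov x \<in> carrier_mat n n" using c by auto
  fix i k assume ik: "i < n" "k < n"
  have n0: "0 < n" using n2 by simp
  have 1: "q dvd (M * x ^\<^sub>m k) $$ (i, 0) - (y ^\<^sub>m k * M) $$ (i, 0)"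
    using mcongD(3)[OF pow_mat_intertwine[OF xc c(1,2) M] ik(1) n0] .
  have 2: "q dvd (N * x ^\<^sub>m k) $$ (i, 0) - (y ^\<^sub>m k * N) $$ (i, 0)"
    using mcongD(3)[OF pow_mat_intertwine[OF xc c(1,3) N] ik(1) n0] .
  have "(y ^\<^sub>m k * M) $$ (i, 0) - (y ^\<^sub>m k * N) $$ (i, 0)
      = (\<Sum>t<n. (y ^\<^sub>m k) $$ (i, t) * M $$ (t, 0)) - (\<Sum>t<n. (y ^\<^sub>m k) $$ (i, t) * N $$ (t, 0))"
    using c ik n0 by (subst (1 2) mat_mult_entry[of _ n n _ n]) auto
  also have "\<dots> = (\<Sum>t<n. (y ^\<^sub>m k) $$ (i, t) * (M $$ (t, 0) - N $$ (t, 0)))"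
    by (simp add: right_diff_distrib sum_subtractf)
  also have "q dvd \<dots>" using e0 by (intro dvd_sum) auto
  finally have 3: "q dvd (y ^\<^sub>m k * M) $$ (i, 0) - (y ^\<^sub>m k * N) $$ (i, 0)" .
  have "(M * krylov x) $$ (i, k) - (N * krylov x) $$ (i, k)
     = ((M * x ^\<^sub>m k) $$ (i, 0) - (y ^\<^sub>m k * M) $$ (i, 0)) + ((y ^\<^sub>m k * M) $$ (i, 0) - (y ^\<^sub>m k * N) $$ (i, 0))
       - ((N * x ^\<^sub>m k) $$ (i, 0) - (y ^\<^sub>m k * N) $$ (i, 0))"
    by (simp add: krylov_mult_entry[OF xc _ ik] c del: index_mult_mat)
  also have "q dvd \<dots>" by (rule dvd_diff[OF dvd_add[OF 1 3] 2])
  finally show "q dvd (M * krylov x) $$ (i, k) - (N * krylov x) $$ (i, k)" .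
qed

lemma pl_first_column:
  assumes "x \<in> carrier_mat n n" "i < n"
  shows "pl n c x $$ (i, 0) = (\<Sum>k<n. c k * krylov x $$ (i, k))"
  using assms n2 by (auto simp: pl_def msum_def krylov_def intro!: sum.cong)

text \<open>The coefficients are the coordinates of M e_0 in the Krylov basis; uniqueness of
  intertwiners does the rest. With M = x^n and modulus 0 this yields a monic relation of degree n,
  in place of the Cayley-Hamilton theorem.\<close>

lemma commutant:
  assumes x: "x \<in> hess" and M: "M \<in> carrier_mat n n" and e: "mcong n q (M * x) (x * M)"
  obtains c where "mcong n q M (pl n c x)"
proof -
  note xc = hess_carrier[OF x]
  obtain K where K: "K \<in> carrier_mat n n" "krylov x * K = 1\<^sub>m n" using krylov_inverse[OF x] by metis
  define c where "c k = (K * M) $$ (k, 0)" for k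
  have "mcong n q M (pl n c x)"
  proof (rule cyclic_unique[OF x xc M _ e])
    show "mcong n q (pl n c x * x) (x * pl n c x)" unfolding pl_comm[OF xc] using xc by (intro mcong_refl) auto
    fix i assume i: "i < n"
    have "pl n c x $$ (i, 0) = (\<Sum>k<n. krylov x $$ (i, k) * (K * M) $$ (k, 0))"
      unfolding pl_first_column[OF xc i] c_def by (simp add: mult.commute)
    also have "\<dots> = (krylov x * (K * M)) $$ (i, 0)"
      using K M i n2 by (intro mat_mult_entry[symmetric]) auto
    also have "krylov x * (K * M) = M" using K M by (simp add: assoc_mult_mat[of _ n n _ n _ n, symmetric])
    finally show "q dvd M $$ (i, 0) - pl n c x $$ (i, 0)" by simp
  qed simp
  then show ?thesis using that by blast
qed

text \<open>The map sending x^k e_0 to y^k e_0 is unitriangular because both Krylov matrices have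
  the same diagonal. It intertwines \<open>x\<close> and \<open>y\<close> on all but the last Krylov
  vector by construction; there the common monic relation compares x^n e_0 with y^n e_0.\<close>

lemma hess_conjugate:
  assumes x: "x \<in> hess" and y: "y \<in> hess"
    and px: "mcong n q (x ^\<^sub>m n) (pl n c x)" and py: "mcong n q (y ^\<^sub>m n) (pl n c y)"
  obtains v where "v \<in> uni n" "mcong n q (v * x) (y * v)"
proof -
  note xc = hess_carrier[OF x] and yc = hess_carrier[OF y]
  obtain K where K: "K \<in> carrier_mat n n" "K * krylov x = 1\<^sub>m n" using krylov_inverse[OF x] by metis
  define v where "v = krylov y * K"
  have vc: "v \<in> carrier_mat n n" using K by (simp add: v_def)
  have vK: "v * krylov x = krylov y" unfolding v_def using K by (simp add: assoc_mult_mat[of _ n n _ n _ n])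
  have vu: "v \<in> uni n"
    by (rule upper_quotient_uni[OF krylov_carrier krylov_carrier vc _ _ _ _ vK])
      (auto simp: krylov_def hess_pow[OF x] hess_pow[OF y] a_nz)
  have vx: "v * x * krylov x \<in> carrier_mat n n" "y * v * krylov x \<in> carrier_mat n n" using vc xc yc by auto
  have "mcong n q (v * x) (y * v)"
  proof (rule krylov_cancel[OF x _ _ mcongI[OF vx]])
    fix i k assume ik: "i < n" "k < n"
    have "(v * x * krylov x) $$ (i, k) = (v * x * x ^\<^sub>m k) $$ (i, 0)"
      using vc xc ik by (intro krylov_mult_entry) auto
    also have "v * x * x ^\<^sub>m k = v * x ^\<^sub>m Suc k"
      using vc xc pow_mat_comm[OF xc, of k] by (simp add: assoc_mult_mat[of _ n n _ n _ n])
    finally have L: "(v * x * krylov x) $$ (i, k) = (v * x ^\<^sub>m Suc k) $$ (i, 0)" .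
    have "y * v * krylov x = y * krylov y" using vc yc by (simp add: vK assoc_mult_mat[of _ n n _ n _ n])
    then have "(y * v * krylov x) $$ (i, k) = (y * y ^\<^sub>m k) $$ (i, 0)"
      using krylov_mult_entry[OF yc yc ik] by simp
    then have R: "(y * v * krylov x) $$ (i, k) = (y ^\<^sub>m Suc k) $$ (i, 0)" using pow_mat_comm[OF yc] by simp
    show "q dvd (v * x * krylov x) $$ (i, k) - (y * v * krylov x) $$ (i, k)"
    proof (cases "Suc k < n")
      case True
      have "(v * x ^\<^sub>m Suc k) $$ (i, 0) = (v * krylov x) $$ (i, Suc k)"
        using krylov_mult_entry[OF xc vc ik(1) True] by simp
      then show ?thesis unfolding L R vK using ik True by (simp add: krylov_def)
    next
      case False
      then have k: "Suc k = n" using ik by simp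
      have n0: "0 < n" using n2 by simp
      have 1: "q dvd (v * x ^\<^sub>m n) $$ (i, 0) - (v * pl n c x) $$ (i, 0)"
        using mcongD(3)[OF mcong_mult_left[OF vc px] ik(1) n0] .
      have 2: "q dvd (y ^\<^sub>m n) $$ (i, 0) - pl n c y $$ (i, 0)"
        using mcongD(3)[OF py ik(1) n0] .
      have "(v * pl n c x) $$ (i, 0) = (\<Sum>t<n. v $$ (i, t) * (\<Sum>k<n. c k * krylov x $$ (t, k)))"
        using vc ik n0 by (subst mat_mult_entry[of _ n n _ n]) (auto simp: pl_first_column[OF xc])
      also have "\<dots> = (\<Sum>k<n. c k * (\<Sum>t<n. v $$ (i, t) * krylov x $$ (t, k)))"
        unfolding sum_distrib_left by (subst sum.swap) (simp add: ac_simps)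
      also have "\<dots> = (\<Sum>k<n. c k * (v * krylov x) $$ (i, k))"
        using vc ik by (intro sum.cong refl) (subst mat_mult_entry[of _ n n _ n], auto)
      also have "\<dots> = pl n c y $$ (i, 0)" unfolding vK using pl_first_column[OF yc ik(1)] by simp
      finally have 3: "(v * pl n c x) $$ (i, 0) = pl n c y $$ (i, 0)" .
      have "(v * x ^\<^sub>m n) $$ (i, 0) - (y ^\<^sub>m n) $$ (i, 0)
         = ((v * x ^\<^sub>m n) $$ (i, 0) - (v * pl n c x) $$ (i, 0)) - ((y ^\<^sub>m n) $$ (i, 0) - pl n c y $$ (i, 0))"
        using 3 by simp
      then show ?thesis unfolding L R k using dvd_diff[OF 1 2] by simp
    qed
  qed (use vc xc yc in auto)
  then show ?thesis using that vu by blast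
qed

section \<open>The character theta as a trace against \<open>x0\<close>\<close>

lemma tr_x0:
  assumes A: "A \<in> carrier_mat n n"
  shows "mtrace (x0 * A) = a * A $$ (0, 1) + (\<Sum>i\<in>{1..<n-1}. A $$ (i, i + 1))"
proof -
  have "mtrace (x0 * A) = (\<Sum>i<n. \<Sum>j<n. x0 $$ (i, j) * A $$ (j, i))"
    using A by (intro mtrace_mult) auto
  also have "\<dots> = (\<Sum>j<n. \<Sum>i<n. x0 $$ (i, j) * A $$ (j, i))" by (rule sum.swap)
  also have "\<dots> = (\<Sum>j<n. if Suc j < n then (if j = 0 then a else 1) * A $$ (j, Suc j) else 0)"
  proof (rule sum.cong[OF refl])
    fix j assume j: "j \<in> {..<n}"
    have "(\<Sum>i<n. x0 $$ (i, j) * A $$ (j, i)) = (\<Sum>i<n. if i = Suc j then (if j = 0 then a else 1) * A $$ (j, Suc j) else 0)"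
      using j by (intro sum.cong) (auto simp: x0_def)
    then show "(\<Sum>i<n. x0 $$ (i, j) * A $$ (j, i)) = (if Suc j < n then (if j = 0 then a else 1) * A $$ (j, Suc j) else 0)"
      by simp
  qed
  also have "\<dots> = (\<Sum>j\<in>{0} \<union> {1..<n-1}. (if j = 0 then a else 1) * A $$ (j, Suc j))"
    using n2 by (intro sum.mono_neutral_cong_right) auto
  also have "\<dots> = a * A $$ (0, 1) + (\<Sum>i\<in>{1..<n-1}. A $$ (i, i + 1))"
    by (subst sum.union_disjoint) auto
  finally show ?thesis .
qed

text \<open>Superdiagonal entries add under multiplication of unitriangular matrices; this is what
  makes theta a character.\<close>

lemma tr_x0_uni_mult:
  assumes "u \<in> uni n" "v \<in> uni n"
  shows "mtrace (x0 * (u * v)) = mtrace (x0 * u) + mtrace (x0 * v)"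
proof -
  note c = uni_carrier[OF assms(1)] uni_carrier[OF assms(2)]
  have e: "(u * v) $$ (i, i + 1) = u $$ (i, i + 1) + v $$ (i, i + 1)" if i: "i + 1 < n" for i
  proof -
    have "(u * v) $$ (i, i + 1) = v $$ (i, i + 1) + (\<Sum>t\<in>{i<..<n}. u $$ (i, t) * v $$ (t, i + 1))"
      using i by (intro uni_mult_entry[OF assms(1) c(2)]) auto
    also have "(\<Sum>t\<in>{i<..<n}. u $$ (i, t) * v $$ (t, i + 1)) = (\<Sum>t\<in>{i + 1}. u $$ (i, t) * v $$ (t, i + 1))"
      using i assms(2) by (intro sum.mono_neutral_right) (auto simp: uni_def)
    finally show ?thesis using i assms(2) by (simp add: uni_def)
  qed
  have s: "(\<Sum>i\<in>{1..<n-1}. (u * v) $$ (i, i + 1)) = (\<Sum>i\<in>{1..<n-1}. u $$ (i, i + 1) + v $$ (i, i + 1))"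
    by (rule sum.cong[OF refl]) (rule e, auto)
  have e0: "(u * v) $$ (0, 1) = u $$ (0, 1) + v $$ (0, 1)" using e[of 0] n2 by simp
  have "mtrace (x0 * (u * v)) = a * (u * v) $$ (0, 1) + (\<Sum>i\<in>{1..<n-1}. (u * v) $$ (i, i + 1))"
    using c by (intro tr_x0) auto
  then show ?thesis unfolding s e0 tr_x0[OF c(1)] tr_x0[OF c(2)] by (simp add: sum.distrib algebra_simps)
qed

lemma tr_x0_one: "mtrace (x0 * 1\<^sub>m n) = 0"
  by (simp add: mtrace_def x0_def)

text \<open>The trace pairs the entries of \<open>E\<close> above the diagonal with those of
  \<open>x\<close> below it, and the latter are common to all Hessenberg matrices. Hence theta and
  phi_x agree on the unitriangular part of K^i.\<close>

lemma tr_hess_strict_upper: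
  assumes "x \<in> hess" "E \<in> strict_upper n"
  shows "mtrace (x * E) = mtrace (x0 * E)"
proof -
  have c: "x \<in> carrier_mat n n" "E \<in> carrier_mat n n" using assms by (auto simp: hess_def strict_upper_def)
  have "x $$ (i, j) * E $$ (j, i) = x0 $$ (i, j) * E $$ (j, i)" if "i < n" "j < n" for i j
  proof (cases "j < i")
    case True then show ?thesis using assms that by (auto simp: hess_def)
  next
    case False then show ?thesis using assms that by (auto simp: strict_upper_def)
  qed
  then show ?thesis unfolding mtrace_mult[OF c] mtrace_mult[OF x0_carrier c(2)] by (intro sum.cong refl) auto
qed

section \<open>The anti-involution\<close>

definition dg :: "'a \<Rightarrow> nat \<Rightarrow> 'a" where
  "dg t i = (if i = 0 \<or> i = n - 1 then 1 else t)"

text \<open>Plain antitransposition would move the entry \<open>a\<close> of \<open>x0\<close> from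
  the top of the subdiagonal to its bottom; the weights 1, t, ..., t, 1 bring it back. They are
  symmetric under reversal of the indices, so \<open>anti b\<close> inverts
  \<open>anti a\<close>.\<close>

definition anti :: "'a \<Rightarrow> 'a mat" where
  "anti t = mat n n (\<lambda>(i, j). if i + j = n - 1 then dg t i else 0)"

text \<open>The anti-involution behind the Gelfand trick: transposition in the antidiagonal, rescaled
  so that it fixes x0 also when a is not 1.\<close>

definition iota :: "'a mat \<Rightarrow> 'a mat" where
  "iota g = anti a * transpose_mat g * anti b"

lemma anti_carrier [simp]: "anti t \<in> carrier_mat n n" by (simp add: anti_def)
lemma iota_carrier [simp]: "g \<in> carrier_mat n n \<Longrightarrow> iota g \<in> carrier_mat n n"
  unfolding iota_def by (meson anti_carrier mult_carrier_mat transpose_carrier_mat)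

lemma anti_mult_left:
  assumes "M \<in> carrier_mat n n" "i < n" "j < n"
  shows "(anti t * M) $$ (i, j) = dg t i * M $$ (n - 1 - i, j)"
proof -
  have "(anti t * M) $$ (i, j) = (\<Sum>k<n. anti t $$ (i, k) * M $$ (k, j))"
    using assms by (intro mat_mult_entry) auto
  also have "\<dots> = (\<Sum>k<n. if k = n - 1 - i then dg t i * M $$ (n - 1 - i, j) else 0)"
    using assms by (intro sum.cong) (auto simp: anti_def)
  finally show ?thesis using assms by simp
qed

lemma anti_mult_right:
  assumes "M \<in> carrier_mat n n" "i < n" "j < n"
  shows "(M * anti t) $$ (i, j) = M $$ (i, n - 1 - j) * dg t j"
proof -
  have "(M * anti t) $$ (i, j) = (\<Sum>k<n. M $$ (i, k) * anti t $$ (k, j))"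
    using assms by (intro mat_mult_entry) auto
  also have "\<dots> = (\<Sum>k<n. if k = n - 1 - j then M $$ (i, n - 1 - j) * dg t j else 0)"
    using assms by (intro sum.cong) (auto simp: anti_def dg_def)
  finally show ?thesis using assms by simp
qed

lemma anti_inverse: "anti a * anti b = 1\<^sub>m n" "anti b * anti a = 1\<^sub>m n"
proof -
  have *: "anti s * anti t = 1\<^sub>m n" if "s * t = 1" for s t
  proof (rule eq_matI)
    fix i j assume "i < dim_row (1\<^sub>m n :: 'a mat)" "j < dim_col (1\<^sub>m n :: 'a mat)"
    then have ij: "i < n" "j < n" by auto
    then show "(anti s * anti t) $$ (i, j) = 1\<^sub>m n $$ (i, j)"
      unfolding anti_mult_left[OF anti_carrier ij] using that by (auto simp: anti_def dg_def)
  qed (auto simp: anti_def)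
  show "anti a * anti b = 1\<^sub>m n" using * ab by simp
  show "anti b * anti a = 1\<^sub>m n" using * ab by (simp add: mult.commute)
qed

lemma iota_entry:
  assumes "g \<in> carrier_mat n n" "i < n" "j < n"
  shows "iota g $$ (i, j) = dg a i * g $$ (n - 1 - j, n - 1 - i) * dg b j"
proof -
  have "iota g $$ (i, j) = (anti a * transpose_mat g) $$ (i, n - 1 - j) * dg b j"
    unfolding iota_def using assms by (intro anti_mult_right) auto
  also have "(anti a * transpose_mat g) $$ (i, n - 1 - j) = dg a i * transpose_mat g $$ (n - 1 - i, n - 1 - j)"
    using assms by (intro anti_mult_left) auto
  finally show ?thesis using assms by auto
qed

lemma iota_mult:
  assumes g: "g \<in> carrier_mat n n" "h \<in> carrier_mat n n"
  shows "iota (g * h) = iota h * iota g"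
proof -
  note as = assoc_mult_mat[of _ n n _ n _ n]
  have "iota h * iota g = anti a * (transpose_mat h * ((anti b * anti a) * (transpose_mat g * anti b)))"
    unfolding iota_def using g by (simp add: as)
  also have "\<dots> = anti a * (transpose_mat h * transpose_mat g) * anti b"
    unfolding anti_inverse using g by (simp add: as)
  also have "transpose_mat h * transpose_mat g = transpose_mat (g * h)"
    by (rule transpose_mult[symmetric]) (use g in auto)
  finally show ?thesis by (simp add: iota_def)
qed

lemma iota_one: "iota (1\<^sub>m n) = 1\<^sub>m n"
  by (simp add: iota_def anti_inverse)

lemma det_iota: "g \<in> carrier_mat n n \<Longrightarrow> det (iota g) = det g"
proof -
  assume g: "g \<in> carrier_mat n n"
  have "det (anti a) * det (anti b) = 1"
    using arg_cong[OF anti_inverse(1), of det] by (simp add: det_mult[of _ n])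
  moreover have "det (iota g) = det (anti a) * det g * det (anti b)"
    unfolding iota_def using g by (simp add: det_mult[of _ n] det_transpose[of _ n])
  ultimately show ?thesis by (simp add: ac_simps)
qed

lemma iota_mcong: "mcong n q g h \<Longrightarrow> mcong n q (iota g) (iota h)"
  unfolding iota_def by (intro mcong_mult mcong_refl mcong_transpose) auto

lemma iota_mcong_cancel:
  assumes g: "g \<in> carrier_mat n n" "h \<in> carrier_mat n n" and e: "mcong n q (iota g) (iota h)"
  shows "mcong n q g h"
proof -
  note as = assoc_mult_mat[of _ n n _ n _ n]
  have *: "transpose_mat (anti b * iota k * anti a) = k" if "k \<in> carrier_mat n n" for k
  proof -
    have "anti b * iota k * anti a = (anti b * anti a) * transpose_mat k * (anti b * anti a)"
      unfolding iota_def using that by (simp add: as)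
    then show ?thesis unfolding anti_inverse using that by simp
  qed
  have "mcong n q (transpose_mat (anti b * iota g * anti a)) (transpose_mat (anti b * iota h * anti a))"
    using e by (intro mcong_transpose mcong_mult mcong_refl) auto
  then show ?thesis by (simp add: * g)
qed

lemma iota_uni: "u \<in> uni n \<Longrightarrow> iota u \<in> uni n"
proof -
  assume u: "u \<in> uni n"
  note c = uni_carrier[OF u]
  have "iota u $$ (i, i) = 1" if "i < n" for i
    using u that ab by (auto simp: iota_entry[OF c] uni_def dg_def)
  moreover have "iota u $$ (i, j) = 0" if "i < n" "j < i" for i j
    using u that by (auto simp: iota_entry[OF c] uni_def)
  ultimately show ?thesis using c by (auto simp: uni_def)
qed

text \<open>At the top of the subdiagonal the weight \<open>a\<close> supplies the missing entry, at
  the bottom \<open>b\<close> cancels the entry \<open>a\<close> that has moved there, and in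
  between the weights multiply to 1; for n = 2 the entry stays in place.\<close>

lemma dg_shift:
  assumes "Suc j < n"
  shows "dg a (Suc j) * x0 $$ (n - 1 - j, n - 1 - Suc j) * dg b j = x0 $$ (Suc j, j)"
proof -
  have "n - 1 - j = Suc (n - 1 - Suc j)" using assms by simp
  then have 1: "x0 $$ (n - 1 - j, n - 1 - Suc j) = (if Suc (Suc j) = n then a else 1)"
    using assms by (auto simp: x0_def)
  have 2: "x0 $$ (Suc j, j) = (if j = 0 then a else 1)" using assms by (simp add: x0_def)
  have 3: "dg a (Suc j) = (if Suc (Suc j) = n then 1 else a)" using assms by (auto simp: dg_def)
  have 4: "dg b j = (if j = 0 then 1 else b)" using assms by (auto simp: dg_def)
  show ?thesis unfolding 1 2 3 4 using ab by auto
qed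

lemma iota_hess: "x \<in> hess \<Longrightarrow> iota x \<in> hess"
proof -
  assume x: "x \<in> hess"
  note c = hess_carrier[OF x]
  have "iota x $$ (i, j) = x0 $$ (i, j)" if ij: "i < n" "j < i" for i j
  proof -
    have lt: "n - 1 - j < n" "n - 1 - i < n - 1 - j" using ij by auto
    have "iota x $$ (i, j) = dg a i * x0 $$ (n - 1 - j, n - 1 - i) * dg b j"
      using x lt ij by (simp add: iota_entry[OF c] hess_def)
    moreover have "x0 $$ (n - 1 - j, n - 1 - i) = 0" "x0 $$ (i, j) = 0" if "i \<noteq> Suc j"
      using that ij by (auto simp: x0_def)
    moreover have "dg a i * x0 $$ (n - 1 - j, n - 1 - i) * dg b j = x0 $$ (i, j)" if "i = Suc j"
      unfolding that by (rule dg_shift) (use that ij in simp)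
    ultimately show ?thesis by fastforce
  qed
  then show ?thesis using c by (auto simp: hess_def)
qed

lemma iota_x0: "iota x0 = x0"
proof (rule eq_matI)
  fix i j assume "i < dim_row x0" "j < dim_col x0"
  then have ij: "i < n" "j < n" by (auto simp: x0_def)
  have h: "x0 \<in> hess" by (simp add: hess_def)
  show "iota x0 $$ (i, j) = x0 $$ (i, j)"
  proof (cases "j < i")
    case True then show ?thesis using iota_hess[OF h] ij by (auto simp: hess_def)
  next
    case False
    then have "x0 $$ (n - 1 - j, n - 1 - i) = 0" "x0 $$ (i, j) = 0" using ij by (auto simp: x0_def)
    then show ?thesis using ij by (simp add: iota_entry)
  qed
qed (use iota_carrier[OF x0_carrier] x0_carrier in \<open>auto simp del: iota_carrier x0_carrier\<close>)

text \<open>The trace is invariant under transposition and cyclic exchange, and \<open>x0\<close> is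
  a fixed point of \<open>iota\<close>.\<close>

lemma tr_x0_iota:
  assumes E: "E \<in> carrier_mat n n"
  shows "mtrace (x0 * iota E) = mtrace (x0 * E)"
proof -
  have "mtrace (x0 * iota E) = mtrace (iota x0 * iota E)" by (simp add: iota_x0)
  also have "\<dots> = mtrace (iota (E * x0))" using E by (simp add: iota_mult)
  also have "\<dots> = mtrace (transpose_mat (E * x0) * anti b * anti a)"
    unfolding iota_def using E by (subst mtrace_comm[symmetric, of _ n]) (auto simp: assoc_mult_mat[of _ n n _ n _ n])
  also have "transpose_mat (E * x0) * anti b * anti a = transpose_mat (E * x0)"
    using E by (simp add: assoc_mult_mat[of _ n n _ n _ n] anti_inverse del: transpose_mult)
  also have "mtrace (transpose_mat (E * x0)) = mtrace (E * x0)" using E by (intro mtrace_transpose[of _ n]) auto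
  also have "\<dots> = mtrace (x0 * E)" using E by (intro mtrace_comm[of _ n]) auto
  finally show ?thesis .
qed

lemma iota_pl:
  assumes x: "x \<in> carrier_mat n n"
  shows "iota (pl n c x) = pl n c (iota x)"
proof -
  note as = assoc_mult_mat[of _ n n _ n _ n]
  have "anti a * transpose_mat x = iota x * anti a"
    unfolding iota_def using x by (simp add: as anti_inverse)
  then have "anti a * pl n c (transpose_mat x) = pl n c (iota x) * anti a"
    using x by (intro mcong_0[of n] pl_intertwine) (auto intro!: mcong_refl)
  then have "iota (pl n c x) = pl n c (iota x) * anti a * anti b"
    unfolding iota_def transpose_pl[OF x] by simp
  also have "\<dots> = pl n c (iota x)" using x by (simp add: as anti_inverse)
  finally show ?thesis .
qed

lemma iota_pow:
  assumes x: "x \<in> carrier_mat n n"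
  shows "iota (x ^\<^sub>m k) = iota x ^\<^sub>m k"
proof (induction k)
  case 0
  have "dim_row (iota x) = n" "dim_row x = n" using x iota_carrier[OF x] by blast+
  then show ?case by (simp add: iota_one)
next
  case (Suc k)
  have "iota (x ^\<^sub>m Suc k) = iota x * iota x ^\<^sub>m k" using x Suc by (simp add: iota_mult)
  then show ?case using pow_mat_comm[OF iota_carrier[OF x], of k] by simp
qed

text \<open>An element intertwining two Hessenberg matrices is, up to unitriangular factors, a polynomial
  in one of them, and polynomials are fixed by a conjugate of iota.\<close>

lemma iota_double_coset:
  assumes x: "x \<in> hess" and y: "y \<in> hess"
    and g: "g \<in> carrier_mat n n" "g' \<in> carrier_mat n n" "g * g' = 1\<^sub>m n"
    and e: "mcong n q (g * x) (y * g)"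
  obtains u1 u2 where "u1 \<in> uni n" "u2 \<in> uni n" "mcong n q (u1 * iota g) (g * u2)"
    "mtrace (x0 * u1) = mtrace (x0 * u2)"
proof -
  note as = assoc_mult_mat[of _ n n _ n _ n]
  note xc = hess_carrier[OF x] and yc = hess_carrier[OF y]
  note ix = iota_hess[OF x] and ixc = iota_carrier[OF xc]
  \<comment> \<open>Modulus 0: the monic relation for \<open>x\<close> is exact, so it passes to
    \<open>iota x\<close> with the same coefficients.\<close>
  obtain c where "mcong n 0 (x ^\<^sub>m n) (pl n c x)"
    using commutant[OF x, of "x ^\<^sub>m n" 0] xc pow_mat_comm[OF xc, of n] mcong_refl
    by (metis mult_carrier_mat pow_carrier)
  then have px: "x ^\<^sub>m n = pl n c x" by (rule mcong_0)
  have pix: "iota x ^\<^sub>m n = pl n c (iota x)"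
    unfolding iota_pow[OF xc, symmetric] px iota_pl[OF xc] ..
  \<comment> \<open>For \<open>y\<close> the relation is available only modulo \<open>q\<close>,
    transported by the invertible intertwiner \<open>g\<close>.\<close>
  have "mcong n q (y ^\<^sub>m n * g) (g * x ^\<^sub>m n)"
    by (rule mcong_sym[OF pow_mat_intertwine[OF xc yc g(1) e]])
  also have "mcong n q (g * x ^\<^sub>m n) (pl n c y * g)"
    unfolding px by (rule pl_intertwine[OF xc yc g(1) e])
  finally have yg: "mcong n q (y ^\<^sub>m n * g) (pl n c y * g)" .
  have "mcong n q (y ^\<^sub>m n * g * g') (pl n c y * g * g')" by (rule mcong_mult_right[OF g(2) yg])
  moreover have "y ^\<^sub>m n * g * g' = y ^\<^sub>m n" "pl n c y * g * g' = pl n c y"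
    using g yc by (simp_all add: as)
  ultimately have py: "mcong n q (y ^\<^sub>m n) (pl n c y)" by simp
  have rx: "mcong n q (x ^\<^sub>m n) (pl n c x)" "mcong n q (iota x ^\<^sub>m n) (pl n c (iota x))"
    unfolding px pix by (auto intro: mcong_refl)
  \<comment> \<open>\<open>v\<close> carries \<open>x\<close> to \<open>y\<close> and
    \<open>s\<close> carries \<open>iota x\<close> to \<open>x\<close>. Dividing \<open>g\<close> by
    \<open>v\<close> on the left leaves an element that commutes with \<open>x\<close>, hence a
    polynomial in \<open>x\<close>.\<close>
  obtain v where v: "v \<in> uni n" "mcong n q (v * x) (y * v)" using hess_conjugate[OF x y rx(1) py] .
  obtain s where s: "s \<in> uni n" "mcong n q (s * iota x) (x * s)" using hess_conjugate[OF ix x rx(2,1)] .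
  obtain vi where vi: "vi \<in> uni n" "v * vi = 1\<^sub>m n" "vi * v = 1\<^sub>m n" using uni_inverse[OF v(1)] .
  note vc = uni_carrier[OF v(1)] and sc = uni_carrier[OF s(1)] and vic = uni_carrier[OF vi(1)]
  have "mcong n q (vi * (v * x) * vi) (vi * (y * v) * vi)"
    using vic v(2) by (intro mcong_mult_left mcong_mult_right)
  moreover have "vi * (v * x) * vi = (vi * v) * (x * vi)" using vc vic xc by (simp add: as)
  moreover have "vi * (y * v) * vi = vi * y * (v * vi)" using vc vic yc by (simp add: as)
  ultimately have vxy: "mcong n q (x * vi) (vi * y)" unfolding vi using vic xc yc by simp
  have "vi * g * x = vi * (g * x)" using vic g xc by (simp add: as)
  also have "mcong n q \<dots> (vi * (y * g))" using vic e by (intro mcong_mult_left)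
  also have "vi * (y * g) = vi * y * g" using vic g yc by (simp add: as)
  also have "mcong n q \<dots> (x * vi * g)" using mcong_sym[OF vxy] g by (intro mcong_mult_right)
  also have "x * vi * g = x * (vi * g)" using vic g xc by (simp add: as)
  finally have "mcong n q (vi * g * x) (x * (vi * g))" .
  then obtain d where d: "mcong n q (vi * g) (pl n d x)" using commutant[OF x, of "vi * g"] vic g by auto
  let ?f = "pl n d x"
  have "g = (v * vi) * g" using vi g by simp
  also have "\<dots> = v * (vi * g)" using vc vic g by (simp add: as)
  also have "mcong n q \<dots> (v * ?f)" using vc d by (intro mcong_mult_left)
  finally have gf: "mcong n q g (v * ?f)" .
  have "mcong n q (iota g) (iota (v * ?f))" by (rule iota_mcong[OF gf])
  also have "iota (v * ?f) = pl n d (iota x) * iota v" using vc by (simp add: iota_mult iota_pl[OF xc])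
  finally have ig: "mcong n q (iota g) (pl n d (iota x) * iota v)" .
  note ivc = iota_carrier[OF vc]
  \<comment> \<open>With g = v f(x) the chain reads v s iota(g) = v s f(iota x) iota(v) = v f(x) s
    iota(v) = g s iota(v), all modulo \<open>q\<close>: \<open>s\<close> turns f(iota x) into
    f(x).\<close>
  have "(v * s) * iota g = v * (s * iota g)" using vc sc g by (simp add: as)
  also have "mcong n q \<dots> (v * (s * (pl n d (iota x) * iota v)))" using ig vc sc by (intro mcong_mult_left)
  also have "v * (s * (pl n d (iota x) * iota v)) = v * (s * pl n d (iota x) * iota v)" using vc sc ivc by (simp add: as)
  also have "mcong n q \<dots> (v * ((?f * s) * iota v))"
    by (intro mcong_mult_left mcong_mult_right pl_intertwine vc ivc xc ixc sc s(2))
  also have "v * ((?f * s) * iota v) = v * ?f * (s * iota v)" using vc sc ivc by (simp add: as)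
  also have "mcong n q \<dots> (g * (s * iota v))" using mcong_sym[OF gf] sc ivc by (intro mcong_mult_right) auto
  finally have fin: "mcong n q ((v * s) * iota g) (g * (s * iota v))" .
  \<comment> \<open>The two unitriangular factors are v s and s iota(v); the trace form is additive
    on such products and does not change under \<open>iota\<close>.\<close>
  have "mtrace (x0 * (v * s)) = mtrace (x0 * (s * iota v))"
    using v s iota_uni[OF v(1)] by (simp add: tr_x0_uni_mult tr_x0_iota[OF vc] add.commute)
  then show ?thesis using that[of "v * s" "s * iota v"] fin v s iota_uni[OF v(1)] by (auto intro: uni_mult)
qed

end

section \<open>The group and its lifts\<close>

lemma mcls_eq_iff:
  assumes "A \<in> carrier_mat n n" "B \<in> carrier_mat n n"
  shows "mcls w n l A = mcls w n l B \<longleftrightarrow> mcong n (w ^ l) A B"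
proof -
  have m: "C \<in> mcls w n l A \<longleftrightarrow> mcong n (w ^ l) A C" if "A \<in> carrier_mat n n" for A C
    using that by (auto simp: mcls_def mcong_def)
  show ?thesis
  proof
    assume "mcls w n l A = mcls w n l B"
    then show "mcong n (w ^ l) A B" using m[OF assms(1), of B] m[OF assms(2), of B] assms by (auto intro: mcong_refl)
  next
    assume "mcong n (w ^ l) A B"
    then show "mcls w n l A = mcls w n l B"
      using m assms by (blast intro: mcong_trans mcong_sym)
  qed
qed

lemma some_in_mcls:
  assumes "A \<in> carrier_mat n n"
  shows "mcong n (w ^ l) A (SOME B. B \<in> mcls w n l A)"
proof -
  have "A \<in> mcls w n l A" using assms by (auto simp: mcls_def)
  then have "(SOME B. B \<in> mcls w n l A) \<in> mcls w n l A" by (rule someI)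
  then show ?thesis using assms by (auto simp: mcls_def mcong_def)
qed

text \<open>The group law picks arbitrary representatives; since congruence is multiplicative, any
  lifts compute the product.\<close>

lemma Grp_mult:
  assumes "A \<in> carrier_mat n n" "B \<in> carrier_mat n n"
  shows "mcls w n l A \<otimes>\<^bsub>Grp w g n l\<^esub> mcls w n l B = mcls w n l (A * B)"
proof -
  have "mcong n (w ^ l) (A * B) ((SOME A'. A' \<in> mcls w n l A) * (SOME B'. B' \<in> mcls w n l B))"
    using assms by (intro mcong_mult some_in_mcls)
  then have "mcls w n l (A * B) = mcls w n l ((SOME A'. A' \<in> mcls w n l A) * (SOME B'. B' \<in> mcls w n l B))"
    by (subst mcls_eq_iff) (auto dest: mcongD)
  then show ?thesis by (simp add: Grp_def)
qed

text \<open>\<open>b\<close> inverts \<open>a\<close> in o itself, as a unit modulo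
  \<open>w ^ l\<close> is a unit of the local ring. \<open>phi_0\<close> excludes the zero function,
  and \<open>n_unit\<close> is the form in which the condition that p does not divide n
  enters.\<close>

locale whittaker = local_dvr w + hessenberg n a b
  for w :: "'a::idom" and n :: nat and a b :: 'a +
  fixes g :: grp_type and l :: nat and \<phi> :: "'a \<Rightarrow> complex"
  assumes l2: "2 \<le> l"
    and phi_add: "\<And>x y. \<phi> (x + y) = \<phi> x * \<phi> y"
    and phi_per: "\<And>x y. w ^ l dvd x - y \<Longrightarrow> \<phi> x = \<phi> y"
    and phi_prim: "\<exists>x. \<phi> (w ^ (l - 1) * x) \<noteq> 1"
    and phi_0: "\<phi> 0 = 1"
    and n_unit: "g = SL \<Longrightarrow> \<exists>k. of_nat n * k = (1::'a)"
begin

lemma phi_uminus: "\<phi> (- x) * \<phi> x = 1"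
  using phi_add[of "- x" x] phi_0 by simp

lemma phi_nz: "\<phi> x \<noteq> 0"
  using phi_uminus[of x] by auto

lemma phi_uminus_eq: "\<phi> (- x) = inverse (\<phi> x)"
  using phi_uminus[of x] by (metis inverse_unique mult.commute)

lemma phi_diff: "\<phi> (x - y) = \<phi> x / \<phi> y"
  using phi_add[of x "- y"] by (simp add: phi_uminus_eq field_simps)

text \<open>If x had valuation k < l, its multiples would contain w^(l-1) o, where
  \<open>\<phi>\<close> is nontrivial. Divisibility by \<open>w ^ l\<close> can thus be tested by
  \<open>\<phi>\<close> on all multiples.\<close>

lemma phi_nondegenerate:
  assumes "\<And>c. \<phi> (c * x) = 1" shows "w ^ l dvd x"
proof (rule ccontr)
  assume "\<not> w ^ l dvd x"
  then obtain u v k where u: "k < l" "x = u * w ^ k" "u * v = 1" using not_dvd_pow_E by metis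
  obtain y where y: "\<phi> (w ^ (l - 1) * y) \<noteq> 1" using phi_prim by auto
  have "l - 1 = k + (l - 1 - k)" using u by simp
  then have "w ^ (l - 1) = w ^ k * w ^ (l - 1 - k)" by (metis power_add)
  then have "w ^ (l - 1) * y = (y * v * w ^ (l - 1 - k)) * x" using u by (simp add: ac_simps)
  then show False using assms y by metis
qed

text \<open>The group at the level of lifts; for SL the determinant is 1 only modulo
  \<open>w ^ l\<close>.\<close>

definition G0 :: "'a mat set" where
  "G0 = {A. Glift w g n l A}"

lemma mem_G0:
  "A \<in> G0 \<longleftrightarrow> A \<in> carrier_mat n n \<and> (g = GL \<longrightarrow> unit_mod w l (det A)) \<and> (g = SL \<longrightarrow> w ^ l dvd det A - 1)"
  unfolding G0_def Glift_def by (cases g) auto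

lemma G0_carrier: "A \<in> G0 \<Longrightarrow> A \<in> carrier_mat n n"
  unfolding mem_G0 by auto

lemma G0_one: "1\<^sub>m n \<in> G0"
  unfolding mem_G0 by (auto simp: unit_mod_def intro: exI[of _ 1])

lemma uni_G0: "u \<in> uni n \<Longrightarrow> u \<in> G0"
  using det_uni[of u n] unfolding mem_G0 by (auto simp: unit_mod_def uni_def intro: exI[of _ 1])

lemma G0_mult:
  assumes "A \<in> G0" "B \<in> G0" shows "A * B \<in> G0"
proof -
  note c = G0_carrier[OF assms(1)] G0_carrier[OF assms(2)]
  note d = det_mult[OF c]
  show ?thesis
  proof (cases g)
    case GL
    then obtain x y where "w ^ l dvd det A * x - 1" "w ^ l dvd det B * y - 1"
      using assms unfolding mem_G0 by (auto simp: unit_mod_def)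
    then have "w ^ l dvd (det A * x - 1) * (det B * y) + (det B * y - 1)" by auto
    then have "w ^ l dvd det (A * B) * (x * y) - 1" unfolding d by (simp add: algebra_simps)
    then show ?thesis using GL c unfolding mem_G0 by (auto simp: unit_mod_def)
  next
    case SL
    then have "w ^ l dvd det A - 1" "w ^ l dvd det B - 1" using assms unfolding mem_G0 by auto
    then have "w ^ l dvd (det A - 1) * det B + (det B - 1)" by auto
    then have "w ^ l dvd det (A * B) - 1" unfolding d by (simp add: algebra_simps)
    then show ?thesis using SL c unfolding mem_G0 by auto
  qed
qed

text \<open>The determinant is a unit of o, so the inverse exists over o and not merely modulo
  \<open>w ^ l\<close>.\<close>

lemma G0_inverse:
  assumes "A \<in> G0"
  obtains B where "B \<in> G0" "A * B = 1\<^sub>m n" "B * A = 1\<^sub>m n"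
proof -
  note c = G0_carrier[OF assms]
  have um: "unit_mod w l (det A)"
    using assms unfolding mem_G0 by (cases g) (auto simp: unit_mod_def intro: exI[of _ 1])
  have l0: "0 < l" using l2 by simp
  obtain e where e: "det A * e = 1" using unit_mod_imp_unit[OF um l0] .
  then obtain B where B: "B \<in> carrier_mat n n" "A * B = 1\<^sub>m n" "B * A = 1\<^sub>m n"
    using inverse_mat_exists[OF c] by metis
  have d: "det A * det B = 1" using det_mult[OF c B(1)] B by simp
  have "B \<in> G0"
  proof (cases g)
    case GL
    have "det B * det A - 1 = 0" using d by (simp add: mult.commute)
    then show ?thesis using GL B unfolding mem_G0 by (auto simp: unit_mod_def intro: exI[of _ "det A"])
  next
    case SL
    then have "w ^ l dvd det A - 1" using assms unfolding mem_G0 by simp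
    then have "w ^ l dvd - ((det A - 1) * det B)" by simp
    then have "w ^ l dvd det B - 1" using d by (simp add: algebra_simps)
    then show ?thesis using SL B unfolding mem_G0 by simp
  qed
  then show ?thesis using that B by blast
qed

lemma iota_G0: "A \<in> G0 \<Longrightarrow> iota A \<in> G0"
  using det_iota[OF G0_carrier, of A] G0_carrier[of A] unfolding mem_G0 by simp

lemma theta_mcls:
  assumes A: "A \<in> carrier_mat n n"
  shows "theta n \<phi> a (mcls w n l A) = \<phi> (mtrace (x0 * A))"
proof -
  let ?B = "SOME B. B \<in> mcls w n l A"
  have c: "mcong n (w ^ l) A ?B" by (rule some_in_mcls[OF A])
  then have B: "?B \<in> carrier_mat n n" by (auto dest: mcongD)
  have "theta n \<phi> a (mcls w n l A) = \<phi> (mtrace (x0 * ?B))"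
    by (simp add: theta_def tr_x0[OF B] Let_def)
  also have "\<dots> = \<phi> (mtrace (x0 * A))"
    by (rule phi_per, rule mtrace_mcong[of n]) (rule mcong_mult_left[OF x0_carrier mcong_sym[OF c]])
  finally show ?thesis .
qed

lemma Usub_eq: "Usub w n l = mcls w n l ` uni n"
  by (simp add: Usub_def uni_def)

lemma mcls_G0: "A \<in> G0 \<Longrightarrow> mcls w n l A \<in> carrier (Grp w g n l)"
  by (auto simp: Grp_def G0_def)

text \<open>Exact replacement for a matrix that is strictly upper triangular only modulo a power of
  \<open>w\<close>.\<close>

definition truncate :: "'a mat \<Rightarrow> 'a mat" where
  "truncate M = mat n n (\<lambda>(i, j). if i < j then M $$ (i, j) else 0)"

lemma truncate_strict_upper: "truncate M \<in> strict_upper n"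
  by (auto simp: truncate_def strict_upper_def)

lemma truncate_mcong:
  "M \<in> carrier_mat n n \<Longrightarrow> (\<And>i j. i < n \<Longrightarrow> j \<le> i \<Longrightarrow> q dvd M $$ (i, j)) \<Longrightarrow> mcong n q (truncate M) M"
  by (auto simp: mcong_def truncate_def)

text \<open>Mackey's criterion for the double coset of h. When theta and its h-conjugate agree on
  strictly upper triangular T h, the two functionals are glued and extended by duality.\<close>

lemma support_cases:
  assumes h: "h \<in> carrier_mat n n"
    and agree: "\<And>E1 E2. E1 \<in> strict_upper n \<Longrightarrow> E2 \<in> strict_upper n \<Longrightarrow>
      mcong n (w ^ l) (h * (1\<^sub>m n + E1)) ((1\<^sub>m n + E2) * h) \<Longrightarrow> \<phi> (mtrace (x0 * E1)) = \<phi> (mtrace (x0 * E2))"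
  obtains x y where "x \<in> hess" "y \<in> hess" "mcong n (w ^ l) (h * x) (y * h)"
proof -
  note as = assoc_mult_mat[of _ n n _ n _ n]
  let ?D = "x0 * h - h * x0"
  \<comment> \<open>The unknowns are upper triangular \<open>P\<close> and \<open>Q\<close>,
    diagonal included, with h P - Q h = x0 h - h x0; this says that h intertwines the Hessenberg
    matrices x0 + P and x0 + Q. \<open>T\<close> lists the positions, and \<open>A\<close> is the
    matrix of the system, with \<open>Inl\<close> for \<open>P\<close> and \<open>Inr\<close> for
    \<open>Q\<close>.\<close>
  define T where "T = {(i, j). i \<le> j \<and> j < n}"
  have T_sub: "T \<subseteq> {..<n} \<times> {..<n}" by (auto simp: T_def)
  have finT: "finite T" by (rule finite_subset[OF T_sub]) auto
  define A :: "nat \<times> nat \<Rightarrow> (nat \<times> nat) + (nat \<times> nat) \<Rightarrow> 'a" where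
    "A rs c = (case c of Inl ij \<Rightarrow> (if snd rs = snd ij then h $$ (fst rs, fst ij) else 0)
                       | Inr ij \<Rightarrow> (if fst rs = fst ij then - h $$ (snd ij, snd rs) else 0))" for rs c
  have "\<exists>s. \<forall>j\<in>{..<n} \<times> {..<n}. w ^ l dvd (\<Sum>c\<in>T <+> T. A j c * s c) - ?D $$ j"
  proof (rule fredholm)
    fix t :: "nat \<times> nat \<Rightarrow> 'a"
    assume t: "\<forall>c\<in>T <+> T. w ^ l dvd (\<Sum>j\<in>{..<n} \<times> {..<n}. t j * A j c)"
    \<comment> \<open>A relation among the equations, transposed so that applying it to a matrix
      becomes a trace against \<open>M\<close>.\<close>
    define M where "M = mat n n (\<lambda>(s, r). t (r, s))"
    have M: "M \<in> carrier_mat n n" by (simp add: M_def)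
    \<comment> \<open>Testing the relation on the unknowns of \<open>P\<close>, and below on those
      of \<open>Q\<close>, says that M h and h M are strictly upper triangular modulo
      \<open>w ^ l\<close>.\<close>
    have 1: "w ^ l dvd (M * h) $$ (j, i)" if "j < n" "i \<le> j" for i j
    proof -
      have ij: "(i, j) \<in> T" "i < n" using that by (auto simp: T_def)
      have "(\<Sum>rs\<in>{..<n} \<times> {..<n}. t rs * A rs (Inl (i, j)))
          = (\<Sum>r<n. \<Sum>s<n. if s = j then t (r, j) * h $$ (r, i) else 0)"
        unfolding sum.cartesian_product by (rule sum.cong) (auto simp: A_def)
      also have "\<dots> = (\<Sum>r<n. M $$ (j, r) * h $$ (r, i))" using that by (auto simp: M_def)
      also have "\<dots> = (M * h) $$ (j, i)" using M h that ij by (intro mat_mult_entry[symmetric]) auto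
      finally show ?thesis using t ij by (metis InlI)
    qed
    have 2: "w ^ l dvd (h * M) $$ (j, i)" if "j < n" "i \<le> j" for i j
    proof -
      have ij: "(i, j) \<in> T" "i < n" using that by (auto simp: T_def)
      have "(\<Sum>rs\<in>{..<n} \<times> {..<n}. t rs * A rs (Inr (i, j)))
          = (\<Sum>r<n. \<Sum>s<n. if r = i then - (h $$ (j, s) * t (i, s)) else 0)"
        unfolding sum.cartesian_product by (rule sum.cong) (auto simp: A_def)
      also have "\<dots> = (\<Sum>s<n. \<Sum>r<n. if r = i then - (h $$ (j, s) * t (i, s)) else 0)" by (rule sum.swap)
      also have "\<dots> = - (\<Sum>s<n. h $$ (j, s) * M $$ (s, i))" using ij by (auto simp: M_def sum_negf)
      also have "(\<Sum>s<n. h $$ (j, s) * M $$ (s, i)) = (h * M) $$ (j, i)"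
        using M h that ij by (intro mat_mult_entry[symmetric]) auto
      finally show ?thesis using t ij by (metis InrI dvd_minus_iff)
    qed
    \<comment> \<open>The identity h (1 + c M h) = (1 + c h M) h produces a pair to which
      \<open>agree\<close> applies; as \<open>c\<close> is free, nondegeneracy then removes
      \<open>\<phi>\<close>.\<close>
    have phi_eq: "\<phi> (c * (mtrace (x0 * (h * M)) - mtrace (x0 * (M * h)))) = 1" for c
    proof -
      have Mc: "c \<cdot>\<^sub>m M \<in> carrier_mat n n" using M by simp
      let ?E1 = "c \<cdot>\<^sub>m truncate (M * h)" and ?E2 = "c \<cdot>\<^sub>m truncate (h * M)"
      have c1: "mcong n (w ^ l) (truncate (M * h)) (M * h)" using M h 1 by (intro truncate_mcong) auto
      have c2: "mcong n (w ^ l) (truncate (h * M)) (h * M)" using M h 2 by (intro truncate_mcong) auto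
      have u: "?E1 \<in> strict_upper n" "?E2 \<in> strict_upper n"
        by (auto intro: strict_upper_smult truncate_strict_upper)
      have "mcong n (w ^ l) (h * (1\<^sub>m n + ?E1)) (h * (1\<^sub>m n + c \<cdot>\<^sub>m (M * h)))"
        using h c1 by (intro mcong_mult_left mcong_add mcong_refl mcong_smult') auto
      also have "h * (1\<^sub>m n + c \<cdot>\<^sub>m (M * h)) = h + c \<cdot>\<^sub>m (h * (M * h))"
        using h M by (simp add: mult_add_distrib_mat[of _ n n _ n] mult_smult_distrib[of _ n n _ n])
      also have "\<dots> = (1\<^sub>m n + c \<cdot>\<^sub>m (h * M)) * h"
        using h M by (simp add: add_mult_distrib_mat[of _ n n _ _ n] mult_smult_assoc_mat[of _ n n _ n] as)
      also have "mcong n (w ^ l) \<dots> ((1\<^sub>m n + ?E2) * h)"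
        using h mcong_sym[OF c2] by (intro mcong_mult_right mcong_add mcong_refl mcong_smult') auto
      finally have "\<phi> (mtrace (x0 * ?E1)) = \<phi> (mtrace (x0 * ?E2))" by (rule agree[OF u])
      moreover have "\<phi> (mtrace (x0 * ?E1)) = \<phi> (mtrace (x0 * (c \<cdot>\<^sub>m (M * h))))"
        by (intro phi_per mtrace_mcong[of n] mcong_mult_left mcong_smult' c1 x0_carrier)
      moreover have "\<phi> (mtrace (x0 * ?E2)) = \<phi> (mtrace (x0 * (c \<cdot>\<^sub>m (h * M))))"
        by (intro phi_per mtrace_mcong[of n] mcong_mult_left mcong_smult' c2 x0_carrier)
      ultimately have "\<phi> (c * mtrace (x0 * (M * h))) = \<phi> (c * mtrace (x0 * (h * M)))"
        using M h by (simp add: mtrace_mult_smult[of _ n])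
      then show ?thesis using phi_nz by (simp add: right_diff_distrib phi_diff)
    qed
    then have "w ^ l dvd mtrace (x0 * (h * M)) - mtrace (x0 * (M * h))" by (rule phi_nondegenerate)
    also have "mtrace (x0 * (M * h)) = mtrace (x0 * M * h)" using M h by (simp add: as)
    also have "\<dots> = mtrace (h * (x0 * M))" using M h by (intro mtrace_comm[of _ n]) auto
    also have "h * (x0 * M) = h * x0 * M" using M h by (simp add: as)
    also have "x0 * (h * M) = x0 * h * M" using M h by (simp add: as)
    also have "mtrace (x0 * h * M) - mtrace (h * x0 * M) = mtrace (?D * M)"
      using M h by (subst minus_mult_distrib_mat[of _ n n _ _ n]) (auto intro!: mtrace_minus[of _ n, symmetric])
    also have "\<dots> = (\<Sum>r<n. \<Sum>s<n. ?D $$ (r, s) * M $$ (s, r))"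
      using M h by (intro mtrace_mult minus_carrier_mat) auto
    also have "\<dots> = (\<Sum>r<n. \<Sum>s<n. t (r, s) * ?D $$ (r, s))"
      by (intro sum.cong refl) (auto simp: M_def)
    also have "\<dots> = (\<Sum>rs\<in>{..<n} \<times> {..<n}. t rs * ?D $$ rs)" by (simp add: sum.cartesian_product)
    finally show "w ^ l dvd (\<Sum>rs\<in>{..<n} \<times> {..<n}. t rs * ?D $$ rs)" .
  qed (use finT in auto)
  then obtain s where s: "\<And>r k. r < n \<Longrightarrow> k < n \<Longrightarrow> w ^ l dvd (\<Sum>c\<in>T <+> T. A (r, k) c * s c) - ?D $$ (r, k)"
    by auto
  define P where "P = mat n n (\<lambda>(i, j). if i \<le> j then s (Inl (i, j)) else 0)"
  define Q where "Q = mat n n (\<lambda>(i, j). if i \<le> j then s (Inr (i, j)) else 0)"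
  have PQ: "P \<in> carrier_mat n n" "Q \<in> carrier_mat n n" by (auto simp: P_def Q_def)
  have sum_T: "(\<Sum>ij\<in>T. f ij) = (\<Sum>i<n. \<Sum>j<n. if i \<le> j then f (i, j) else 0)" for f :: "nat \<times> nat \<Rightarrow> 'a"
    unfolding sum.cartesian_product
    by (rule sum.mono_neutral_cong_left) (auto simp: T_def split: if_splits)
  have sol: "mcong n (w ^ l) (h * P - Q * h) ?D"
  proof (rule mcongI)
    fix r k assume rk: "r < n" "k < n"
    have "(\<Sum>ij\<in>T. A (r, k) (Inl ij) * s (Inl ij)) = (\<Sum>i<n. \<Sum>j<n. if j = k then h $$ (r, i) * P $$ (i, k) else 0)"
      unfolding sum_T by (intro sum.cong refl) (auto simp: A_def P_def)
    also have "\<dots> = (\<Sum>i<n. h $$ (r, i) * P $$ (i, k))" using rk by simp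
    also have "\<dots> = (h * P) $$ (r, k)" using rk h PQ by (intro mat_mult_entry[symmetric])
    finally have 1: "(\<Sum>ij\<in>T. A (r, k) (Inl ij) * s (Inl ij)) = (h * P) $$ (r, k)" .
    have "(\<Sum>ij\<in>T. A (r, k) (Inr ij) * s (Inr ij)) = (\<Sum>i<n. \<Sum>j<n. if i = r then - (Q $$ (r, j) * h $$ (j, k)) else 0)"
      unfolding sum_T by (intro sum.cong refl) (auto simp: A_def Q_def)
    also have "\<dots> = (\<Sum>j<n. \<Sum>i<n. if i = r then - (Q $$ (r, j) * h $$ (j, k)) else 0)" by (rule sum.swap)
    also have "\<dots> = - (\<Sum>j<n. Q $$ (r, j) * h $$ (j, k))" using rk by (simp add: sum_negf)
    also have "(\<Sum>j<n. Q $$ (r, j) * h $$ (j, k)) = (Q * h) $$ (r, k)"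
      using rk h PQ by (intro mat_mult_entry[symmetric])
    finally have 2: "(\<Sum>ij\<in>T. A (r, k) (Inr ij) * s (Inr ij)) = - (Q * h) $$ (r, k)" .
    have "(\<Sum>c\<in>T <+> T. A (r, k) c * s c) = (h * P) $$ (r, k) - (Q * h) $$ (r, k)"
      using 1 2 finT by (simp add: sum.Plus)
    also have "\<dots> = (h * P - Q * h) $$ (r, k)" using rk h PQ by auto
    finally show "w ^ l dvd (h * P - Q * h) $$ (r, k) - ?D $$ (r, k)" using s[OF rk] by simp
  qed (use h PQ in \<open>auto intro!: minus_carrier_mat\<close>)
  have x: "x0 + P \<in> hess" "x0 + Q \<in> hess" by (auto simp: hess_def P_def Q_def x0_def)
  have d1: "h * (x0 + P) = h * x0 + h * P" using h PQ by (intro mult_add_distrib_mat) auto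
  have d2: "(x0 + Q) * h = x0 * h + Q * h" using h PQ by (intro add_mult_distrib_mat) auto
  have "mcong n (w ^ l) (h * (x0 + P)) ((x0 + Q) * h)"
  proof (rule mcongI)
    fix i j assume ij: "i < n" "j < n"
    have e: "(M + N) $$ (i, j) = M $$ (i, j) + N $$ (i, j)" "(M - N) $$ (i, j) = M $$ (i, j) - N $$ (i, j)"
      if "M \<in> carrier_mat n n" "N \<in> carrier_mat n n" for M N :: "'a mat"
      using ij that by auto
    have "(h * (x0 + P)) $$ (i, j) - ((x0 + Q) * h) $$ (i, j) = (h * P - Q * h) $$ (i, j) - ?D $$ (i, j)"
      unfolding d1 d2 using h PQ by (simp add: e del: index_mult_mat index_add_mat index_minus_mat)
    then show "w ^ l dvd (h * (x0 + P)) $$ (i, j) - ((x0 + Q) * h) $$ (i, j)"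
      using mcongD(3)[OF sol ij] by simp
  qed (use h PQ in auto)
  then show ?thesis using that x by blast
qed

end

section \<open>Eigenvectors in invariant subspaces\<close>

definition poly_act :: "nat \<Rightarrow> complex mat \<Rightarrow> complex poly \<Rightarrow> complex vec \<Rightarrow> complex vec" where
  "poly_act d B p v = vec d (\<lambda>i. \<Sum>k\<le>degree p. coeff p k * (B ^\<^sub>m k *\<^sub>v v) $ i)"

lemma poly_act_bound:
  assumes "degree p \<le> N" "i < d"
  shows "poly_act d B p v $ i = (\<Sum>k\<le>N. coeff p k * (B ^\<^sub>m k *\<^sub>v v) $ i)"
proof -
  have "(\<Sum>k\<le>degree p. coeff p k * (B ^\<^sub>m k *\<^sub>v v) $ i) = (\<Sum>k\<le>N. coeff p k * (B ^\<^sub>m k *\<^sub>v v) $ i)"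
    by (rule sum.mono_neutral_left) (use assms in \<open>auto simp: coeff_eq_0\<close>)
  then show ?thesis using assms by (simp add: poly_act_def)
qed

lemma poly_act_linear_factor:
  assumes B: "B \<in> carrier_mat d d" and v: "v \<in> carrier_vec d"
  shows "poly_act d B ([:- \<mu>, 1:] * q) v = B *\<^sub>v poly_act d B q v - \<mu> \<cdot>\<^sub>v poly_act d B q v"
proof (rule eq_vecI)
  fix i assume "i < dim_vec (B *\<^sub>v poly_act d B q v - \<mu> \<cdot>\<^sub>v poly_act d B q v)"
  then have i: "i < d" by (simp add: poly_act_def)
  have pow: "B ^\<^sub>m Suc k *\<^sub>v v = B *\<^sub>v (B ^\<^sub>m k *\<^sub>v v)" for k
    using B v pow_mat_comm[OF B, of k] by (simp add: assoc_mult_mat_vec[of _ d d _ d])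
  have co: "coeff ([:- \<mu>, 1:] * q) k = (case k of 0 \<Rightarrow> 0 | Suc j \<Rightarrow> coeff q j) - \<mu> * coeff q k" for k
    by (simp add: coeff_pCons split: nat.split)
  let ?N = "Suc (degree q)"
  have deg: "degree ([:- \<mu>, 1:] * q) \<le> ?N"
    by (rule order_trans[OF degree_mult_le]) simp
  have "poly_act d B ([:- \<mu>, 1:] * q) v $ i = (\<Sum>k\<le>?N. ((case k of 0 \<Rightarrow> 0 | Suc j \<Rightarrow> coeff q j) - \<mu> * coeff q k) * (B ^\<^sub>m k *\<^sub>v v) $ i)"
    unfolding poly_act_bound[OF deg i] co ..
  also have "\<dots> = (\<Sum>k\<le>?N. (case k of 0 \<Rightarrow> 0 | Suc j \<Rightarrow> coeff q j) * (B ^\<^sub>m k *\<^sub>v v) $ i)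
      - \<mu> * (\<Sum>k\<le>?N. coeff q k * (B ^\<^sub>m k *\<^sub>v v) $ i)"
    by (simp add: left_diff_distrib sum_subtractf sum_distrib_left mult.assoc del: sum.atMost_Suc pow_mat.simps)
  also have "(\<Sum>k\<le>?N. coeff q k * (B ^\<^sub>m k *\<^sub>v v) $ i) = poly_act d B q v $ i"
    by (rule poly_act_bound[symmetric]) (use i in auto)
  also have "(\<Sum>k\<le>?N. (case k of 0 \<Rightarrow> 0 | Suc j \<Rightarrow> coeff q j) * (B ^\<^sub>m k *\<^sub>v v) $ i)
      = (\<Sum>k\<le>degree q. coeff q k * (B *\<^sub>v (B ^\<^sub>m k *\<^sub>v v)) $ i)"
    unfolding pow[symmetric] by (subst sum.atMost_Suc_shift) simp
  also have "\<dots> = (\<Sum>k\<le>degree q. \<Sum>t<d. coeff q k * (B $$ (i, t) * (B ^\<^sub>m k *\<^sub>v v) $ t))"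
    using B v i by (auto simp: scalar_prod_def atLeast0LessThan sum_distrib_left intro!: sum.cong)
  also have "\<dots> = (\<Sum>t<d. B $$ (i, t) * (\<Sum>k\<le>degree q. coeff q k * (B ^\<^sub>m k *\<^sub>v v) $ t))"
    by (subst sum.swap) (simp add: sum_distrib_left ac_simps)
  also have "\<dots> = (B *\<^sub>v poly_act d B q v) $ i"
    using B i by (auto simp: poly_act_def scalar_prod_def atLeast0LessThan)
  finally show "poly_act d B ([:- \<mu>, 1:] * q) v $ i = (B *\<^sub>v poly_act d B q v - \<mu> \<cdot>\<^sub>v poly_act d B q v) $ i"
    using i B by (simp add: poly_act_def)
qed (use B in \<open>auto simp: poly_act_def\<close>)

text \<open>The d + 1 vectors v, B v, ..., B^d v in dimension d are linearly dependent.\<close>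

lemma annihilating_poly:
  assumes B: "B \<in> carrier_mat d d" and v: "v \<in> carrier_vec d"
  obtains p where "p \<noteq> 0" "poly_act d B p v = 0\<^sub>v d"
proof -
  \<comment> \<open>A zero row at the bottom makes the matrix square, so that dependence of the
    columns follows from a vanishing determinant.\<close>
  define K where "K = mat (Suc d) (Suc d) (\<lambda>(i, k). if i < d then (B ^\<^sub>m k *\<^sub>v v) $ i else 0)"
  have K: "K \<in> carrier_mat (Suc d) (Suc d)" by (simp add: K_def)
  have "det (transpose_mat K) = 0"
  proof -
    have "transpose_mat K *\<^sub>v unit_vec (Suc d) d = 0\<^sub>v (Suc d)"
      by (rule eq_vecI) (auto simp: K_def)
    moreover have "unit_vec (Suc d) d \<noteq> (0\<^sub>v (Suc d) :: complex vec)" by simp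
    ultimately show ?thesis
      using det_0_iff_vec_prod_zero_field[of "transpose_mat K" "Suc d"] K unit_vec_carrier by (metis transpose_carrier_mat)
  qed
  then have "det K = 0" using det_transpose[OF K] by simp
  then obtain c where c: "c \<in> carrier_vec (Suc d)" "c \<noteq> 0\<^sub>v (Suc d)" "K *\<^sub>v c = 0\<^sub>v (Suc d)"
    using det_0_iff_vec_prod_zero_field[OF K] by auto
  define p where "p = Poly (list_of_vec c)"
  have co: "coeff p k = (if k \<le> d then c $ k else 0)" for k
    using c by (auto simp: p_def coeff_Poly_eq nth_default_def list_of_vec_index)
  have "p \<noteq> 0"
  proof
    assume "p = 0"
    then have "c $ k = 0" if "k \<le> d" for k using co[of k] that by simp
    then have "c = 0\<^sub>v (Suc d)" using c by (intro eq_vecI) auto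
    then show False using c by simp
  qed
  moreover have "poly_act d B p v = 0\<^sub>v d"
  proof (rule eq_vecI)
    fix i assume "i < dim_vec (0\<^sub>v d :: complex vec)"
    then have i: "i < d" by simp
    have "degree p \<le> d" by (rule degree_le) (simp add: co)
    then have "poly_act d B p v $ i = (\<Sum>k\<le>d. coeff p k * (B ^\<^sub>m k *\<^sub>v v) $ i)" using i by (rule poly_act_bound)
    also have "\<dots> = (\<Sum>k\<le>d. K $$ (i, k) * c $ k)" using i by (intro sum.cong) (auto simp: co K_def)
    also have "\<dots> = (K *\<^sub>v c) $ i"
      using K c(1) i by (auto simp: scalar_prod_def atLeast0LessThan lessThan_Suc_atMost)
    finally have "poly_act d B p v $ i = (K *\<^sub>v c) $ i" .
    then show "poly_act d B p v $ i = 0\<^sub>v d $ i" unfolding c(3) using i by simp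
  qed (simp add: poly_act_def)
  ultimately show ?thesis using that by blast
qed

text \<open>Split off a root of an annihilating polynomial of v: either the quotient still
  annihilates v and has smaller degree, or its value at v is an eigenvector. That value is a
  combination of iterates of v and therefore stays in \<open>W\<close>.\<close>

lemma eigenvector_in_subspace:
  assumes B: "B \<in> carrier_mat d d" and W: "is_subspace d W" "\<And>v. v \<in> W \<Longrightarrow> B *\<^sub>v v \<in> W"
    and v: "v \<in> W" "v \<noteq> 0\<^sub>v d"
  obtains v1 \<mu> where "v1 \<in> W" "v1 \<noteq> 0\<^sub>v d" "B *\<^sub>v v1 = \<mu> \<cdot>\<^sub>v v1"
proof -
  have sub: "W \<subseteq> carrier_vec d" and add: "\<And>x y. x \<in> W \<Longrightarrow> y \<in> W \<Longrightarrow> x + y \<in> W"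
    and smu: "\<And>c x. x \<in> W \<Longrightarrow> c \<cdot>\<^sub>v x \<in> W" and zero: "0\<^sub>v d \<in> W"
    using W(1) by (auto simp: is_subspace_def)
  have vc: "v \<in> carrier_vec d" using v sub by auto
  have minus: "B *\<^sub>v x - \<mu> \<cdot>\<^sub>v x \<in> W" if x: "x \<in> W" for x \<mu>
  proof -
    have "B *\<^sub>v x - \<mu> \<cdot>\<^sub>v x = B *\<^sub>v x + (- \<mu>) \<cdot>\<^sub>v x" using x sub B by (intro eq_vecI) auto
    then show ?thesis using add[OF W(2)[OF x] smu[OF x]] by simp
  qed
  have "poly_act d B p v = 0\<^sub>v d \<Longrightarrow> p \<noteq> 0 \<Longrightarrow>
      \<exists>q \<mu>. poly_act d B q v \<noteq> 0\<^sub>v d \<and> B *\<^sub>v poly_act d B q v = \<mu> \<cdot>\<^sub>v poly_act d B q v" for p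
  proof (induction "degree p" arbitrary: p rule: less_induct)
    case less
    show ?case
    proof (cases "degree p = 0")
      case True
      then obtain c where c: "p = [:c:]" by (rule degree_eq_zeroE)
      then have "c \<cdot>\<^sub>v v = 0\<^sub>v d" using less.prems vc B by (auto simp: poly_act_def vec_eq_iff)
      moreover have "c \<noteq> 0" using c less.prems by auto
      ultimately have "v = 0\<^sub>v d" using vc by (auto simp: vec_eq_iff)
      then show ?thesis using v by simp
    next
      case False
      then have "\<not> constant (poly p)" by (simp add: constant_degree)
      then obtain \<mu> where "poly p \<mu> = 0" using fundamental_theorem_of_algebra by blast
      then obtain q where q: "p = [:- \<mu>, 1:] * q" by (auto simp: poly_eq_0_iff_dvd elim: dvdE)
      have q0: "q \<noteq> 0" using q less.prems by auto
      then have "degree p = Suc (degree q)" unfolding q by (subst degree_mult_eq) auto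
      then have dq: "degree q < degree p" by simp
      show ?thesis
      proof (cases "poly_act d B q v = 0\<^sub>v d")
        case True show ?thesis by (rule less.hyps[OF dq True q0])
      next
        case False
        have ca: "poly_act d B q v \<in> carrier_vec d" unfolding poly_act_def by (rule vec_carrier)
        have z: "B *\<^sub>v poly_act d B q v - \<mu> \<cdot>\<^sub>v poly_act d B q v = 0\<^sub>v d"
          using less.prems(1) unfolding q poly_act_linear_factor[OF B vc] .
        have "B *\<^sub>v poly_act d B q v = \<mu> \<cdot>\<^sub>v poly_act d B q v"
        proof (rule eq_vecI)
          fix i assume "i < dim_vec (\<mu> \<cdot>\<^sub>v poly_act d B q v)"
          then have i: "i < d" using ca by auto
          then have "(B *\<^sub>v poly_act d B q v - \<mu> \<cdot>\<^sub>v poly_act d B q v) $ i = 0" using z by simp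
          then show "(B *\<^sub>v poly_act d B q v) $ i = (\<mu> \<cdot>\<^sub>v poly_act d B q v) $ i"
            using i B ca by simp
        qed (use B ca in auto)
        then show ?thesis using False by blast
      qed
    qed
  qed
  then obtain q \<mu> where q: "poly_act d B q v \<noteq> 0\<^sub>v d" "B *\<^sub>v poly_act d B q v = \<mu> \<cdot>\<^sub>v poly_act d B q v"
    using annihilating_poly[OF B vc] by metis
  have pw: "B ^\<^sub>m k *\<^sub>v v \<in> W" for k
  proof (induction k)
    case 0 then show ?case using B vc v by simp
  next
    case (Suc k)
    have "B ^\<^sub>m Suc k *\<^sub>v v = B *\<^sub>v (B ^\<^sub>m k *\<^sub>v v)"
      using B vc pow_mat_comm[OF B, of k] by (simp add: assoc_mult_mat_vec[of _ d d _ d])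
    then show ?case using W(2)[OF Suc] by simp
  qed
  have "vec d (\<lambda>i. \<Sum>k\<in>{..<N}. f k * (B ^\<^sub>m k *\<^sub>v v) $ i) \<in> W" for N f
  proof (induction N)
    case 0
    have "vec d (\<lambda>i. 0) = (0\<^sub>v d :: complex vec)" by auto
    then show ?case using zero by simp
  next
    case (Suc N)
    have "vec d (\<lambda>i. \<Sum>k\<in>{..<Suc N}. f k * (B ^\<^sub>m k *\<^sub>v v) $ i)
        = vec d (\<lambda>i. \<Sum>k\<in>{..<N}. f k * (B ^\<^sub>m k *\<^sub>v v) $ i) + f N \<cdot>\<^sub>v (B ^\<^sub>m N *\<^sub>v v)"
      using B by (intro eq_vecI) auto
    then show ?case using add[OF Suc smu[OF pw]] by simp
  qed
  then have "poly_act d B q v \<in> W" unfolding poly_act_def lessThan_Suc_atMost[symmetric] .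
  then show ?thesis using that q by blast
qed

section \<open>Uniqueness of Whittaker models\<close>

lemma msum_reindex_uni:
  assumes fin: "finite (mreps n q (uni n))"
    and f: "\<And>A. A \<in> uni n \<Longrightarrow> f A \<in> uni n"
    and f_inj: "\<And>A A'. A \<in> uni n \<Longrightarrow> A' \<in> uni n \<Longrightarrow> mcong n q (f A) (f A') \<Longrightarrow> mcong n q A A'"
    and F: "\<And>A A'. A \<in> uni n \<Longrightarrow> A' \<in> uni n \<Longrightarrow> mcong n q A A' \<Longrightarrow> F A = F A'"
  shows "msum d (mreps n q (uni n)) (\<lambda>A. F (f A)) = msum d (mreps n q (uni n)) F"
proof (rule eq_matI)
  fix i j assume "i < dim_row (msum d (mreps n q (uni n)) F)" "j < dim_col (msum d (mreps n q (uni n)) F)"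
  then have ij: "i < d" "j < d" by (auto simp: msum_def)
  show "msum d (mreps n q (uni n)) (\<lambda>A. F (f A)) $$ (i, j) = msum d (mreps n q (uni n)) F $$ (i, j)"
    unfolding msum_entry[OF ij]
    by (rule sum_mreps_reindex[OF uni_sub fin f f_inj, where F = "\<lambda>A. F A $$ (i, j)"]) (use F in \<open>auto intro: arg_cong\<close>)
qed (auto simp: msum_def)

locale whittaker_rep = whittaker w n a b g l \<phi>
  for w :: "'a::idom" and n :: nat and a b :: 'a and g :: grp_type and l :: nat and \<phi> :: "'a \<Rightarrow> complex" +
  fixes d :: nat and \<rho> :: "'a mat set \<Rightarrow> complex mat"
  assumes rep: "is_rep (Grp w g n l) d \<rho>"
begin

section \<open>The averaging operator and its equivariance\<close>

definition r :: "'a mat \<Rightarrow> complex mat" where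
  "r A = \<rho> (mcls w n l A)"

definition th :: "'a mat \<Rightarrow> complex" where
  "th u = \<phi> (mtrace (x0 * u))"

abbreviation "RU \<equiv> mreps n (w ^ l) (uni n :: 'a mat set)"

text \<open>Not divided by the group order: the square of \<open>E\<close> is \<open>card RU\<close>
  times \<open>E\<close>, and this nonzero scalar accompanies every later insertion of an
  \<open>E\<close>.\<close>

definition E :: "complex mat" where
  "E = msum d RU (\<lambda>u. inverse (th u) \<cdot>\<^sub>m r u)"

lemma r_carrier [simp]: "A \<in> G0 \<Longrightarrow> r A \<in> carrier_mat d d"
  using rep mcls_G0 by (auto simp: is_rep_def r_def)

lemma r_cong: "mcong n (w ^ l) A B \<Longrightarrow> r A = r B"
  using mcls_eq_iff mcongD(1,2) by (metis r_def)

lemma r_one: "r (1\<^sub>m n) = 1\<^sub>m d"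
  using rep by (simp add: is_rep_def r_def Grp_def)

lemma r_mult: "A \<in> G0 \<Longrightarrow> B \<in> G0 \<Longrightarrow> r (A * B) = r A * r B"
  using rep mcls_G0 Grp_mult[OF G0_carrier G0_carrier, of A B w g l] unfolding is_rep_def r_def by metis

lemma r_uni [simp]: "u \<in> uni n \<Longrightarrow> r u \<in> carrier_mat d d"
  by (rule r_carrier[OF uni_G0])

lemma finite_RU: "finite RU" by (rule finite_mreps[OF uni_sub])

lemma RU_uni: "u \<in> RU \<Longrightarrow> u \<in> uni n" using mreps_subset[OF uni_sub] by blast

lemma card_RU: "of_nat (card RU) \<noteq> (0::complex)"
proof -
  have "mrep n (w ^ l) (uni n) (1\<^sub>m n) \<in> RU" using uni_one by (auto simp: mreps_def)
  then show ?thesis using finite_RU by auto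
qed

lemma E_carrier [simp]: "E \<in> carrier_mat d d" by (simp add: E_def)

lemma th_mult: "u \<in> uni n \<Longrightarrow> v \<in> uni n \<Longrightarrow> th (u * v) = th u * th v"
  by (simp add: th_def tr_x0_uni_mult phi_add)

lemma th_nz [simp]: "th u \<noteq> 0" by (simp add: th_def phi_nz)

lemma th_cong: "mcong n (w ^ l) u v \<Longrightarrow> th u = th v"
  unfolding th_def by (intro phi_per mtrace_mcong[of n] mcong_mult_left x0_carrier)

lemma th_iota: "u \<in> uni n \<Longrightarrow> th (iota u) = th u"
  by (simp add: th_def tr_x0_iota uni_carrier)

lemma uni_cancel_left:
  fixes u :: "'a mat"
  assumes u: "u \<in> uni n" and A: "A \<in> carrier_mat n n" "A' \<in> carrier_mat n n" "mcong n q (u * A) (u * A')"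
  shows "mcong n q A A'"
proof -
  obtain v where v: "v \<in> uni n" "v * u = 1\<^sub>m n" using uni_inverse[OF u] by metis
  note c = uni_carrier[OF u] uni_carrier[OF v(1)]
  have "mcong n q (v * (u * A)) (v * (u * A'))" by (rule mcong_mult_left[OF c(2) A(3)])
  moreover have "v * (u * B) = B" if "B \<in> carrier_mat n n" for B
    using that c v by (simp add: assoc_mult_mat[of _ n n _ n _ n, symmetric])
  ultimately show ?thesis using A by simp
qed

lemma uni_cancel_right:
  fixes u :: "'a mat"
  assumes u: "u \<in> uni n" and A: "A \<in> carrier_mat n n" "A' \<in> carrier_mat n n" "mcong n q (A * u) (A' * u)"
  shows "mcong n q A A'"
proof -
  obtain v where v: "v \<in> uni n" "u * v = 1\<^sub>m n" using uni_inverse[OF u] by metis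
  note c = uni_carrier[OF u] uni_carrier[OF v(1)]
  have "mcong n q (A * u * v) (A' * u * v)" by (rule mcong_mult_right[OF c(2) A(3)])
  moreover have "B * u * v = B" if "B \<in> carrier_mat n n" for B
    using that c v by (simp add: assoc_mult_mat[of _ n n _ n _ n])
  ultimately show ?thesis using A by simp
qed

lemma E_left:
  assumes u: "u \<in> uni n" shows "r u * E = th u \<cdot>\<^sub>m E"
proof -
  have "r u * E = msum d RU (\<lambda>v. r u * (inverse (th v) \<cdot>\<^sub>m r v))"
    unfolding E_def using u RU_uni by (intro msum_left) auto
  also have "\<dots> = msum d RU (\<lambda>v. th u \<cdot>\<^sub>m (inverse (th (u * v)) \<cdot>\<^sub>m r (u * v)))"
  proof (rule msum_cong[OF refl])
    fix v assume "v \<in> RU"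
    then have v: "v \<in> uni n" by (rule RU_uni)
    then show "r u * (inverse (th v) \<cdot>\<^sub>m r v) = th u \<cdot>\<^sub>m (inverse (th (u * v)) \<cdot>\<^sub>m r (u * v))"
      using u by (subst mult_smult_distrib[of _ d d _ d]) (auto simp: th_mult r_mult uni_G0 intro!: eq_matI)
  qed
  also have "\<dots> = th u \<cdot>\<^sub>m msum d RU (\<lambda>v. inverse (th (u * v)) \<cdot>\<^sub>m r (u * v))"
    using u RU_uni by (intro msum_smult[symmetric]) (auto simp: uni_mult)
  also have "msum d RU (\<lambda>v. inverse (th (u * v)) \<cdot>\<^sub>m r (u * v)) = E"
    unfolding E_def
  proof (rule msum_reindex_uni[OF finite_RU, where F = "\<lambda>v. inverse (th v) \<cdot>\<^sub>m r v"])
    fix A A' :: "'a mat" assume A: "A \<in> uni n" "A' \<in> uni n"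
    show "mcong n (w ^ l) A A'" if "mcong n (w ^ l) (u * A) (u * A')"
      by (rule uni_cancel_left[OF u uni_carrier[OF A(1)] uni_carrier[OF A(2)] that])
    show "inverse (th A) \<cdot>\<^sub>m r A = inverse (th A') \<cdot>\<^sub>m r A'" if "mcong n (w ^ l) A A'"
      using th_cong[OF that] r_cong[OF that] by simp
  qed (use u in \<open>auto intro: uni_mult\<close>)
  finally show ?thesis .
qed

lemma E_right:
  assumes u: "u \<in> uni n" shows "E * r u = th u \<cdot>\<^sub>m E"
proof -
  have "E * r u = msum d RU (\<lambda>v. (inverse (th v) \<cdot>\<^sub>m r v) * r u)"
    unfolding E_def using u RU_uni by (intro msum_right) auto
  also have "\<dots> = msum d RU (\<lambda>v. th u \<cdot>\<^sub>m (inverse (th (v * u)) \<cdot>\<^sub>m r (v * u)))"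
  proof (rule msum_cong[OF refl])
    fix v assume "v \<in> RU"
    then have v: "v \<in> uni n" by (rule RU_uni)
    then show "(inverse (th v) \<cdot>\<^sub>m r v) * r u = th u \<cdot>\<^sub>m (inverse (th (v * u)) \<cdot>\<^sub>m r (v * u))"
      using u by (subst mult_smult_assoc_mat[of _ d d _ d]) (auto simp: th_mult r_mult uni_G0 intro!: eq_matI)
  qed
  also have "\<dots> = th u \<cdot>\<^sub>m msum d RU (\<lambda>v. inverse (th (v * u)) \<cdot>\<^sub>m r (v * u))"
    using u RU_uni by (intro msum_smult[symmetric]) (auto simp: uni_mult)
  also have "msum d RU (\<lambda>v. inverse (th (v * u)) \<cdot>\<^sub>m r (v * u)) = E"
    unfolding E_def
  proof (rule msum_reindex_uni[OF finite_RU, where F = "\<lambda>v. inverse (th v) \<cdot>\<^sub>m r v"])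
    fix A A' :: "'a mat" assume A: "A \<in> uni n" "A' \<in> uni n"
    show "mcong n (w ^ l) A A'" if "mcong n (w ^ l) (A * u) (A' * u)"
      by (rule uni_cancel_right[OF u uni_carrier[OF A(1)] uni_carrier[OF A(2)] that])
    show "inverse (th A) \<cdot>\<^sub>m r A = inverse (th A') \<cdot>\<^sub>m r A'" if "mcong n (w ^ l) A A'"
      using th_cong[OF that] r_cong[OF that] by simp
  qed (use u in \<open>auto intro: uni_mult\<close>)
  finally show ?thesis .
qed

lemma E_E: "E * E = of_nat (card RU) \<cdot>\<^sub>m E"
proof -
  have "E * E = msum d RU (\<lambda>v. (inverse (th v) \<cdot>\<^sub>m r v) * E)"
    unfolding E_def using RU_uni by (subst msum_right) auto
  also have "\<dots> = msum d RU (\<lambda>v. E)"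
  proof (rule msum_cong[OF refl])
    fix v assume "v \<in> RU"
    then have v: "v \<in> uni n" by (rule RU_uni)
    have "(inverse (th v) \<cdot>\<^sub>m r v) * E = inverse (th v) \<cdot>\<^sub>m (r v * E)"
      using v by (intro mult_smult_assoc_mat[of _ d d _ d]) auto
    also have "\<dots> = E" unfolding E_left[OF v] using th_nz[of v] by (intro eq_matI) (auto simp: field_simps)
    finally show "(inverse (th v) \<cdot>\<^sub>m r v) * E = E" .
  qed
  also have "\<dots> = of_nat (card RU) \<cdot>\<^sub>m E" by (rule msum_const) simp
  finally show ?thesis .
qed

text \<open>The element of the Hecke algebra attached to the double coset of h; unitriangular
  factors on either side only rescale it by theta.\<close>

definition Q :: "'a mat \<Rightarrow> complex mat" where
  "Q h = E * r h * E"

lemma Q_carrier [simp]: "h \<in> G0 \<Longrightarrow> Q h \<in> carrier_mat d d" by (simp add: Q_def)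

lemma Q_uni:
  assumes h: "h \<in> G0" and u: "u \<in> uni n"
  shows "Q (u * h) = th u \<cdot>\<^sub>m Q h" "Q (h * u) = th u \<cdot>\<^sub>m Q h"
proof -
  note as = assoc_mult_mat[of _ d d _ d _ d]
  have "Q (u * h) = (E * r u) * (r h * E)" unfolding Q_def using h u by (simp add: r_mult uni_G0 as)
  also have "\<dots> = th u \<cdot>\<^sub>m (E * (r h * E))" unfolding E_right[OF u] using h by (intro mult_smult_assoc_mat[of _ d d _ d]) auto
  finally show "Q (u * h) = th u \<cdot>\<^sub>m Q h" unfolding Q_def using h by (simp add: as)
  have "Q (h * u) = (E * r h) * (r u * E)" unfolding Q_def using h u by (simp add: r_mult uni_G0 as)
  also have "\<dots> = th u \<cdot>\<^sub>m (E * r h * E)" unfolding E_left[OF u] using h by (intro mult_smult_distrib[of _ d d _ d]) auto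
  finally show "Q (h * u) = th u \<cdot>\<^sub>m Q h" unfolding Q_def .
qed

lemma Q_cong: "mcong n (w ^ l) h k \<Longrightarrow> Q h = Q k"
  unfolding Q_def by (simp add: r_cong)

text \<open>The two descriptions of the same double coset element scale \<open>Q h\<close> by
  different values of theta.\<close>

lemma Q_unsupported:
  assumes h: "h \<in> G0" and u: "u \<in> uni n" "v \<in> uni n" and e: "mcong n (w ^ l) (h * u) (v * h)"
    and ne: "th u \<noteq> th v"
  shows "Q h = 0\<^sub>m d d"
proof -
  have e: "th u \<cdot>\<^sub>m Q h = th v \<cdot>\<^sub>m Q h" using Q_cong[OF e] Q_uni[OF h] u by simp
  show ?thesis
  proof (rule eq_matI)
    fix i j assume "i < dim_row (0\<^sub>m d d :: complex mat)" "j < dim_col (0\<^sub>m d d :: complex mat)"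
    then have ij: "i < d" "j < d" by auto
    have "(th u \<cdot>\<^sub>m Q h) $$ (i, j) = (th v \<cdot>\<^sub>m Q h) $$ (i, j)" using e by simp
    then show "Q h $$ (i, j) = 0\<^sub>m d d $$ (i, j)" using ij Q_carrier[OF h] ne by auto
  qed (use Q_carrier[OF h] in auto)
qed

lemma th_one_plus:
  assumes "F \<in> strict_upper n" shows "th (1\<^sub>m n + F) = \<phi> (mtrace (x0 * F))"
proof -
  have F: "F \<in> carrier_mat n n" using assms by (simp add: strict_upper_def)
  have "mtrace (x0 * (1\<^sub>m n + F)) = mtrace (x0 * 1\<^sub>m n + x0 * F)"
    using F by (subst mult_add_distrib_mat[of _ n n _ n]) auto
  also have "\<dots> = mtrace (x0 * F)" using F by (subst mtrace_add[of _ n]) (auto simp: tr_x0_one[simplified])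
  finally show ?thesis by (simp add: th_def)
qed

text \<open>Either theta and its conjugate by h disagree somewhere; then both sides vanish, because
  \<open>iota\<close> carries the disagreeing pair to one for \<open>iota h\<close>. Or h
  intertwines two Hessenberg matrices, and \<open>iota h\<close> lies in its double coset with
  matching values of theta.\<close>

lemma Q_iota:
  assumes h: "h \<in> G0" shows "Q (iota h) = Q h"
proof (cases "\<exists>E1 E2. E1 \<in> strict_upper n \<and> E2 \<in> strict_upper n \<and>
    mcong n (w ^ l) (h * (1\<^sub>m n + E1)) ((1\<^sub>m n + E2) * h) \<and> \<phi> (mtrace (x0 * E1)) \<noteq> \<phi> (mtrace (x0 * E2))")
  case True
  then obtain E1 E2 where E12: "E1 \<in> strict_upper n" "E2 \<in> strict_upper n"
    "mcong n (w ^ l) (h * (1\<^sub>m n + E1)) ((1\<^sub>m n + E2) * h)" "\<phi> (mtrace (x0 * E1)) \<noteq> \<phi> (mtrace (x0 * E2))"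
    by blast
  let ?u = "1\<^sub>m n + E1" and ?v = "1\<^sub>m n + E2"
  have u: "?u \<in> uni n" "?v \<in> uni n" using E12 by (auto intro: uni_one_plus)
  have ne: "th ?u \<noteq> th ?v" using E12 by (simp add: th_one_plus)
  note c = G0_carrier[OF h] uni_carrier[OF u(1)] uni_carrier[OF u(2)]
  have 1: "Q h = 0\<^sub>m d d" by (rule Q_unsupported[OF h u E12(3) ne])
  have "mcong n (w ^ l) (iota ((?v) * h)) (iota (h * ?u))" by (rule iota_mcong[OF mcong_sym[OF E12(3)]])
  then have "mcong n (w ^ l) (iota h * iota ?v) (iota ?u * iota h)" unfolding iota_mult[OF c(1,2)] iota_mult[OF c(3,1)] .
  then have "Q (iota h) = 0\<^sub>m d d"
    by (rule Q_unsupported[OF iota_G0[OF h] iota_uni[OF u(2)] iota_uni[OF u(1)]]) (use ne u in \<open>simp add: th_iota\<close>)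
  then show ?thesis using 1 by simp
next
  case False
  note hc = G0_carrier[OF h]
  obtain h' where h': "h' \<in> G0" "h * h' = 1\<^sub>m n" using G0_inverse[OF h] by metis
  obtain x y where xy: "x \<in> hess" "y \<in> hess" "mcong n (w ^ l) (h * x) (y * h)"
    using support_cases[OF hc] False by blast
  obtain u1 u2 where u: "u1 \<in> uni n" "u2 \<in> uni n" "mcong n (w ^ l) (u1 * iota h) (h * u2)"
    "mtrace (x0 * u1) = mtrace (x0 * u2)"
    using iota_double_coset[OF xy(1,2) hc G0_carrier[OF h'(1)] h'(2) xy(3)] .
  have "th u1 \<cdot>\<^sub>m Q (iota h) = th u1 \<cdot>\<^sub>m Q h"
    using Q_cong[OF u(3)] Q_uni(1)[OF iota_G0[OF h] u(1)] Q_uni(2)[OF h u(2)] u(4) by (simp add: th_def)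
  then have "inverse (th u1) \<cdot>\<^sub>m (th u1 \<cdot>\<^sub>m Q (iota h)) = inverse (th u1) \<cdot>\<^sub>m (th u1 \<cdot>\<^sub>m Q h)" by simp
  moreover have "inverse (th u1) \<cdot>\<^sub>m (th u1 \<cdot>\<^sub>m M) = M" for M using th_nz[of u1] by (intro eq_matI) auto
  ultimately show ?thesis by simp
qed

lemma E_r_E_r_E:
  assumes h: "h \<in> G0" "k \<in> G0"
  shows "E * r h * E * r k * E = msum d RU (\<lambda>u. inverse (th u) \<cdot>\<^sub>m Q (h * u * k))"
proof -
  note as = assoc_mult_mat[of _ d d _ d _ d]
  have "E * r h * E * r k * E = (E * r h * E) * (r k * E)" using h by (simp add: as)
  also have "\<dots> = msum d RU (\<lambda>u. (E * r h) * (inverse (th u) \<cdot>\<^sub>m r u)) * (r k * E)"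
  proof -
    have "(E * r h) * E = msum d RU (\<lambda>u. (E * r h) * (inverse (th u) \<cdot>\<^sub>m r u))"
      by (subst (2) E_def, rule msum_left) (use h RU_uni in auto)
    then show ?thesis by (simp only:)
  qed
  also have "\<dots> = msum d RU (\<lambda>u. ((E * r h) * (inverse (th u) \<cdot>\<^sub>m r u)) * (r k * E))"
    using h RU_uni by (intro msum_right) auto
  also have "\<dots> = msum d RU (\<lambda>u. inverse (th u) \<cdot>\<^sub>m Q (h * u * k))"
  proof (rule msum_cong[OF refl])
    fix u assume "u \<in> RU"
    then have u: "u \<in> G0" by (intro uni_G0 RU_uni)
    have "((E * r h) * (inverse (th u) \<cdot>\<^sub>m r u)) * (r k * E) = (inverse (th u) \<cdot>\<^sub>m (E * r h * r u)) * (r k * E)"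
      using h u by (subst mult_smult_distrib[of _ d d _ d]) auto
    also have "\<dots> = inverse (th u) \<cdot>\<^sub>m ((E * r h * r u) * (r k * E))"
      using h u by (subst mult_smult_assoc_mat[of _ d d _ d]) auto
    also have "(E * r h * r u) * (r k * E) = Q (h * u * k)"
      unfolding Q_def using h u by (simp add: r_mult G0_mult as)
    finally show "((E * r h) * (inverse (th u) \<cdot>\<^sub>m r u)) * (r k * E) = inverse (th u) \<cdot>\<^sub>m Q (h * u * k)" .
  qed
  finally show ?thesis .
qed

text \<open>Expanding the middle \<open>E\<close> gives a sum over u of Q(h u k). Applying
  \<open>iota\<close> to the argument reverses the three factors, and u may be replaced by
  \<open>iota u\<close> since this permutes the classes in U and preserves theta; the result is the
  product in the opposite order.\<close>

lemma hecke_commute: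
  assumes h: "h \<in> G0" "k \<in> G0"
  shows "E * r h * E * r k * E = E * r k * E * r h * E"
proof -
  note as = assoc_mult_mat[of _ d d _ d _ d]
  note ih = iota_G0[OF h(1)] iota_G0[OF h(2)]
  note c = G0_carrier[OF h(1)] G0_carrier[OF h(2)]
  have "E * r h * E * r k * E = msum d RU (\<lambda>u. inverse (th u) \<cdot>\<^sub>m Q (h * u * k))"
    by (rule E_r_E_r_E[OF h])
  also have "\<dots> = msum d RU (\<lambda>u. inverse (th (iota u)) \<cdot>\<^sub>m Q (iota k * iota u * iota h))"
  proof (rule msum_cong[OF refl])
    fix u assume "u \<in> RU"
    then have u: "u \<in> uni n" by (rule RU_uni)
    note uc = uni_carrier[OF u]
    have "Q (h * u * k) = Q (iota (h * u * k))" by (intro Q_iota[symmetric] G0_mult h uni_G0[OF u])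
    also have "iota (h * u * k) = iota k * iota u * iota h"
      using c uc by (simp add: iota_mult assoc_mult_mat[of _ n n _ n _ n])
    finally show "inverse (th u) \<cdot>\<^sub>m Q (h * u * k) = inverse (th (iota u)) \<cdot>\<^sub>m Q (iota k * iota u * iota h)"
      by (simp add: th_iota[OF u])
  qed
  also have "\<dots> = msum d RU (\<lambda>u. inverse (th u) \<cdot>\<^sub>m Q (iota k * u * iota h))"
  proof (rule msum_reindex_uni[OF finite_RU, where F = "\<lambda>u. inverse (th u) \<cdot>\<^sub>m Q (iota k * u * iota h)"])
    fix A A' :: "'a mat" assume A: "A \<in> uni n" "A' \<in> uni n" "mcong n (w ^ l) A A'"
    have "mcong n (w ^ l) (iota k * A * iota h) (iota k * A' * iota h)"
      using A c by (intro mcong_mult_right mcong_mult_left) auto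
    then show "inverse (th A) \<cdot>\<^sub>m Q (iota k * A * iota h) = inverse (th A') \<cdot>\<^sub>m Q (iota k * A' * iota h)"
      using Q_cong th_cong[OF A(3)] by metis
  qed (auto simp: iota_uni intro: iota_mcong_cancel[OF uni_carrier uni_carrier])
  also have "\<dots> = E * r (iota k) * E * r (iota h) * E" by (rule E_r_E_r_E[OF ih(2,1), symmetric])
  \<comment> \<open>The remaining occurrences of \<open>iota\<close> are removed one at a time, each
    inside a factor Q.\<close>
  also have "\<dots> = Q (iota k) * (r (iota h) * E)" unfolding Q_def using ih by (simp add: as)
  also have "\<dots> = E * r k * Q (iota h)" unfolding Q_iota[OF h(2)] unfolding Q_def using h ih by (simp add: as)
  also have "\<dots> = E * r k * E * r h * E" unfolding Q_iota[OF h(1)] unfolding Q_def using h by (simp add: as)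
  finally show ?thesis .
qed

end

lemma linear_msum:
  fixes L :: "complex vec \<Rightarrow> complex"
  assumes add: "\<And>u v. u \<in> carrier_vec d \<Longrightarrow> v \<in> carrier_vec d \<Longrightarrow> L (u + v) = L u + L v"
    and smult: "\<And>c v. v \<in> carrier_vec d \<Longrightarrow> L (c \<cdot>\<^sub>v v) = c * L v"
    and R: "finite R" "\<And>u. u \<in> R \<Longrightarrow> F u \<in> carrier_mat d d" and v: "v \<in> carrier_vec d"
  shows "L (msum d R F *\<^sub>v v) = (\<Sum>u\<in>R. L (F u *\<^sub>v v))"
  using R
proof (induction R rule: finite_induct)
  case empty
  have "msum d {} F *\<^sub>v v = 0 \<cdot>\<^sub>v v" using v by (intro eq_vecI) (auto simp: msum_def scalar_prod_def)
  then show ?case using smult[OF v, of 0] by simp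
next
  case (insert x R)
  have F: "F x \<in> carrier_mat d d" using insert.prems by auto
  have "msum d (insert x R) F = F x + msum d R F"
    using insert.hyps F by (intro eq_matI) (auto simp: msum_def)
  then have "msum d (insert x R) F *\<^sub>v v = F x *\<^sub>v v + msum d R F *\<^sub>v v"
    using F v by (simp add: add_mult_distrib_mat_vec[of _ d d])
  moreover have "F x *\<^sub>v v \<in> carrier_vec d" using F v by (rule mult_mat_vec_carrier)
  moreover have "msum d R F *\<^sub>v v \<in> carrier_vec d" using v by (intro mult_mat_vec_carrier[of _ d d]) auto
  ultimately show ?case using insert add by simp
qed

lemma mult_mat_vec_sq [simp]:
  "A \<in> carrier_mat d d \<Longrightarrow> v \<in> carrier_vec d \<Longrightarrow> A *\<^sub>v v \<in> carrier_vec d"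
  by (rule mult_mat_vec_carrier)

lemma smult_mat_vec:
  fixes A :: "'a::comm_ring_1 mat"
  assumes "A \<in> carrier_mat d d" "v \<in> carrier_vec d"
  shows "(c \<cdot>\<^sub>m A) *\<^sub>v v = c \<cdot>\<^sub>v (A *\<^sub>v v)" "A *\<^sub>v (c \<cdot>\<^sub>v v) = c \<cdot>\<^sub>v (A *\<^sub>v v)"
  using assms by (auto intro!: eq_vecI simp: scalar_prod_def sum_distrib_left ac_simps)

lemma mat_mult_unit_vec:
  fixes A :: "'a::comm_ring_1 mat"
  assumes A: "A \<in> carrier_mat n m" and ij: "i < n" "j < m"
  shows "(A *\<^sub>v unit_vec m j) $ i = A $$ (i, j)"
proof -
  have "(A *\<^sub>v unit_vec m j) $ i = row A i \<bullet> unit_vec m j"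
    using ij carrier_matD[OF A] by (intro index_mult_mat_vec) simp
  also have "\<dots> = row A i $ j" using ij carrier_matD[OF A] by (intro scalar_prod_right_unit) auto
  finally show ?thesis using ij carrier_matD[OF A] by simp
qed

lemma smult_vec_cancel:
  fixes c :: complex
  assumes "c \<cdot>\<^sub>v u = c \<cdot>\<^sub>v v" "c \<noteq> 0" shows "u = v"
proof -
  have dim: "dim_vec u = dim_vec v" using arg_cong[OF assms(1), of dim_vec] by simp
  have "u $ i = v $ i" if "i < dim_vec v" for i
    using arg_cong[OF assms(1), of "\<lambda>x. x $ i"] that dim assms(2) by simp
  then show ?thesis using dim by (intro eq_vecI) auto
qed

section \<open>Consequences of irreducibility for the Hecke algebra\<close>

context whittaker_rep
begin

lemma G_cases:
  assumes "x \<in> carrier (Grp w g n l)"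
  obtains A where "A \<in> G0" "x = mcls w n l A"
  using assms by (auto simp: Grp_def G0_def)

lemma irreducible_carrier:
  assumes irr: "irreducible_rep (Grp w g n l) d \<rho>"
    and W: "is_subspace d W" "\<And>A v. A \<in> G0 \<Longrightarrow> v \<in> W \<Longrightarrow> r A *\<^sub>v v \<in> W"
    and v: "v \<in> W" "v \<noteq> 0\<^sub>v d"
  shows "W = carrier_vec d"
proof -
  have "\<forall>x\<in>carrier (Grp w g n l). \<forall>v\<in>W. \<rho> x *\<^sub>v v \<in> W"
  proof (intro ballI)
    fix x u assume x: "x \<in> carrier (Grp w g n l)" and u: "u \<in> W"
    obtain A where "A \<in> G0" "x = mcls w n l A" using G_cases[OF x] .
    then show "\<rho> x *\<^sub>v u \<in> W" using W(2)[OF _ u] by (simp add: r_def)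
  qed
  then have "W = {0\<^sub>v d} \<or> W = carrier_vec d" using irr W(1) unfolding irreducible_rep_def by blast
  then show ?thesis using v by auto
qed

lemma r_vec_carrier: "A \<in> G0 \<Longrightarrow> v \<in> carrier_vec d \<Longrightarrow> r A *\<^sub>v v \<in> carrier_vec d"
  by simp

lemma r_mult_vec:
  "A \<in> G0 \<Longrightarrow> B \<in> G0 \<Longrightarrow> v \<in> carrier_vec d \<Longrightarrow> r A *\<^sub>v (r B *\<^sub>v v) = r (A * B) *\<^sub>v v"
  by (simp add: r_mult assoc_mult_mat_vec[of _ d d _ d])

lemma r_one_vec: "v \<in> carrier_vec d \<Longrightarrow> r (1\<^sub>m n) *\<^sub>v v = v"
  by (simp add: r_one)

lemma Q_vec: "h \<in> G0 \<Longrightarrow> v \<in> carrier_vec d \<Longrightarrow> Q h *\<^sub>v v = E *\<^sub>v (r h *\<^sub>v (E *\<^sub>v v))"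
  unfolding Q_def by (simp add: assoc_mult_mat_vec[of _ d d _ d])

lemma E_E_vec: "v \<in> carrier_vec d \<Longrightarrow> E *\<^sub>v (E *\<^sub>v v) = of_nat (card RU) \<cdot>\<^sub>v (E *\<^sub>v v)"
  using arg_cong[OF E_E, of "\<lambda>M. M *\<^sub>v v"] by (simp add: assoc_mult_mat_vec[of _ d d _ d] smult_mat_vec[of _ d])

lemma Q_E_vec: "h \<in> G0 \<Longrightarrow> v \<in> carrier_vec d \<Longrightarrow> Q h *\<^sub>v (E *\<^sub>v v) = of_nat (card RU) \<cdot>\<^sub>v (Q h *\<^sub>v v)"
  by (simp add: Q_vec E_E_vec smult_mat_vec[of _ d])

lemma Q_commute_vec:
  assumes "h \<in> G0" "k \<in> G0" "v \<in> carrier_vec d"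
  shows "Q h *\<^sub>v (Q k *\<^sub>v v) = Q k *\<^sub>v (Q h *\<^sub>v v)"
proof -
  have *: "Q h *\<^sub>v (Q k *\<^sub>v v) = of_nat (card RU) \<cdot>\<^sub>v ((E * r h * E * r k * E) *\<^sub>v v)"
    if "h \<in> G0" "k \<in> G0" for h k
    using that assms(3)
    by (simp add: Q_vec E_E_vec smult_mat_vec[of _ d] assoc_mult_mat_vec[of _ d d _ d])
  show ?thesis using * assms hecke_commute[OF assms(1,2)] by simp
qed

lemma subspaceI:
  assumes "W \<subseteq> carrier_vec d" "0\<^sub>v d \<in> W" "\<And>u v. u \<in> W \<Longrightarrow> v \<in> W \<Longrightarrow> u + v \<in> W"
    "\<And>c v. v \<in> W \<Longrightarrow> c \<cdot>\<^sub>v v \<in> W"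
  shows "is_subspace d W"
  using assms by (auto simp: is_subspace_def)

lemma mat_zero_vec: "A \<in> carrier_mat d d \<Longrightarrow> A *\<^sub>v 0\<^sub>v d = (0\<^sub>v d :: complex vec)"
  by (intro eq_vecI) auto

text \<open>Schur's lemma by hand. \<open>Q h\<close> has an eigenvector on the image of
  \<open>E\<close>; the vectors all of whose translates are sent by \<open>E\<close> into the
  eigenspace form a subrepresentation, which is nonzero by commutativity of the Hecke algebra and
  hence everything.\<close>

lemma Q_scalar:
  assumes irr: "irreducible_rep (Grp w g n l) d \<rho>" and h: "h \<in> G0"
  shows "\<exists>\<mu>. \<forall>v\<in>carrier_vec d. Q h *\<^sub>v v = \<mu> \<cdot>\<^sub>v (E *\<^sub>v v)"
proof (cases "\<forall>v\<in>carrier_vec d. E *\<^sub>v v = 0\<^sub>v d")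
  case True
  then have "Q h *\<^sub>v v = 0 \<cdot>\<^sub>v (E *\<^sub>v v)" if "v \<in> carrier_vec d" for v
    using that h by (simp add: Q_vec) (auto intro: mat_zero_vec simp: mat_zero_vec)
  then show ?thesis by blast
next
  case False
  then obtain u where u: "u \<in> carrier_vec d" "E *\<^sub>v u \<noteq> 0\<^sub>v d" by auto
  let ?c = "of_nat (card RU) :: complex"
  define I where "I = (\<lambda>v. E *\<^sub>v v) ` carrier_vec d"
  have I: "is_subspace d I"
  proof (rule subspaceI)
    show "I \<subseteq> carrier_vec d" by (auto simp: I_def)
    show "0\<^sub>v d \<in> I" unfolding I_def by (rule image_eqI[of _ _ "0\<^sub>v d"]) (auto simp: mat_zero_vec)
    fix c x y assume "x \<in> I" "y \<in> I"
    then obtain x' y' where "x' \<in> carrier_vec d" "y' \<in> carrier_vec d" "x = E *\<^sub>v x'" "y = E *\<^sub>v y'"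
      by (auto simp: I_def)
    then show "x + y \<in> I" unfolding I_def
      by (intro image_eqI[of _ _ "x' + y'"]) (auto simp: mult_add_distrib_mat_vec[of _ d d])
  next
    fix c x assume "x \<in> I"
    then obtain x' where "x' \<in> carrier_vec d" "x = E *\<^sub>v x'" by (auto simp: I_def)
    then show "c \<cdot>\<^sub>v x \<in> I" unfolding I_def
      by (intro image_eqI[of _ _ "c \<cdot>\<^sub>v x'"]) (auto simp: smult_mat_vec[of _ d])
  qed
  have QI: "Q h *\<^sub>v v \<in> I" if "v \<in> I" for v
    using that h by (auto simp: I_def Q_vec)
  have "E *\<^sub>v u \<in> I" using u by (auto simp: I_def)
  then obtain v1 \<mu> where v1: "v1 \<in> I" "v1 \<noteq> 0\<^sub>v d" "Q h *\<^sub>v v1 = \<mu> \<cdot>\<^sub>v v1"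
    using eigenvector_in_subspace[OF Q_carrier[OF h] I QI _ u(2)] by metis
  then obtain v' where v': "v' \<in> carrier_vec d" "v1 = E *\<^sub>v v'" by (auto simp: I_def)
  have cQ: "?c \<cdot>\<^sub>v (Q h *\<^sub>v v') = \<mu> \<cdot>\<^sub>v (E *\<^sub>v v')" using v1(3) h v' by (simp add: Q_E_vec)
  define W where "W = {v \<in> carrier_vec d. \<forall>k\<in>G0. Q h *\<^sub>v (E *\<^sub>v (r k *\<^sub>v v)) = \<mu> \<cdot>\<^sub>v (E *\<^sub>v (r k *\<^sub>v v))}"
  have W: "is_subspace d W"
    by (rule subspaceI) (use h in \<open>auto simp: W_def mat_zero_vec mult_add_distrib_mat_vec[of _ d d] smult_mat_vec[of _ d]
        smult_add_distrib_vec[of _ d] smult_smult_assoc mult.commute\<close>)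
  have stab: "r A *\<^sub>v v \<in> W" if A: "A \<in> G0" and v: "v \<in> W" for A v
    using v A by (auto simp: W_def r_mult_vec G0_mult)
  have v1W: "v1 \<in> W"
  proof -
    have "Q h *\<^sub>v (E *\<^sub>v (r k *\<^sub>v v1)) = \<mu> \<cdot>\<^sub>v (E *\<^sub>v (r k *\<^sub>v v1))" if k: "k \<in> G0" for k
    proof -
      have e: "E *\<^sub>v (r k *\<^sub>v v1) = Q k *\<^sub>v v'" using v' k by (simp add: Q_vec)
      \<comment> \<open>\<open>Q k\<close> commutes with \<open>Q h\<close>, so the eigenvalue
        equation spreads from v1 to all its translates.\<close>
      have "?c \<cdot>\<^sub>v (Q h *\<^sub>v (Q k *\<^sub>v v')) = Q k *\<^sub>v (?c \<cdot>\<^sub>v (Q h *\<^sub>v v'))"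
        using Q_commute_vec[OF h k v'(1)] h k v' by (simp add: smult_mat_vec[of _ d])
      also have "\<dots> = \<mu> \<cdot>\<^sub>v (?c \<cdot>\<^sub>v (Q k *\<^sub>v v'))"
        unfolding cQ using k v' by (simp add: smult_mat_vec[of _ d] Q_E_vec)
      also have "\<dots> = ?c \<cdot>\<^sub>v (\<mu> \<cdot>\<^sub>v (Q k *\<^sub>v v'))" by (simp add: smult_smult_assoc mult.commute)
      finally show ?thesis unfolding e using card_RU by (rule smult_vec_cancel)
    qed
    then show ?thesis using v' by (auto simp: W_def)
  qed
  have Wc: "W = carrier_vec d" by (rule irreducible_carrier[OF irr W _ v1W v1(2)]) (rule stab)
  have "Q h *\<^sub>v v = (\<mu> / ?c) \<cdot>\<^sub>v (E *\<^sub>v v)" if v: "v \<in> carrier_vec d" for v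
  proof -
    have "v \<in> W" using v Wc by simp
    then have "Q h *\<^sub>v (E *\<^sub>v (r (1\<^sub>m n) *\<^sub>v v)) = \<mu> \<cdot>\<^sub>v (E *\<^sub>v (r (1\<^sub>m n) *\<^sub>v v))"
      using G0_one unfolding W_def by blast
    then have "?c \<cdot>\<^sub>v (Q h *\<^sub>v v) = \<mu> \<cdot>\<^sub>v (E *\<^sub>v v)" using v h by (simp add: r_one Q_E_vec)
    also have "\<dots> = ?c \<cdot>\<^sub>v ((\<mu> / ?c) \<cdot>\<^sub>v (E *\<^sub>v v))" using card_RU by (simp add: smult_smult_assoc)
    finally show ?thesis using card_RU by (rule smult_vec_cancel)
  qed
  then show ?thesis by blast
qed

text \<open>Vectors whose translates are all sent by \<open>E\<close> into one line form a
  subrepresentation. For the line through v0 = E u it contains v0 itself, because E r(k) E u is a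
  scalar multiple of E u.\<close>

lemma E_rank_one:
  assumes irr: "irreducible_rep (Grp w g n l) d \<rho>"
  shows "\<exists>v0\<in>carrier_vec d. \<forall>v\<in>carrier_vec d. \<exists>t. E *\<^sub>v v = t \<cdot>\<^sub>v v0"
proof (cases "\<forall>v\<in>carrier_vec d. E *\<^sub>v v = 0\<^sub>v d")
  case True
  then show ?thesis by (intro bexI[of _ "0\<^sub>v d"]) (auto intro!: exI[of _ 0])
next
  case False
  then obtain u where u: "u \<in> carrier_vec d" "E *\<^sub>v u \<noteq> 0\<^sub>v d" by auto
  define v0 where "v0 = E *\<^sub>v u"
  have v0: "v0 \<in> carrier_vec d" using u by (simp add: v0_def)
  define W where "W = {v \<in> carrier_vec d. \<forall>k\<in>G0. \<exists>t. E *\<^sub>v (r k *\<^sub>v v) = t \<cdot>\<^sub>v v0}"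
  have W: "is_subspace d W"
  proof (rule subspaceI)
    show "W \<subseteq> carrier_vec d" by (auto simp: W_def)
    have "0 \<cdot>\<^sub>v v0 = 0\<^sub>v d" using v0 by auto
    then show "0\<^sub>v d \<in> W" by (auto simp: W_def mat_zero_vec intro!: exI[of _ 0])
  next
    fix x y assume xy: "x \<in> W" "y \<in> W"
    then have c: "x \<in> carrier_vec d" "y \<in> carrier_vec d" by (auto simp: W_def)
    have "\<exists>t. E *\<^sub>v (r k *\<^sub>v (x + y)) = t \<cdot>\<^sub>v v0" if k: "k \<in> G0" for k
    proof -
      obtain s t where "E *\<^sub>v (r k *\<^sub>v x) = s \<cdot>\<^sub>v v0" "E *\<^sub>v (r k *\<^sub>v y) = t \<cdot>\<^sub>v v0"
        using xy k unfolding W_def by blast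
      then have "E *\<^sub>v (r k *\<^sub>v (x + y)) = (s + t) \<cdot>\<^sub>v v0"
        using c k by (simp add: mult_add_distrib_mat_vec[of _ d d] add_smult_distrib_vec)
      then show ?thesis by blast
    qed
    then show "x + y \<in> W" using c by (auto simp: W_def)
  next
    fix c x assume x: "x \<in> W"
    then have xc: "x \<in> carrier_vec d" by (auto simp: W_def)
    have "\<exists>t. E *\<^sub>v (r k *\<^sub>v (c \<cdot>\<^sub>v x)) = t \<cdot>\<^sub>v v0" if k: "k \<in> G0" for k
    proof -
      obtain s where "E *\<^sub>v (r k *\<^sub>v x) = s \<cdot>\<^sub>v v0" using x k unfolding W_def by blast
      then have "E *\<^sub>v (r k *\<^sub>v (c \<cdot>\<^sub>v x)) = (c * s) \<cdot>\<^sub>v v0"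
        using xc k by (simp add: smult_mat_vec[of _ d] smult_smult_assoc)
      then show ?thesis by blast
    qed
    then show "c \<cdot>\<^sub>v x \<in> W" using xc by (auto simp: W_def)
  qed
  have stab: "r A *\<^sub>v v \<in> W" if A: "A \<in> G0" and v: "v \<in> W" for A v
    using v A by (auto simp: W_def r_mult_vec G0_mult)
  have v0W: "v0 \<in> W"
  proof -
    have "\<exists>t. E *\<^sub>v (r k *\<^sub>v v0) = t \<cdot>\<^sub>v v0" if k: "k \<in> G0" for k
      using Q_scalar[OF irr k] u k unfolding v0_def by (metis Q_vec)
    then show ?thesis using v0 by (auto simp: W_def)
  qed
  have v0_nz: "v0 \<noteq> 0\<^sub>v d" using u(2) by (simp add: v0_def)
  have Wc: "W = carrier_vec d" by (rule irreducible_carrier[OF irr W _ v0W v0_nz]) (rule stab)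
  have "\<exists>t. E *\<^sub>v v = t \<cdot>\<^sub>v v0" if v: "v \<in> carrier_vec d" for v
  proof -
    have "v \<in> W" using v Wc by simp
    then have "\<exists>t. E *\<^sub>v (r (1\<^sub>m n) *\<^sub>v v) = t \<cdot>\<^sub>v v0" using G0_one unfolding W_def by blast
    then show ?thesis unfolding r_one_vec[OF v] .
  qed
  then show ?thesis using v0 by blast
qed

section \<open>Whittaker functionals\<close>

abbreviation "whom T \<equiv> ind_hom (Grp w g n l) (Usub w n l) (theta n \<phi> a) d \<rho> T"

text \<open>Frobenius reciprocity: a homomorphism into the induced representation is recovered from
  its evaluation at the identity.\<close>

definition whf :: "(complex vec \<Rightarrow> 'a mat set \<Rightarrow> complex) \<Rightarrow> complex vec \<Rightarrow> complex" where
  "whf T v = T v (mcls w n l (1\<^sub>m n))"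

lemma whf_add: "whom T \<Longrightarrow> u \<in> carrier_vec d \<Longrightarrow> v \<in> carrier_vec d \<Longrightarrow> whf T (u + v) = whf T u + whf T v"
  by (simp add: ind_hom_def whf_def)

lemma whf_smult: "whom T \<Longrightarrow> v \<in> carrier_vec d \<Longrightarrow> whf T (c \<cdot>\<^sub>v v) = c * whf T v"
  by (simp add: ind_hom_def whf_def)

lemma whf_r:
  assumes T: "whom T" and v: "v \<in> carrier_vec d" and A: "A \<in> G0"
  shows "T v (mcls w n l A) = whf T (r A *\<^sub>v v)"
proof -
  have "T (\<rho> (mcls w n l A) *\<^sub>v v) (mcls w n l (1\<^sub>m n)) = T v (mcls w n l (1\<^sub>m n) \<otimes>\<^bsub>Grp w g n l\<^esub> mcls w n l A)"
    using T v mcls_G0[OF A] mcls_G0[OF G0_one] unfolding ind_hom_def by blast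
  also have "mcls w n l (1\<^sub>m n) \<otimes>\<^bsub>Grp w g n l\<^esub> mcls w n l A = mcls w n l A"
    using G0_carrier[OF A] by (simp add: Grp_mult)
  finally show ?thesis by (simp add: whf_def r_def)
qed

lemma whf_uni:
  assumes T: "whom T" and v: "v \<in> carrier_vec d" and u: "u \<in> uni n"
  shows "whf T (r u *\<^sub>v v) = th u * whf T v"
proof -
  have "T v (mcls w n l u \<otimes>\<^bsub>Grp w g n l\<^esub> mcls w n l (1\<^sub>m n)) = theta n \<phi> a (mcls w n l u) * T v (mcls w n l (1\<^sub>m n))"
    using T v u mcls_G0[OF G0_one] unfolding ind_hom_def Usub_eq by blast
  also have "mcls w n l u \<otimes>\<^bsub>Grp w g n l\<^esub> mcls w n l (1\<^sub>m n) = mcls w n l u"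
    using uni_carrier[OF u] by (simp add: Grp_mult)
  finally show ?thesis
    unfolding whf_r[OF T v uni_G0[OF u]] theta_mcls[OF uni_carrier[OF u]] by (simp add: whf_def th_def)
qed

text \<open>Each term of the average contributes the same value by equivariance; a Whittaker
  functional is therefore determined by its restriction to the image of \<open>E\<close>.\<close>

lemma whf_E:
  assumes T: "whom T" and v: "v \<in> carrier_vec d"
  shows "whf T (E *\<^sub>v v) = of_nat (card RU) * whf T v"
proof -
  have "whf T (E *\<^sub>v v) = (\<Sum>u\<in>RU. whf T ((inverse (th u) \<cdot>\<^sub>m r u) *\<^sub>v v))"
    unfolding E_def using RU_uni finite_RU v by (intro linear_msum whf_add[OF T] whf_smult[OF T]) auto
  also have "\<dots> = (\<Sum>u\<in>RU. whf T v)"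
  proof (rule sum.cong[OF refl])
    fix u assume "u \<in> RU"
    then have u: "u \<in> uni n" by (rule RU_uni)
    have "(inverse (th u) \<cdot>\<^sub>m r u) *\<^sub>v v = inverse (th u) \<cdot>\<^sub>v (r u *\<^sub>v v)" using u v by (intro smult_mat_vec) auto
    then show "whf T ((inverse (th u) \<cdot>\<^sub>m r u) *\<^sub>v v) = whf T v"
      using whf_smult[OF T r_vec_carrier[OF uni_G0[OF u] v]] whf_uni[OF T v u] by simp
  qed
  finally show ?thesis by simp
qed

lemma at_most_one:
  assumes irr: "irreducible_rep (Grp w g n l) d \<rho>"
  shows "at_most_one_whittaker (Grp w g n l) (Usub w n l) (theta n \<phi> a) d \<rho>"
  unfolding at_most_one_whittaker_def
proof (intro allI impI)
  fix T1 T2 assume "whom T1 \<and> whom T2"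
  then have T: "whom T1" "whom T2" by auto
  obtain v0 where v0: "v0 \<in> carrier_vec d" "\<And>v. v \<in> carrier_vec d \<Longrightarrow> \<exists>t. E *\<^sub>v v = t \<cdot>\<^sub>v v0"
    using E_rank_one[OF irr] by auto
  have key: "\<exists>t. whf T1 v = t * whf T1 v0 \<and> whf T2 v = t * whf T2 v0" if v: "v \<in> carrier_vec d" for v
  proof -
    obtain t where t: "E *\<^sub>v v = t \<cdot>\<^sub>v v0" using v0 v by blast
    have "whf U v = (t / of_nat (card RU)) * whf U v0" if U: "whom U" for U
      using whf_E[OF U v] whf_smult[OF U v0(1), of t] card_RU unfolding t by (simp add: field_simps)
    then show ?thesis using T by blast
  qed
  \<comment> \<open>The values at v0 determine both functionals, so the crossed values give a linear
    relation; when both values vanish the functionals are zero and any nonzero pair serves.\<close>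
  define c1 where "c1 = (if whf T1 v0 = 0 \<and> whf T2 v0 = 0 then 1 else whf T2 v0)"
  define c2 where "c2 = (if whf T1 v0 = 0 \<and> whf T2 v0 = 0 then 1 else - whf T1 v0)"
  have z: "c1 * whf T1 v + c2 * whf T2 v = 0" if v: "v \<in> carrier_vec d" for v
    using key[OF v] by (auto simp: c1_def c2_def)
  have "c1 * T1 v x + c2 * T2 v x = 0" for v x
  proof (cases "v \<in> carrier_vec d \<and> x \<in> carrier (Grp w g n l)")
    case True
    then obtain A where A: "A \<in> G0" "x = mcls w n l A" using G_cases by blast
    then show ?thesis using True z[OF r_vec_carrier[OF A(1)]] by (simp add: whf_r[OF T(1)] whf_r[OF T(2)])
  next
    case False
    then have "T1 v x = 0" "T2 v x = 0" using T unfolding ind_hom_def by (metis)+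
    then show ?thesis by simp
  qed
  moreover have "(c1, c2) \<noteq> (0, 0)" by (auto simp: c1_def c2_def)
  ultimately show "\<exists>c1 c2::complex. (c1, c2) \<noteq> (0, 0) \<and> (\<forall>v x. c1 * T1 v x + c2 * T2 v x = 0)" by blast
qed

text \<open>A nonzero functional cannot vanish on the image of \<open>E\<close>. Conversely, each
  row of \<open>E\<close> is a theta-equivariant functional, and a row with a nonzero entry gives a
  nonzero model.\<close>

lemma admits_whittaker_iff:
  "admits_whittaker (Grp w g n l) (Usub w n l) (theta n \<phi> a) d \<rho> \<longleftrightarrow> E \<noteq> 0\<^sub>m d d"
proof
  assume "admits_whittaker (Grp w g n l) (Usub w n l) (theta n \<phi> a) d \<rho>"
  then obtain T where T: "whom T" "T \<noteq> (\<lambda>v x. 0)" by (auto simp: admits_whittaker_def)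
  then obtain v x where vx: "T v x \<noteq> 0" by fastforce
  have v: "v \<in> carrier_vec d" and x: "x \<in> carrier (Grp w g n l)"
    using T vx unfolding ind_hom_def by metis+
  obtain A where A: "A \<in> G0" "x = mcls w n l A" using G_cases[OF x] .
  have "whf T (r A *\<^sub>v v) \<noteq> 0" using vx A v whf_r[OF T(1)] by simp
  then have nz: "whf T (E *\<^sub>v (r A *\<^sub>v v)) \<noteq> 0" using whf_E[OF T(1) r_vec_carrier[OF A(1) v]] card_RU by simp
  show "E \<noteq> 0\<^sub>m d d"
  proof
    assume "E = 0\<^sub>m d d"
    then have "E *\<^sub>v (r A *\<^sub>v v) = 0 \<cdot>\<^sub>v v" using A v r_vec_carrier[OF A(1) v] by auto
    then show False using nz whf_smult[OF T(1) v, of 0] by simp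
  qed
next
  assume "E \<noteq> 0\<^sub>m d d"
  then obtain i j where ij: "i < d" "j < d" "E $$ (i, j) \<noteq> 0"
    using E_carrier by (metis eq_matI carrier_matD index_zero_mat)
  define T :: "complex vec \<Rightarrow> 'a mat set \<Rightarrow> complex" where "T v x = (if v \<in> carrier_vec d \<and> x \<in> carrier (Grp w g n l) then (E *\<^sub>v (\<rho> x *\<^sub>v v)) $ i else 0)" for v x
  have Tr: "T v (mcls w n l A) = (E *\<^sub>v (r A *\<^sub>v v)) $ i" if "v \<in> carrier_vec d" "A \<in> G0" for v :: "complex vec" and A
    using that mcls_G0 by (auto simp: T_def r_def)
  have Tout: "T v x = 0" if "v \<notin> carrier_vec d \<or> x \<notin> carrier (Grp w g n l)" for v x
    using that by (auto simp: T_def)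
  have "whom T"
    unfolding ind_hom_def
  proof (intro conjI allI ballI impI)
    show "T v = (\<lambda>x. 0)" if "v \<notin> carrier_vec d" for v :: "complex vec" using that by (auto simp: T_def)
    show "T v x = 0" if "x \<notin> carrier (Grp w g n l)" for v x using that by (auto simp: T_def)
  next
    fix v u :: "complex vec" assume c: "v \<in> carrier_vec d" "u \<in> carrier_vec d"
    show "T (v + u) = (\<lambda>x. T v x + T u x)"
    proof
      fix x show "T (v + u) x = T v x + T u x"
      proof (cases "x \<in> carrier (Grp w g n l)")
        case True
        then obtain A where A: "A \<in> G0" "x = mcls w n l A" using G_cases by blast
        have "E *\<^sub>v (r A *\<^sub>v (v + u)) = E *\<^sub>v (r A *\<^sub>v v) + E *\<^sub>v (r A *\<^sub>v u)"
          using A c by (simp add: mult_add_distrib_mat_vec[of _ d d])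
        moreover have "dim_vec (E *\<^sub>v (r A *\<^sub>v u)) = d" using E_carrier by (metis carrier_matD(1) dim_mult_mat_vec)
        ultimately show ?thesis using A c ij by (simp add: Tr)
      qed (simp add: Tout)
    qed
  next
    fix c and v :: "complex vec" assume v: "v \<in> carrier_vec d"
    show "T (c \<cdot>\<^sub>v v) = (\<lambda>x. c * T v x)"
    proof
      fix x show "T (c \<cdot>\<^sub>v v) x = c * T v x"
      proof (cases "x \<in> carrier (Grp w g n l)")
        case True
        then obtain A where A: "A \<in> G0" "x = mcls w n l A" using G_cases by blast
        have "E *\<^sub>v (r A *\<^sub>v (c \<cdot>\<^sub>v v)) = c \<cdot>\<^sub>v (E *\<^sub>v (r A *\<^sub>v v))"
          using A v by (simp add: smult_mat_vec[of _ d])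
        moreover have "dim_vec (E *\<^sub>v (r A *\<^sub>v v)) = d" using E_carrier by (metis carrier_matD(1) dim_mult_mat_vec)
        ultimately show ?thesis using A v ij by (simp add: Tr)
      qed (simp add: Tout)
    qed
  next
    fix v :: "complex vec" and U x assume v: "v \<in> carrier_vec d" and "U \<in> Usub w n l" "x \<in> carrier (Grp w g n l)"
    then obtain u A where u: "u \<in> uni n" "U = mcls w n l u" and A: "A \<in> G0" "x = mcls w n l A"
      using G_cases unfolding Usub_eq by blast
    have "U \<otimes>\<^bsub>Grp w g n l\<^esub> x = mcls w n l (u * A)" using u A by (simp add: Grp_mult uni_carrier G0_carrier)
    then have "T v (U \<otimes>\<^bsub>Grp w g n l\<^esub> x) = (E *\<^sub>v (r (u * A) *\<^sub>v v)) $ i" using v u A by (simp add: Tr G0_mult uni_G0)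
    also have "E *\<^sub>v (r (u * A) *\<^sub>v v) = (E * r u) *\<^sub>v (r A *\<^sub>v v)"
      using u A v by (simp add: r_mult_vec[symmetric] uni_G0 assoc_mult_mat_vec[of _ d d _ d])
    also have "\<dots> = th u \<cdot>\<^sub>v (E *\<^sub>v (r A *\<^sub>v v))"
      unfolding E_right[OF u(1)] using A v by (simp add: smult_mat_vec[of _ d])
    also have "\<dots> $ i = th u * (E *\<^sub>v (r A *\<^sub>v v)) $ i"
    proof -
      have "dim_vec (E *\<^sub>v (r A *\<^sub>v v)) = d" using E_carrier by (metis carrier_matD(1) dim_mult_mat_vec)
      then show ?thesis using ij by simp
    qed
    finally show "T v (U \<otimes>\<^bsub>Grp w g n l\<^esub> x) = theta n \<phi> a U * T v x"
      using u A v by (simp add: Tr theta_mcls uni_carrier th_def)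
  next
    fix v :: "complex vec" and h x assume v: "v \<in> carrier_vec d" and "h \<in> carrier (Grp w g n l)" "x \<in> carrier (Grp w g n l)"
    then obtain B A where B: "B \<in> G0" "h = mcls w n l B" and A: "A \<in> G0" "x = mcls w n l A"
      using G_cases by metis
    have "x \<otimes>\<^bsub>Grp w g n l\<^esub> h = mcls w n l (A * B)" using B A by (simp add: Grp_mult G0_carrier)
    then show "T (\<rho> h *\<^sub>v v) x = T v (x \<otimes>\<^bsub>Grp w g n l\<^esub> h)"
      using v A B by (simp add: Tr G0_mult r_mult_vec r_def[symmetric])
  qed
  moreover have "T (unit_vec d j) (mcls w n l (1\<^sub>m n)) \<noteq> 0"
    using ij mat_mult_unit_vec[OF E_carrier ij(1,2)] by (simp add: Tr G0_one r_one_vec)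
  ultimately show "admits_whittaker (Grp w g n l) (Usub w n l) (theta n \<phi> a) d \<rho>"
    unfolding admits_whittaker_def by fastforce
qed

end

section \<open>Characters of congruence subgroups\<close>

context whittaker
begin

definition mm :: nat where "mm = l div 2"
definition ii :: nat where "ii = (l + 1) div 2"

lemma l_eq: "l = ii + mm" unfolding ii_def mm_def by presburger
lemma mm_pos: "0 < mm" using l2 unfolding mm_def by presburger
lemma ii_pos: "0 < ii" using l2 unfolding ii_def by presburger
lemma l_le_2ii: "l \<le> 2 * ii" unfolding ii_def by presburger
text \<open>For odd l this bound and the next need mm \<ge> 1, that is, l \<ge> 2. They place
  commutators of K^mm inside K^ii and third-order terms beyond \<open>w ^ l\<close>.\<close>

lemma ii_le: "ii \<le> 2 * mm" using l2 unfolding ii_def mm_def by presburger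
lemma l_le_3mm: "l \<le> 2 * mm + mm" using l2 unfolding mm_def by presburger
lemma mm_le: "2 * mm \<le> l" unfolding mm_def by presburger

lemma w_ii_dvd: "w ^ l dvd w ^ ii * x \<longleftrightarrow> w ^ mm dvd x"
proof -
  have "w ^ l = w ^ ii * w ^ mm" by (subst l_eq) (rule power_add)
  then show ?thesis using w_nz by simp
qed

definition ninv :: 'a where "ninv = (SOME k. of_nat n * k = 1)"

lemma ninv: "g = SL \<Longrightarrow> of_nat n * ninv = 1"
  unfolding ninv_def using n_unit by (rule someI_ex)

text \<open>For SL the congruence subgroup is parametrised by all of M_n through the projection onto
  trace zero matrices, so that GL and SL can be treated alike.\<close>

definition pr :: "'a mat \<Rightarrow> 'a mat" where
  "pr Z = (if g = SL then Z - (ninv * mtrace Z) \<cdot>\<^sub>m 1\<^sub>m n else Z)"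

lemma pr_carrier [simp]: "Z \<in> carrier_mat n n \<Longrightarrow> pr Z \<in> carrier_mat n n"
  by (auto simp: pr_def intro!: minus_carrier_mat)

lemma pr_add: "Y \<in> carrier_mat n n \<Longrightarrow> Z \<in> carrier_mat n n \<Longrightarrow> pr (Y + Z) = pr Y + pr Z"
  unfolding pr_def by (auto simp: mtrace_add[of _ n] algebra_simps intro!: eq_matI)

lemma mtrace_pr: "Z \<in> carrier_mat n n \<Longrightarrow> g = SL \<Longrightarrow> mtrace (pr Z) = 0"
proof -
  assume Z: "Z \<in> carrier_mat n n" and g: "g = SL"
  have "mtrace (pr Z) = mtrace Z - ninv * mtrace Z * of_nat n"
    unfolding pr_def using g Z by (simp add: mtrace_minus[of _ n] mtrace_smult[of _ n] mtrace_one)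
  also have "\<dots> = mtrace Z - (of_nat n * ninv) * mtrace Z" by (simp add: ac_simps)
  finally show ?thesis using ninv[OF g] by simp
qed

lemma pr_eq: "Z \<in> carrier_mat n n \<Longrightarrow> mtrace Z = 0 \<Longrightarrow> pr Z = Z"
  unfolding pr_def by (auto intro!: eq_matI)

lemma pr_mcong: "mcong n q Y Z \<Longrightarrow> mcong n q (pr Y) (pr Z)"
proof -
  assume c: "mcong n q Y Z"
  have "q dvd ninv * mtrace Y - ninv * mtrace Z"
    unfolding right_diff_distrib[symmetric] using mtrace_mcong[OF c] by simp
  then have "mcong n q ((ninv * mtrace Y) \<cdot>\<^sub>m 1\<^sub>m n) ((ninv * mtrace Z) \<cdot>\<^sub>m 1\<^sub>m n)"
    by (auto simp: mcong_def)
  then show ?thesis using c by (auto simp: pr_def intro: mcong_minus)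
qed

lemma pr_mcong_self:
  assumes "Z \<in> carrier_mat n n" "g = SL \<Longrightarrow> q dvd mtrace Z"
  shows "mcong n q (pr Z) Z"
  using assms by (auto simp: pr_def mcong_def)

text \<open>Conjugation preserves the trace and fixes scalar matrices.\<close>

lemma pr_conj:
  assumes "Z \<in> carrier_mat n n" "h \<in> carrier_mat n n" "h' \<in> carrier_mat n n" "h * h' = 1\<^sub>m n" "h' * h = 1\<^sub>m n"
  shows "pr (h * Z * h') = h * pr Z * h'"
proof -
  have "mtrace (h * Z * h') = mtrace (h' * (h * Z))" using assms by (intro mtrace_comm[of _ n]) auto
  also have "h' * (h * Z) = Z" using assms by (simp add: assoc_mult_mat[of _ n n _ n _ n, symmetric])
  finally have t: "mtrace (h * Z * h') = mtrace Z" .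
  have "h * (Z - c \<cdot>\<^sub>m 1\<^sub>m n) * h' = h * Z * h' - c \<cdot>\<^sub>m 1\<^sub>m n" for c
  proof -
    have "h * (Z - c \<cdot>\<^sub>m 1\<^sub>m n) = h * Z - c \<cdot>\<^sub>m h"
      using assms by (subst mult_minus_distrib_mat[of _ n n _ n]) (auto simp: mult_smult_distrib[of _ n n _ n])
    also have "\<dots> * h' = h * Z * h' - (c \<cdot>\<^sub>m h) * h'"
      using assms by (intro minus_mult_distrib_mat[of _ n n _ _ n]) auto
    also have "(c \<cdot>\<^sub>m h) * h' = c \<cdot>\<^sub>m 1\<^sub>m n"
      using assms by (subst mult_smult_assoc_mat[of _ n n _ n]) auto
    finally show ?thesis .
  qed
  then show ?thesis by (simp add: pr_def t)
qed

text \<open>The determinant is 1 modulo \<open>w\<close>, hence a unit; the extra condition on it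
  concerns SL alone.\<close>

lemma one_plus_G0:
  assumes Y: "Y \<in> carrier_mat n n" and k: "0 < k" and SL: "g = SL \<Longrightarrow> w ^ l dvd det (1\<^sub>m n + w ^ k \<cdot>\<^sub>m Y) - 1"
  shows "1\<^sub>m n + w ^ k \<cdot>\<^sub>m Y \<in> G0"
proof -
  let ?d = "det (1\<^sub>m n + w ^ k \<cdot>\<^sub>m Y)"
  have wk: "w dvd w ^ k" using k by (rule dvd_power[OF disjI1])
  have "(w ^ k)\<^sup>2 dvd ?d - (1 + w ^ k * mtrace Y)" by (rule det_one_plus[OF Y])
  then have "w dvd ?d - (1 + w ^ k * mtrace Y)" using wk by (metis dvd_trans dvd_power zero_less_numeral)
  then have "w dvd (?d - (1 + w ^ k * mtrace Y)) + w ^ k * mtrace Y" using wk by (intro dvd_add) auto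
  then have "w dvd ?d - 1" by simp
  then have "\<not> w dvd ?d" using w_nonunit by (metis diff_diff_eq2 add_diff_cancel_left' dvd_diff)
  then obtain y where "?d * y = 1" using unit_if_not_dvd by (metis dvdE)
  then have "unit_mod w l ?d" by (auto simp: unit_mod_def intro: exI[of _ y])
  then show ?thesis unfolding mem_G0 using Y SL by auto
qed

text \<open>Parametrises K^ii by all of M_n, additively modulo \<open>w ^ l\<close> because 2 ii
  \<ge> l. For SL scalar matrices are sent to 1.\<close>

definition emb :: "'a mat \<Rightarrow> 'a mat" where
  "emb Z = 1\<^sub>m n + w ^ ii \<cdot>\<^sub>m pr Z"

lemma emb_G0: "Z \<in> carrier_mat n n \<Longrightarrow> emb Z \<in> G0"
proof -
  assume Z: "Z \<in> carrier_mat n n"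
  have "w ^ l dvd det (1\<^sub>m n + w ^ ii \<cdot>\<^sub>m pr Z) - 1" if g: "g = SL"
  proof -
    have "(w ^ ii)\<^sup>2 dvd det (1\<^sub>m n + w ^ ii \<cdot>\<^sub>m pr Z) - 1"
      using det_one_plus[of "pr Z" n "w ^ ii"] Z mtrace_pr[OF Z g] by simp
    moreover have "w ^ l dvd (w ^ ii)\<^sup>2" unfolding power_mult[symmetric] using l_le_2ii by (intro le_imp_power_dvd) simp
    ultimately show ?thesis by (rule dvd_trans[rotated])
  qed
  then show ?thesis unfolding emb_def using Z ii_pos by (intro one_plus_G0) auto
qed

lemma emb_strict_upper: "F \<in> strict_upper n \<Longrightarrow> emb F = 1\<^sub>m n + w ^ ii \<cdot>\<^sub>m F"
  unfolding emb_def by (subst pr_eq) (auto simp: strict_upper_def mtrace_def)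

lemma emb_mcong: "mcong n (w ^ mm) Y Z \<Longrightarrow> mcong n (w ^ l) (emb Y) (emb Z)"
proof -
  assume "mcong n (w ^ mm) Y Z"
  then have "mcong n (w ^ ii * w ^ mm) (w ^ ii \<cdot>\<^sub>m pr Y) (w ^ ii \<cdot>\<^sub>m pr Z)" by (intro mcong_smult pr_mcong)
  then show ?thesis unfolding emb_def power_add[symmetric] l_eq[symmetric] by (intro mcong_add mcong_refl) auto
qed

lemma one_plus_mult_eq:
  fixes Y Z :: "'a mat"
  assumes Y: "Y \<in> carrier_mat n n" "Z \<in> carrier_mat n n"
  shows "(1\<^sub>m n + s \<cdot>\<^sub>m Y) * (1\<^sub>m n + t \<cdot>\<^sub>m Z) = 1\<^sub>m n + s \<cdot>\<^sub>m Y + (t \<cdot>\<^sub>m Z + (s * t) \<cdot>\<^sub>m (Y * Z))"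
proof -
  have "(1\<^sub>m n + s \<cdot>\<^sub>m Y) * (1\<^sub>m n + t \<cdot>\<^sub>m Z) = (1\<^sub>m n + s \<cdot>\<^sub>m Y) * 1\<^sub>m n + (1\<^sub>m n + s \<cdot>\<^sub>m Y) * (t \<cdot>\<^sub>m Z)"
    using Y by (intro mult_add_distrib_mat) auto
  also have "(1\<^sub>m n + s \<cdot>\<^sub>m Y) * (t \<cdot>\<^sub>m Z) = 1\<^sub>m n * (t \<cdot>\<^sub>m Z) + (s \<cdot>\<^sub>m Y) * (t \<cdot>\<^sub>m Z)"
    using Y by (intro add_mult_distrib_mat) auto
  also have "(s \<cdot>\<^sub>m Y) * (t \<cdot>\<^sub>m Z) = (s * t) \<cdot>\<^sub>m (Y * Z)"
    using Y by (simp add: mult_smult_assoc_mat[of _ n n _ n] mult_smult_distrib[of _ n n _ n]) (auto intro!: eq_matI)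
  finally show "(1\<^sub>m n + s \<cdot>\<^sub>m Y) * (1\<^sub>m n + t \<cdot>\<^sub>m Z) = 1\<^sub>m n + s \<cdot>\<^sub>m Y + (t \<cdot>\<^sub>m Z + (s * t) \<cdot>\<^sub>m (Y * Z))"
    using Y by simp
qed

lemma one_plus_mult:
  fixes Y Z :: "'a mat"
  assumes Y: "Y \<in> carrier_mat n n" "Z \<in> carrier_mat n n"
  shows "mcong n (s * t) ((1\<^sub>m n + s \<cdot>\<^sub>m Y) * (1\<^sub>m n + t \<cdot>\<^sub>m Z)) (1\<^sub>m n + s \<cdot>\<^sub>m Y + t \<cdot>\<^sub>m Z)"
proof -
  show ?thesis unfolding one_plus_mult_eq[OF Y]
  proof (rule mcongI)
    fix i j assume ij: "i < n" "j < n"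
    have YZ: "Y * Z \<in> carrier_mat n n" using Y by simp
    have "(1\<^sub>m n + s \<cdot>\<^sub>m Y + (t \<cdot>\<^sub>m Z + (s * t) \<cdot>\<^sub>m (Y * Z))) $$ (i, j) - (1\<^sub>m n + s \<cdot>\<^sub>m Y + t \<cdot>\<^sub>m Z) $$ (i, j)
        = (s * t) * (Y * Z) $$ (i, j)"
      using ij Y YZ by (simp del: index_mult_mat(1))
    then show "s * t dvd (1\<^sub>m n + s \<cdot>\<^sub>m Y + (t \<cdot>\<^sub>m Z + (s * t) \<cdot>\<^sub>m (Y * Z))) $$ (i, j) - (1\<^sub>m n + s \<cdot>\<^sub>m Y + t \<cdot>\<^sub>m Z) $$ (i, j)"
      by simp
  qed (use Y in auto)
qed

lemma emb_add:
  assumes Y: "Y \<in> carrier_mat n n" "Z \<in> carrier_mat n n"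
  shows "mcong n (w ^ l) (emb Y * emb Z) (emb (Y + Z))"
proof -
  have "w ^ l dvd w ^ ii * w ^ ii"
    unfolding power_add[symmetric] using l_le_2ii by (intro le_imp_power_dvd) simp
  then have "mcong n (w ^ l) (emb Y * emb Z) (1\<^sub>m n + w ^ ii \<cdot>\<^sub>m pr Y + w ^ ii \<cdot>\<^sub>m pr Z)"
    unfolding emb_def using Y by (intro mcong_dvd[OF one_plus_mult]) auto
  moreover have "1\<^sub>m n + w ^ ii \<cdot>\<^sub>m pr Y + w ^ ii \<cdot>\<^sub>m pr Z = emb (Y + Z)"
  proof -
    have c: "pr Y \<in> carrier_mat n n" "pr Z \<in> carrier_mat n n" using Y by auto
    show ?thesis unfolding emb_def pr_add[OF Y] using c by (intro eq_matI) (auto simp: algebra_simps)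
  qed
  ultimately show ?thesis by simp
qed

lemma emb_conj:
  assumes Z: "Z \<in> carrier_mat n n" and h: "h \<in> carrier_mat n n" "h' \<in> carrier_mat n n" "h * h' = 1\<^sub>m n" "h' * h = 1\<^sub>m n"
  shows "h * emb Z = emb (h * Z * h') * h"
proof -
  note as = assoc_mult_mat[of _ n n _ n _ n]
  have p: "pr Z \<in> carrier_mat n n" using Z by simp
  have "emb (h * Z * h') * h = 1\<^sub>m n * h + (w ^ ii \<cdot>\<^sub>m (h * pr Z * h')) * h"
    unfolding emb_def pr_conj[OF Z h] using p h by (intro add_mult_distrib_mat) auto
  also have "(w ^ ii \<cdot>\<^sub>m (h * pr Z * h')) * h = w ^ ii \<cdot>\<^sub>m (h * pr Z)"
    using p h by (simp add: mult_smult_assoc_mat[of _ n n _ n] as)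
  also have "1\<^sub>m n * h + w ^ ii \<cdot>\<^sub>m (h * pr Z) = h * 1\<^sub>m n + h * (w ^ ii \<cdot>\<^sub>m pr Z)"
    using p h by (simp add: mult_smult_distrib[of _ n n _ n])
  also have "\<dots> = h * emb Z" unfolding emb_def using p h by (intro mult_add_distrib_mat[symmetric]) auto
  finally show ?thesis by simp
qed

abbreviation "RM \<equiv> mreps n (w ^ mm) (carrier_mat n n :: 'a mat set)"

lemma finite_RM: "finite RM" by (rule finite_mreps) simp

lemma RM_carrier: "Y \<in> RM \<Longrightarrow> Y \<in> carrier_mat n n"
  using mreps_subset[of "carrier_mat n n :: 'a mat set" n "w ^ mm"] by blast

lemma card_RM: "of_nat (card RM) \<noteq> (0::complex)"
proof -
  have "mrep n (w ^ mm) (carrier_mat n n) (1\<^sub>m n) \<in> RM" by (simp add: mreps_def)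
  then show ?thesis using finite_RM by auto
qed

lemma phi_cong: "w ^ l dvd w ^ k * (x - y) \<Longrightarrow> \<phi> (w ^ k * x) = \<phi> (w ^ k * y)"
  by (intro phi_per) (simp add: right_diff_distrib)

lemma mtrace_mult_unit:
  assumes "M \<in> carrier_mat n n" "i < n" "j < n"
  shows "mtrace (M * mat n n (\<lambda>(r, s). if r = j \<and> s = i then c else 0)) = c * M $$ (i, j)"
proof -
  have "mtrace (M * mat n n (\<lambda>(r, s). if r = j \<and> s = i then c else 0))
     = (\<Sum>r<n. \<Sum>s<n. M $$ (r, s) * mat n n (\<lambda>(r, s). if r = j \<and> s = i then c else 0) $$ (s, r))"
    using assms by (intro mtrace_mult) auto
  also have "\<dots> = (\<Sum>r<n. \<Sum>s<n. if s = j then (if r = i then M $$ (r, j) * c else 0) else 0)"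
    by (intro sum.cong refl) auto
  also have "\<dots> = (\<Sum>r<n. if r = i then M $$ (r, j) * c else 0)" using assms by simp
  finally show ?thesis using assms by simp
qed

text \<open>Orthogonality for the trace form, a nonzero entry of \<open>M\<close> being detected by
  an elementary matrix. The condition on \<open>k\<close> says that the character factors through
  matrices modulo \<open>w ^ mm\<close>, so one set of representatives serves both k = ii and k = 2
  mm.\<close>

lemma character_sum:
  assumes M: "M \<in> carrier_mat n n" and k: "l \<le> k + mm"
  shows "(\<Sum>Y\<in>RM. \<phi> (w ^ k * mtrace (M * Y)))
    = (if \<forall>i<n. \<forall>j<n. w ^ l dvd w ^ k * M $$ (i, j) then of_nat (card RM) else 0)"
proof (cases "\<forall>i<n. \<forall>j<n. w ^ l dvd w ^ k * M $$ (i, j)")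
  case True
  have "\<phi> (w ^ k * mtrace (M * Y)) = 1" if "Y \<in> RM" for Y
  proof -
    have "w ^ k * mtrace (M * Y) = (\<Sum>i<n. \<Sum>j<n. (w ^ k * M $$ (i, j)) * Y $$ (j, i))"
      using M RM_carrier[OF that] by (simp add: mtrace_mult[of _ n] sum_distrib_left mult.assoc)
    also have "w ^ l dvd \<dots>" by (intro dvd_sum, rule dvd_mult2) (use True in auto)
    finally show ?thesis using phi_per[of _ 0] phi_0 by simp
  qed
  then show ?thesis using True by simp
next
  case False
  then obtain i j where ij: "i < n" "j < n" "\<not> w ^ l dvd w ^ k * M $$ (i, j)" by auto
  then obtain c where c: "\<phi> (c * (w ^ k * M $$ (i, j))) \<noteq> 1" using phi_nondegenerate by blast
  have "(\<Sum>Y\<in>RM. \<phi> (w ^ k * mtrace (M * Y))) = 0"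
  proof (rule sum_character_eq_0[OF finite_RM])
    fix Y Z :: "'a mat" assume YZ: "Y \<in> carrier_mat n n" "Z \<in> carrier_mat n n"
    have "mtrace (M * (Y + Z)) = mtrace (M * Y) + mtrace (M * Z)"
      using M YZ by (simp add: mult_add_distrib_mat[of _ n n _ n] mtrace_add[of _ n])
    then show "\<phi> (w ^ k * mtrace (M * (Y + Z))) = \<phi> (w ^ k * mtrace (M * Y)) * \<phi> (w ^ k * mtrace (M * Z))"
      by (simp add: distrib_left phi_add)
  next
    fix Y Z :: "'a mat" assume YZ: "mcong n (w ^ mm) Y Z"
    have "w ^ mm dvd mtrace (M * Y) - mtrace (M * Z)" by (rule mtrace_mcong[OF mcong_mult_left[OF M YZ]])
    then have "w ^ k * w ^ mm dvd w ^ k * (mtrace (M * Y) - mtrace (M * Z))" by (intro mult_dvd_mono dvd_refl)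
    moreover have "w ^ l dvd w ^ k * w ^ mm" unfolding power_add[symmetric] using k by (rule le_imp_power_dvd)
    ultimately show "\<phi> (w ^ k * mtrace (M * Y)) = \<phi> (w ^ k * mtrace (M * Z))"
      by (intro phi_cong) (rule dvd_trans)
  next
    show "mat n n (\<lambda>(r, s). if r = j \<and> s = i then c else 0) \<in> carrier_mat n n" by simp
    show "\<phi> (w ^ k * mtrace (M * mat n n (\<lambda>(r, s). if r = j \<and> s = i then c else 0))) \<noteq> 1"
      unfolding mtrace_mult_unit[OF M ij(1,2)] using c by (simp add: ac_simps)
  qed
  then show ?thesis unfolding if_not_P[OF False] .
qed

end

section \<open>Isotypic components under K^ii\<close>

context whittaker_rep
begin

definition sg :: "'a mat \<Rightarrow> complex mat" where
  "sg Z = r (emb Z)"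

definition psi :: "'a \<Rightarrow> complex" where
  "psi t = \<phi> (w ^ ii * t)"

text \<open>The zero vector is included; nonvanishing is stated separately. Since Z runs over all of
  M_n, a nonzero such vector forces, for SL, the trace of \<open>x\<close> to vanish modulo
  \<open>w ^ mm\<close>.\<close>

definition charvec :: "'a mat \<Rightarrow> complex vec \<Rightarrow> bool" where
  "charvec x v \<longleftrightarrow> v \<in> carrier_vec d \<and> (\<forall>Z\<in>carrier_mat n n. sg Z *\<^sub>v v = psi (mtrace (x * Z)) \<cdot>\<^sub>v v)"

lemma psi_add: "psi (s + t) = psi s * psi t"
  by (simp add: psi_def distrib_left phi_add)

lemma psi_cong: "w ^ mm dvd s - t \<Longrightarrow> psi s = psi t"
  unfolding psi_def by (intro phi_cong) (simp only: w_ii_dvd)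

lemma psi_uminus: "psi (- s) * psi s = 1"
  using phi_uminus[of "w ^ ii * s"] by (simp add: psi_def)

lemma psi_nondegenerate: "(\<And>c. psi (c * x) = 1) \<Longrightarrow> w ^ mm dvd x"
  using phi_nondegenerate[of "w ^ ii * x"] by (simp add: psi_def w_ii_dvd mult.left_commute)

lemma sg_carrier [simp]: "Z \<in> carrier_mat n n \<Longrightarrow> sg Z \<in> carrier_mat d d"
  unfolding sg_def by (intro r_carrier emb_G0)

lemma sg_cong: "mcong n (w ^ mm) Y Z \<Longrightarrow> sg Y = sg Z"
  unfolding sg_def by (intro r_cong emb_mcong)

lemma sg_add: "Y \<in> carrier_mat n n \<Longrightarrow> Z \<in> carrier_mat n n \<Longrightarrow> sg (Y + Z) = sg Y * sg Z"
  unfolding sg_def using r_cong[OF emb_add] by (simp add: r_mult emb_G0)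

lemma sg_zero: "sg (0\<^sub>m n n) = 1\<^sub>m d"
proof -
  have "emb (0\<^sub>m n n) = 1\<^sub>m n + w ^ ii \<cdot>\<^sub>m 0\<^sub>m n n"
    unfolding emb_def by (subst pr_eq) (auto simp: mtrace_def)
  also have "\<dots> = 1\<^sub>m n" by (intro eq_matI) auto
  finally show ?thesis by (simp add: sg_def r_one)
qed

lemma charvecD: "charvec x v \<Longrightarrow> Z \<in> carrier_mat n n \<Longrightarrow> sg Z *\<^sub>v v = psi (mtrace (x * Z)) \<cdot>\<^sub>v v"
  by (simp add: charvec_def)

lemma charvec_carrier: "charvec x v \<Longrightarrow> v \<in> carrier_vec d"
  by (simp add: charvec_def)

lemma charvec_cong: "mcong n (w ^ mm) x y \<Longrightarrow> charvec x v \<Longrightarrow> charvec y v"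
  unfolding charvec_def using psi_cong mtrace_mcong[OF mcong_mult_right] by metis

text \<open>Cyclicity of the trace moves conjugation of the group element to conjugation of
  \<open>x\<close>.\<close>

lemma charvec_conj:
  assumes x: "x \<in> carrier_mat n n" and v: "charvec x v" and h: "h \<in> G0" "h' \<in> G0" "h * h' = 1\<^sub>m n" "h' * h = 1\<^sub>m n"
  shows "charvec (h * x * h') (r h *\<^sub>v v)"
  unfolding charvec_def
proof (intro conjI ballI)
  note vc = charvec_carrier[OF v] and hc = G0_carrier[OF h(1)] G0_carrier[OF h(2)]
  note as = assoc_mult_mat[of _ n n _ n _ n]
  show "r h *\<^sub>v v \<in> carrier_vec d" using h vc by simp
  fix Z :: "'a mat" assume Z: "Z \<in> carrier_mat n n"
  let ?Z = "h' * Z * h"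
  have Zc: "?Z \<in> carrier_mat n n" using Z hc by simp
  have "h * ?Z * h' = (h * h') * Z * (h * h')" using Z hc by (simp add: as del: mult_one_sq) 
  then have "h * ?Z * h' = Z" using h Z by simp
  then have "h * emb ?Z = emb Z * h" using emb_conj[OF Zc hc h(3,4)] by simp
  then have "r h * sg ?Z = sg Z * r h" unfolding sg_def using h Z Zc by (simp add: r_mult[symmetric] emb_G0)
  then have "sg Z *\<^sub>v (r h *\<^sub>v v) = r h *\<^sub>v (sg ?Z *\<^sub>v v)"
    using h Z Zc vc by (simp add: assoc_mult_mat_vec[of _ d d _ d, symmetric])
  also have "\<dots> = psi (mtrace (x * ?Z)) \<cdot>\<^sub>v (r h *\<^sub>v v)"
    using charvecD[OF v Zc] h vc by (simp add: smult_mat_vec[of _ d])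
  also have "mtrace (x * ?Z) = mtrace (x * h' * Z * h)" using x Z hc by (simp add: as)
  also have "\<dots> = mtrace (h * (x * h' * Z))" using x Z hc by (intro mtrace_comm[of _ n]) auto
  also have "h * (x * h' * Z) = h * x * h' * Z" using x Z hc by (simp add: as)
  finally show "sg Z *\<^sub>v (r h *\<^sub>v v) = psi (mtrace (h * x * h' * Z)) \<cdot>\<^sub>v (r h *\<^sub>v v)" .
qed

text \<open>The Fourier projector onto the component of K^ii belonging to \<open>x\<close>, up to
  the factor \<open>card RM\<close>.\<close>

definition P :: "'a mat \<Rightarrow> complex mat" where
  "P x = msum d RM (\<lambda>Y. psi (- mtrace (x * Y)) \<cdot>\<^sub>m sg Y)"

lemma P_carrier [simp]: "P x \<in> carrier_mat d d" by (simp add: P_def)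

lemma P_vec_entry:
  assumes "v \<in> carrier_vec d" "j < d"
  shows "(P x *\<^sub>v v) $ j = (\<Sum>Y\<in>RM. psi (- mtrace (x * Y)) * (sg Y *\<^sub>v v) $ j)"
proof -
  have "(P x *\<^sub>v v) $ j = (\<Sum>Y\<in>RM. ((psi (- mtrace (x * Y)) \<cdot>\<^sub>m sg Y) *\<^sub>v v) $ j)"
    unfolding P_def using assms RM_carrier by (intro msum_mult_vec) auto
  also have "\<dots> = (\<Sum>Y\<in>RM. psi (- mtrace (x * Y)) * (sg Y *\<^sub>v v) $ j)"
  proof (rule sum.cong[OF refl])
    fix Y assume "Y \<in> RM"
    then have s: "sg Y \<in> carrier_mat d d" by (intro sg_carrier RM_carrier)
    then have "dim_vec (sg Y *\<^sub>v v) = d" by auto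
    then show "((psi (- mtrace (x * Y)) \<cdot>\<^sub>m sg Y) *\<^sub>v v) $ j = psi (- mtrace (x * Y)) * (sg Y *\<^sub>v v) $ j"
      using assms s by (simp add: smult_mat_vec[of _ d])
  qed
  finally show ?thesis .
qed

lemma P_charvec_eigen:
  assumes x: "x \<in> carrier_mat n n" "y \<in> carrier_mat n n" and v: "charvec y v"
  shows "P x *\<^sub>v v = (if mcong n (w ^ mm) y x then of_nat (card RM) else 0) \<cdot>\<^sub>v v"
proof (rule eq_vecI)
  note vc = charvec_carrier[OF v]
  fix j assume "j < dim_vec ((if mcong n (w ^ mm) y x then of_nat (card RM) else 0) \<cdot>\<^sub>v v)"
  then have j: "j < d" using vc by simp
  have "(P x *\<^sub>v v) $ j = (\<Sum>Y\<in>RM. psi (- mtrace (x * Y)) * (sg Y *\<^sub>v v) $ j)"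
    by (rule P_vec_entry[OF vc j])
  also have "\<dots> = (\<Sum>Y\<in>RM. \<phi> (w ^ ii * mtrace ((y - x) * Y)) * v $ j)"
  proof (rule sum.cong[OF refl])
    fix Y assume "Y \<in> RM"
    then have Y: "Y \<in> carrier_mat n n" by (rule RM_carrier)
    have e: "mtrace ((y - x) * Y) = - mtrace (x * Y) + mtrace (y * Y)"
      using x Y by (simp add: minus_mult_distrib_mat[of _ n n _ _ n] mtrace_minus[of _ n])
    have "\<phi> (w ^ ii * mtrace ((y - x) * Y)) = psi (- mtrace (x * Y)) * psi (mtrace (y * Y))"
      unfolding psi_add[symmetric] unfolding psi_def by (simp only: e)
    then show "psi (- mtrace (x * Y)) * (sg Y *\<^sub>v v) $ j = \<phi> (w ^ ii * mtrace ((y - x) * Y)) * v $ j"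
      using charvecD[OF v Y] j vc by simp
  qed
  also have "\<dots> = (\<Sum>Y\<in>RM. \<phi> (w ^ ii * mtrace ((y - x) * Y))) * v $ j" by (simp add: sum_distrib_right)
  also have "(\<Sum>Y\<in>RM. \<phi> (w ^ ii * mtrace ((y - x) * Y)))
      = (if \<forall>i<n. \<forall>j<n. w ^ l dvd w ^ ii * (y - x) $$ (i, j) then of_nat (card RM) else 0)"
    using x l_eq by (intro character_sum minus_carrier_mat) auto
  also have "(\<forall>i<n. \<forall>j<n. w ^ l dvd w ^ ii * (y - x) $$ (i, j)) \<longleftrightarrow> mcong n (w ^ mm) y x"
    unfolding w_ii_dvd mcong_def using x by auto
  finally show "(P x *\<^sub>v v) $ j = ((if mcong n (w ^ mm) y x then of_nat (card RM) else 0) \<cdot>\<^sub>v v) $ j"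
    using j vc by simp
qed (use charvec_carrier[OF v] carrier_matD[OF P_carrier] in auto)

lemma charvec_P:
  assumes X: "X \<in> carrier_mat n n" and v: "v \<in> carrier_vec d"
  shows "charvec X (P X *\<^sub>v v)"
  unfolding charvec_def
proof (intro conjI ballI)
  have Pv: "P X *\<^sub>v v \<in> carrier_vec d" using v by simp
  then show "P X *\<^sub>v v \<in> carrier_vec d" .
  fix Z :: "'a mat" assume Z: "Z \<in> carrier_mat n n"
  show "sg Z *\<^sub>v (P X *\<^sub>v v) = psi (mtrace (X * Z)) \<cdot>\<^sub>v (P X *\<^sub>v v)"
  proof (rule eq_vecI)
    fix j assume "j < dim_vec (psi (mtrace (X * Z)) \<cdot>\<^sub>v (P X *\<^sub>v v))"
    then have j: "j < d" using carrier_matD[OF P_carrier] by simp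
    have "(sg Z *\<^sub>v (P X *\<^sub>v v)) $ j = ((sg Z * P X) *\<^sub>v v) $ j"
      using Z v by (simp add: assoc_mult_mat_vec[of _ d d _ d])
    also have "sg Z * P X = msum d RM (\<lambda>Y. sg Z * (psi (- mtrace (X * Y)) \<cdot>\<^sub>m sg Y))"
      unfolding P_def using Z RM_carrier by (intro msum_left) auto
    also have "(\<dots> *\<^sub>v v) $ j = (\<Sum>Y\<in>RM. ((sg Z * (psi (- mtrace (X * Y)) \<cdot>\<^sub>m sg Y)) *\<^sub>v v) $ j)"
      using Z v j RM_carrier by (intro msum_mult_vec) auto
    also have "\<dots> = (\<Sum>Y\<in>RM. psi (mtrace (X * Z)) * (psi (- mtrace (X * (Y + Z))) * (sg (Y + Z) *\<^sub>v v) $ j))"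
    proof (rule sum.cong[OF refl])
      fix Y assume "Y \<in> RM"
      then have Y: "Y \<in> carrier_mat n n" by (rule RM_carrier)
      have "- mtrace (X * Y) = mtrace (X * Z) + - mtrace (X * (Y + Z))"
        using X Y Z by (simp add: mult_add_distrib_mat[of _ n n _ n] mtrace_add[of _ n])
      then have e: "psi (- mtrace (X * Y)) = psi (mtrace (X * Z)) * psi (- mtrace (X * (Y + Z)))"
        by (simp only: psi_add)
      have "Y + Z = Z + Y" using Y Z by (intro comm_add_mat)
      then have "sg (Y + Z) = sg Z * sg Y" using Y Z by (simp add: sg_add)
      moreover have "sg Z * (c \<cdot>\<^sub>m sg Y) = c \<cdot>\<^sub>m (sg Z * sg Y)" for c
        using Y Z by (intro mult_smult_distrib[of _ d d _ d]) auto
      moreover have "dim_vec ((sg Z * sg Y) *\<^sub>v v) = d" using Y Z by (metis carrier_matD(1) dim_mult_mat_vec mult_carrier_sq sg_carrier)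
      ultimately show "((sg Z * (psi (- mtrace (X * Y)) \<cdot>\<^sub>m sg Y)) *\<^sub>v v) $ j
          = psi (mtrace (X * Z)) * (psi (- mtrace (X * (Y + Z))) * (sg (Y + Z) *\<^sub>v v) $ j)"
        unfolding e using Y Z j v by (simp add: smult_mat_vec[of _ d])
    qed
    also have "\<dots> = psi (mtrace (X * Z)) * (\<Sum>Y\<in>RM. psi (- mtrace (X * (Y + Z))) * (sg (Y + Z) *\<^sub>v v) $ j)"
      by (simp add: sum_distrib_left)
    also have "(\<Sum>Y\<in>RM. psi (- mtrace (X * (Y + Z))) * (sg (Y + Z) *\<^sub>v v) $ j)
        = (\<Sum>Y\<in>RM. psi (- mtrace (X * Y)) * (sg Y *\<^sub>v v) $ j)"
    proof (rule sum_mreps_reindex[OF _ finite_RM, where F = "\<lambda>Y. psi (- mtrace (X * Y)) * (sg Y *\<^sub>v v) $ j"])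
      fix A A' :: "'a mat" assume A: "A \<in> carrier_mat n n" "A' \<in> carrier_mat n n"
      show "mcong n (w ^ mm) A A'" if "mcong n (w ^ mm) (A + Z) (A' + Z)"
        by (rule mcong_add_cancel[OF A Z that])
      show "psi (- mtrace (X * A)) * (sg A *\<^sub>v v) $ j = psi (- mtrace (X * A')) * (sg A' *\<^sub>v v) $ j"
        if c: "mcong n (w ^ mm) A A'"
      proof -
        have "w ^ mm dvd mtrace (X * A) - mtrace (X * A')" by (rule mtrace_mcong[OF mcong_mult_left[OF X c]])
        then have "w ^ mm dvd - mtrace (X * A) - - mtrace (X * A')"
          by (subst minus_diff_minus) (simp only: dvd_minus_iff)
        then show ?thesis using psi_cong sg_cong[OF c] by metis
      qed
    qed (use Z in auto)
    also have "\<dots> = (P X *\<^sub>v v) $ j" by (rule P_vec_entry[OF v j, symmetric])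
    finally show "(sg Z *\<^sub>v (P X *\<^sub>v v)) $ j = (psi (mtrace (X * Z)) \<cdot>\<^sub>v (P X *\<^sub>v v)) $ j"
      using j carrier_matD(1)[OF P_carrier, of X] by simp
  qed (use Z carrier_matD[OF P_carrier] carrier_matD[OF sg_carrier[OF Z]] in auto)
qed

text \<open>Fourier inversion: summed over all X, the operators P X give \<open>card RM\<close>
  times the identity, since only the class of Y = 0 survives the sum over X.\<close>

lemma exists_P_nonzero:
  assumes v: "v \<in> carrier_vec d" "v \<noteq> 0\<^sub>v d"
  obtains X where "X \<in> carrier_mat n n" "P X *\<^sub>v v \<noteq> 0\<^sub>v d"
proof (rule ccontr)
  assume "\<not> thesis"
  then have z: "\<And>X. X \<in> carrier_mat n n \<Longrightarrow> P X *\<^sub>v v = 0\<^sub>v d" using that by blast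
  \<comment> \<open>The representative chosen for the class of 0 need not be the zero
    matrix.\<close>
  let ?Y0 = "mrep n (w ^ mm) (carrier_mat n n) (0\<^sub>m n n)"
  have Y0: "?Y0 \<in> RM" "mcong n (w ^ mm) (0\<^sub>m n n) ?Y0"
    using mrep(2)[of "carrier_mat n n :: 'a mat set" n "0\<^sub>m n n"] by (auto simp: mreps_def)
  have sY0: "sg ?Y0 = 1\<^sub>m d" using sg_cong[OF Y0(2)] sg_zero by simp
  have "v $ j = 0" if j: "j < d" for j
  proof -
    have "0 = (\<Sum>X\<in>RM. (P X *\<^sub>v v) $ j)" using z RM_carrier j by simp
    also have "\<dots> = (\<Sum>X\<in>RM. \<Sum>Y\<in>RM. psi (- mtrace (X * Y)) * (sg Y *\<^sub>v v) $ j)"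
      by (simp add: P_vec_entry[OF v(1) j])
    also have "\<dots> = (\<Sum>Y\<in>RM. \<Sum>X\<in>RM. psi (- mtrace (X * Y)) * (sg Y *\<^sub>v v) $ j)" by (rule sum.swap)
    also have "\<dots> = (\<Sum>Y\<in>RM. if Y = ?Y0 then of_nat (card RM) * v $ j else 0)"
    proof (rule sum.cong[OF refl])
      fix Y assume YR: "Y \<in> RM"
      then have Y: "Y \<in> carrier_mat n n" by (rule RM_carrier)
      have nY: "- Y \<in> carrier_mat n n" using Y by simp
      have "(\<Sum>X\<in>RM. psi (- mtrace (X * Y)) * (sg Y *\<^sub>v v) $ j)
          = (\<Sum>X\<in>RM. psi (- mtrace (X * Y))) * (sg Y *\<^sub>v v) $ j" by (simp add: sum_distrib_right)
      also have "(\<Sum>X\<in>RM. psi (- mtrace (X * Y))) = (\<Sum>X\<in>RM. \<phi> (w ^ ii * mtrace ((- Y) * X)))"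
      proof (rule sum.cong[OF refl])
        fix X assume "X \<in> RM"
        then have X: "X \<in> carrier_mat n n" by (rule RM_carrier)
        have "mtrace ((- Y) * X) = - mtrace (Y * X)"
          using X Y by (simp add: mtrace_uminus[of _ n])
        then show "psi (- mtrace (X * Y)) = \<phi> (w ^ ii * mtrace ((- Y) * X))"
          using mtrace_comm[OF X Y] by (simp add: psi_def)
      qed
      also have "\<dots> = (if \<forall>i<n. \<forall>j<n. w ^ l dvd w ^ ii * (- Y) $$ (i, j) then of_nat (card RM) else 0)"
        using nY l_eq by (intro character_sum) auto
      also have "(\<forall>i<n. \<forall>j<n. w ^ l dvd w ^ ii * (- Y) $$ (i, j)) \<longleftrightarrow> mcong n (w ^ mm) (0\<^sub>m n n) Y"
        unfolding w_ii_dvd mcong_def using Y by auto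
      also have "mcong n (w ^ mm) (0\<^sub>m n n) Y \<longleftrightarrow> Y = ?Y0"
      proof
        assume "mcong n (w ^ mm) (0\<^sub>m n n) Y"
        then have "mcong n (w ^ mm) Y ?Y0" using Y0(2) by (metis mcong_sym mcong_trans)
        then show "Y = ?Y0" using mreps_inj[OF _ YR Y0(1)] by simp
      next
        assume "Y = ?Y0" then show "mcong n (w ^ mm) (0\<^sub>m n n) Y" using Y0(2) by simp
      qed
      finally show "(\<Sum>X\<in>RM. psi (- mtrace (X * Y)) * (sg Y *\<^sub>v v) $ j)
          = (if Y = ?Y0 then of_nat (card RM) * v $ j else 0)"
        using v by (cases "Y = ?Y0") (simp_all add: sY0)
    qed
    also have "\<dots> = of_nat (card RM) * v $ j" using finite_RM Y0 by simp
    finally show ?thesis using card_RM by simp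
  qed
  then have "v = 0\<^sub>v d" using v by (intro eq_vecI) auto
  then show False using v by simp
qed

end

section \<open>Existence of Whittaker models\<close>

lemma strict_upper_divide:
  fixes q :: "'a::idom"
  assumes F: "F \<in> strict_upper n" and q: "q \<noteq> 0" and dv: "\<And>i j. i < n \<Longrightarrow> j < n \<Longrightarrow> q dvd F $$ (i, j)"
  obtains F' where "F' \<in> strict_upper n" "F = q \<cdot>\<^sub>m F'"
proof -
  obtain f where f: "\<And>i j. i < n \<Longrightarrow> j < n \<Longrightarrow> F $$ (i, j) = q * f i j" using dv unfolding dvd_def by metis
  define F' where "F' = mat n n (\<lambda>(i, j). f i j)"
  have Fc: "F \<in> carrier_mat n n" using F by (simp add: strict_upper_def)
  have eq: "F = q \<cdot>\<^sub>m F'" using Fc f by (auto simp: F'_def intro!: eq_matI)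
  have "F' $$ (i, j) = 0" if "i < n" "j \<le> i" for i j
  proof -
    have "q * f i j = 0" using f[of i j] that F by (auto simp: strict_upper_def)
    then show ?thesis using q that by (simp add: F'_def)
  qed
  then have "F' \<in> strict_upper n" by (auto simp: strict_upper_def F'_def)
  then show ?thesis using that eq by blast
qed

lemma uni_cong_one:
  fixes q :: "'a::idom"
  assumes u: "u \<in> uni n" and q: "q \<noteq> 0" and c: "mcong n q u (1\<^sub>m n)"
  obtains F where "F \<in> strict_upper n" "u = 1\<^sub>m n + q \<cdot>\<^sub>m F"
proof -
  note uc = uni_carrier[OF u]
  have s: "u - 1\<^sub>m n \<in> strict_upper n"
    using u by (auto simp: strict_upper_def uni_def intro!: minus_carrier_mat)
  have "q dvd (u - 1\<^sub>m n) $$ (i, j)" if "i < n" "j < n" for i j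
    using mcongD(3)[OF c that] uc that by simp
  then obtain F where F: "F \<in> strict_upper n" "u - 1\<^sub>m n = q \<cdot>\<^sub>m F" using strict_upper_divide[OF s q] by blast
  have "u = 1\<^sub>m n + (u - 1\<^sub>m n)" using uc by (auto intro!: eq_matI)
  then show ?thesis using that F by simp
qed

lemma smult_vec_eq_iff:
  fixes v :: "complex vec"
  assumes v: "v \<in> carrier_vec d" "v \<noteq> 0\<^sub>v d" shows "s \<cdot>\<^sub>v v = t \<cdot>\<^sub>v v \<longleftrightarrow> s = t"
proof
  assume e: "s \<cdot>\<^sub>v v = t \<cdot>\<^sub>v v"
  obtain j where j: "j < d" "v $ j \<noteq> 0" using v by (metis carrier_vecD eq_vecI index_zero_vec)
  then show "s = t" using arg_cong[OF e, of "\<lambda>y. y $ j"] v by simp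
qed simp

context whittaker
begin

lemma strict_upper_carrier: "F \<in> strict_upper n \<Longrightarrow> F \<in> carrier_mat n n"
  by (simp add: strict_upper_def)

text \<open>For SL and odd l the determinant of 1 + w^mm pr Y is known to be 1 only modulo w^(2 mm),
  one power short of what is needed. Dividing the first row by the determinant repairs this and
  changes the matrix only modulo w^(2 mm), so Y' still agrees with pr Y modulo w^mm.\<close>

lemma one_plus_lift:
  assumes Y: "Y \<in> carrier_mat n n"
  obtains k Y' where "k \<in> G0" "Y' \<in> carrier_mat n n" "k = 1\<^sub>m n + w ^ mm \<cdot>\<^sub>m Y'" "mcong n (w ^ mm) Y' (pr Y)"
proof (cases "g = SL")
  case False
  then have "pr Y = Y" by (simp add: pr_def)
  moreover have "1\<^sub>m n + w ^ mm \<cdot>\<^sub>m Y \<in> G0" using Y mm_pos False by (intro one_plus_G0) auto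
  ultimately show ?thesis using that Y mcong_refl[OF Y] by simp
next
  case True
  define A where "A = 1\<^sub>m n + w ^ mm \<cdot>\<^sub>m pr Y"
  have A: "A \<in> carrier_mat n n" using Y by (simp add: A_def)
  have "(w ^ mm)\<^sup>2 dvd det A - 1"
    using det_one_plus[of "pr Y" n "w ^ mm"] Y mtrace_pr[OF Y True] by (simp add: A_def)
  then obtain t where t: "det A - 1 = (w ^ mm)\<^sup>2 * t" by auto
  have "w dvd (w ^ mm)\<^sup>2 * t" using mm_pos by (simp add: dvd_mult2 power2_eq_square dvd_power)
  then have "w dvd det A - 1" using t by simp
  then have "\<not> w dvd det A" using w_nonunit by (metis diff_diff_eq2 add_diff_cancel_left' dvd_diff)
  then obtain e where e: "det A * e = 1" using unit_if_not_dvd by (metis dvdE)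
  have "e = 1 - e * (det A - 1)" using e by (simp add: algebra_simps)
  then have e1: "e = 1 + (w ^ mm * w ^ mm) * (- (e * t))" unfolding t by (simp add: power2_eq_square ac_simps)
  \<comment> \<open>The change in the first row: e - 1 is divisible by w^(2 mm), and one of the two
    factors w^mm is absorbed into Y'.\<close>
  define N where "N = mat n n (\<lambda>(i, j). if i = 0 then - (e * t) * A $$ (0, j) else 0)"
  define Y' where "Y' = pr Y + w ^ mm \<cdot>\<^sub>m N"
  have N: "N \<in> carrier_mat n n" by (simp add: N_def)
  have Y': "Y' \<in> carrier_mat n n" using Y N by (simp add: Y'_def)
  have n0: "0 < n" using n2 by simp
  have "det (multrow 0 e A) = 1" using det_multrow[OF n0 A, of e] e by (simp add: mult.commute)
  then have G: "multrow 0 e A \<in> G0" unfolding mem_G0 using A True by simp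
  have "multrow 0 e A = 1\<^sub>m n + w ^ mm \<cdot>\<^sub>m Y'"
  proof (rule eq_matI)
    fix i j assume "i < dim_row (1\<^sub>m n + w ^ mm \<cdot>\<^sub>m Y')" "j < dim_col (1\<^sub>m n + w ^ mm \<cdot>\<^sub>m Y')"
    then have ij: "i < n" "j < n" using Y' by auto
    have a: "(1\<^sub>m n + w ^ mm \<cdot>\<^sub>m Y') $$ (i, j) = A $$ (i, j) + (w ^ mm * w ^ mm) * N $$ (i, j)"
    proof -
      have p: "pr Y \<in> carrier_mat n n" using Y by simp
      show ?thesis unfolding A_def Y'_def using ij N p by (simp add: algebra_simps)
    qed
    show "multrow 0 e A $$ (i, j) = (1\<^sub>m n + w ^ mm \<cdot>\<^sub>m Y') $$ (i, j)"
    proof (cases "i = 0")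
      case True
      have "multrow 0 e A $$ (i, j) = e * A $$ (0, j)" using A ij True by simp
      also have "\<dots> = (1 + (w ^ mm * w ^ mm) * (- (e * t))) * A $$ (0, j)" using e1 by simp
      also have "\<dots> = A $$ (0, j) + (w ^ mm * w ^ mm) * (- (e * t) * A $$ (0, j))" by (simp add: algebra_simps)
      finally show ?thesis unfolding a using True ij by (simp add: N_def)
    next
      case False then show ?thesis unfolding a using A ij by (simp add: N_def)
    qed
  qed (use A Y' in auto)
  moreover have "mcong n (w ^ mm) Y' (pr Y)"
    using Y N carrier_matD[OF pr_carrier[OF Y]] by (auto simp: mcong_def Y'_def)
  ultimately show ?thesis using that G Y' by metis
qed

text \<open>The cyclic vector is e_0; the Krylov matrix is invertible over o and so remains
  invertible over the residue field.\<close>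

lemma regular_hess:
  assumes x: "x \<in> hess" shows "regular_elt w n 1 x"
proof -
  note xc = hess_carrier[OF x]
  obtain K where K: "K \<in> carrier_mat n n" "krylov x * K = 1\<^sub>m n" "K * krylov x = 1\<^sub>m n" using krylov_inverse[OF x] .
  have n0: "0 < n" using n2 by simp
  let ?v = "unit_vec n 0 :: 'a vec"
  have kv: "((x ^\<^sub>m k) *\<^sub>v ?v) $ j = krylov x $$ (j, k)" if "j < n" "k < n" for j k
    using mat_mult_unit_vec[OF pow_carrier[OF xc] that(1) n0] that by (simp add: krylov_def)
  have mv: "(A *\<^sub>v vec n c) $ j = (\<Sum>k<n. A $$ (j, k) * c k)" if "A \<in> carrier_mat n n" "j < n" for A :: "'a mat" and c j
    using that by (auto simp: scalar_prod_def atLeast0LessThan)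
  show ?thesis unfolding regular_elt_def
  proof (rule bexI[of _ ?v], intro conjI ballI allI impI)
    fix u :: "'a vec" assume u: "u \<in> carrier_vec n"
    define c where "c k = (K *\<^sub>v u) $ k" for k
    have Ku: "vec n c = K *\<^sub>v u" using K by (intro eq_vecI) (auto simp: c_def)
    have "u $ j - (\<Sum>k<n. c k * ((x ^\<^sub>m k) *\<^sub>v ?v) $ j) = 0" if j: "j < n" for j
    proof -
      have "(\<Sum>k<n. c k * ((x ^\<^sub>m k) *\<^sub>v ?v) $ j) = (krylov x *\<^sub>v vec n c) $ j"
        unfolding mv[OF krylov_carrier j] using kv[OF j] by (intro sum.cong) (auto simp: mult.commute)
      also have "krylov x *\<^sub>v vec n c = (krylov x * K) *\<^sub>v u"
        unfolding Ku using K u by (intro assoc_mult_mat_vec[symmetric, of _ n n _ n]) auto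
      finally show ?thesis using K u by simp
    qed
    then show "\<exists>c. \<forall>j<n. w ^ 1 dvd u $ j - (\<Sum>k<n. c k * ((x ^\<^sub>m k) *\<^sub>v ?v) $ j)" by (metis dvd_0_right)
  next
    fix c k assume c: "\<forall>j<n. w ^ 1 dvd (\<Sum>k<n. c k * ((x ^\<^sub>m k) *\<^sub>v ?v) $ j)" and k: "k < n"
    have d: "w ^ 1 dvd (krylov x *\<^sub>v vec n c) $ j" if j: "j < n" for j
    proof -
      have "(\<Sum>k<n. c k * ((x ^\<^sub>m k) *\<^sub>v ?v) $ j) = (krylov x *\<^sub>v vec n c) $ j"
        unfolding mv[OF krylov_carrier j] using kv[OF j] by (intro sum.cong) (auto simp: mult.commute)
      then show ?thesis using c j by metis
    qed
    have "c k = (K *\<^sub>v (krylov x *\<^sub>v vec n c)) $ k"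
    proof -
      have "K *\<^sub>v (krylov x *\<^sub>v vec n c) = (K * krylov x) *\<^sub>v vec n c"
        using K by (intro assoc_mult_mat_vec[symmetric, of _ n n _ n]) auto
      then show ?thesis using K k by simp
    qed
    also have "\<dots> = (\<Sum>j<n. K $$ (k, j) * (krylov x *\<^sub>v vec n c) $ j)"
      using K k by (auto simp: scalar_prod_def atLeast0LessThan krylov_def)
    also have "w ^ 1 dvd \<dots>" using d by (intro dvd_sum dvd_mult) auto
    finally show "w ^ 1 dvd c k" .
  qed (use n0 in auto)
qed

text \<open>In the Krylov basis \<open>x\<close> becomes a companion matrix. Rescaling by D =
  diag(1, a, ..., a), the diagonal of the Krylov matrix, makes the base change unitriangular and
  produces the subdiagonal (a, 1, ..., 1).\<close>

lemma exists_companion: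
  assumes x: "x \<in> hess"
  obtains C v v' where "C \<in> hess" "v \<in> uni n" "v' \<in> uni n" "v * v' = 1\<^sub>m n" "v' * v = 1\<^sub>m n" "C = v * x * v'"
    "\<forall>i<n. \<forall>j<n. j \<noteq> n - 1 \<longrightarrow> C $$ (i, j) = x0 $$ (i, j)"
proof -
  note as = assoc_mult_mat[of _ n n _ n _ n]
  note xc = hess_carrier[OF x]
  obtain K where K: "K \<in> carrier_mat n n" "K * krylov x = 1\<^sub>m n" using krylov_inverse[OF x] by metis
  define D where "D = mat n n (\<lambda>(i, j). if i = j then if i = 0 then 1 else a else 0)"
  have D: "D \<in> carrier_mat n n" by (simp add: D_def)
  define v where "v = D * K"
  have vc: "v \<in> carrier_mat n n" using K D by (simp add: v_def)
  have vK: "v * krylov x = D" unfolding v_def using K D by (simp add: as)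
  have vu: "v \<in> uni n"
    by (rule upper_quotient_uni[OF krylov_carrier D vc _ _ _ _ vK])
      (auto simp: krylov_def hess_pow[OF x] a_nz D_def)
  obtain v' where v': "v' \<in> uni n" "v * v' = 1\<^sub>m n" "v' * v = 1\<^sub>m n" using uni_inverse[OF vu] .
  note v'c = uni_carrier[OF v'(1)]
  define C where "C = v * x * v'"
  have Cc: "C \<in> carrier_mat n n" using vc xc v'c by (simp add: C_def)
  \<comment> \<open>As \<open>x\<close> shifts the Krylov basis, column j of C D is column j + 1 of
    D for j < n - 1; the last column stays arbitrary.\<close>
  have CD: "C * D = v * (x * krylov x)"
  proof -
    have "C * D = v * x * (v' * v) * krylov x" unfolding C_def vK[symmetric] using vc xc v'c by (simp add: as)
    then show ?thesis using v' vc xc by (simp add: as)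
  qed
  have ent: "C $$ (i, j) = x0 $$ (i, j)" if ij: "i < n" "j < n" "j \<noteq> n - 1" for i j
  proof -
    have j1: "Suc j < n" using ij by simp
    have n0: "0 < n" using ij by simp
    have "(C * D) $$ (i, j) = (\<Sum>t<n. C $$ (i, t) * D $$ (t, j))" using Cc D ij by (intro mat_mult_entry)
    also have "\<dots> = (\<Sum>t<n. if t = j then C $$ (i, j) * (if j = 0 then 1 else a) else 0)"
      using ij by (intro sum.cong) (auto simp: D_def)
    also have "\<dots> = C $$ (i, j) * (if j = 0 then 1 else a)" using ij by simp
    finally have 1: "(C * D) $$ (i, j) = C $$ (i, j) * (if j = 0 then 1 else a)" .
    have "(x * krylov x) $$ (t, j) = krylov x $$ (t, Suc j)" if t: "t < n" for t
      using krylov_mult_entry[OF xc xc t ij(2)] pow_mat_comm[OF xc, of j] t j1 by (simp add: krylov_def)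
    then have "(v * (x * krylov x)) $$ (i, j) = (v * krylov x) $$ (i, Suc j)"
      using vc xc ij j1 by (subst (1 2) mat_mult_entry[of _ n n _ n]) auto
    then have "C $$ (i, j) * (if j = 0 then 1 else a) = D $$ (i, Suc j)" using 1 unfolding CD vK by simp
    then show ?thesis using ij j1 a_nz by (auto simp: D_def x0_def split: if_splits)
  qed
  have "C \<in> hess" using Cc ent by (auto simp: hess_def)
  then show ?thesis using that vu v' C_def ent by blast
qed

end

context whittaker_rep
begin

text \<open>For SL the trace of Y vanishes only modulo \<open>w ^ mm\<close>, by the first-order
  expansion of the determinant, so this element need not be literally \<open>emb Y\<close>; modulo
  \<open>w ^ l\<close> the two agree.\<close>

lemma charvec_one_plus:
  assumes v: "charvec x v" and Y: "Y \<in> carrier_mat n n" and G: "1\<^sub>m n + w ^ ii \<cdot>\<^sub>m Y \<in> G0"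
  shows "r (1\<^sub>m n + w ^ ii \<cdot>\<^sub>m Y) *\<^sub>v v = \<phi> (w ^ ii * mtrace (x * Y)) \<cdot>\<^sub>v v"
proof -
  have "w ^ mm dvd mtrace Y" if g: "g = SL"
  proof -
    have "w ^ l dvd det (1\<^sub>m n + w ^ ii \<cdot>\<^sub>m Y) - 1" using G g unfolding mem_G0 by simp
    moreover have "w ^ l dvd (w ^ ii)\<^sup>2" unfolding power_mult[symmetric] using l_le_2ii by (intro le_imp_power_dvd) simp
    then have "w ^ l dvd det (1\<^sub>m n + w ^ ii \<cdot>\<^sub>m Y) - (1 + w ^ ii * mtrace Y)"
      using det_one_plus[OF Y] by (rule dvd_trans)
    ultimately have "w ^ l dvd (det (1\<^sub>m n + w ^ ii \<cdot>\<^sub>m Y) - 1) - (det (1\<^sub>m n + w ^ ii \<cdot>\<^sub>m Y) - (1 + w ^ ii * mtrace Y))"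
      by (rule dvd_diff)
    then show ?thesis by (simp add: w_ii_dvd)
  qed
  then have "mcong n (w ^ mm) (pr Y) Y" using Y by (intro pr_mcong_self)
  then have "mcong n (w ^ ii * w ^ mm) (w ^ ii \<cdot>\<^sub>m pr Y) (w ^ ii \<cdot>\<^sub>m Y)" by (rule mcong_smult)
  then have "mcong n (w ^ l) (emb Y) (1\<^sub>m n + w ^ ii \<cdot>\<^sub>m Y)"
    unfolding emb_def power_add[symmetric] l_eq[symmetric] by (intro mcong_add mcong_refl) auto
  then have "r (1\<^sub>m n + w ^ ii \<cdot>\<^sub>m Y) = sg Y" unfolding sg_def by (rule r_cong[symmetric])
  then show ?thesis using charvecD[OF v Y] by (simp add: psi_def)
qed

text \<open>Absorbing w^(k - ii) into Y reduces the deeper subgroup K^k to level ii. The cases of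
  interest are k = ii and k = l - 1, where regularity is tested.\<close>

lemma contains_char_if_charvec:
  assumes x: "x \<in> carrier_mat n n" and v: "charvec x v" "v \<noteq> 0\<^sub>v d" and k: "ii \<le> k"
  shows "contains_char w g n l \<phi> d \<rho> k x"
  unfolding contains_char_def
proof (rule bexI[of _ v], intro conjI ballI impI)
  fix Y :: "'a mat" assume Y: "Y \<in> carrier_mat n n" and G: "Glift w g n l (1\<^sub>m n + w ^ k \<cdot>\<^sub>m Y)"
  let ?Y = "w ^ (k - ii) \<cdot>\<^sub>m Y"
  have wk: "w ^ k = w ^ ii * w ^ (k - ii)" using k by (simp add: power_add[symmetric])
  have e: "w ^ ii \<cdot>\<^sub>m ?Y = w ^ k \<cdot>\<^sub>m Y" unfolding wk by (auto simp: mult.assoc intro!: eq_matI)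
  have Yc: "?Y \<in> carrier_mat n n" using Y by simp
  have "1\<^sub>m n + w ^ ii \<cdot>\<^sub>m ?Y \<in> G0" unfolding e using G by (simp add: G0_def)
  from charvec_one_plus[OF v(1) Yc this]
  have "r (1\<^sub>m n + w ^ k \<cdot>\<^sub>m Y) *\<^sub>v v = \<phi> (w ^ ii * mtrace (x * ?Y)) \<cdot>\<^sub>v v" unfolding e .
  also have "mtrace (x * ?Y) = w ^ (k - ii) * mtrace (x * Y)"
    using x Y by (rule mtrace_mult_smult)
  also have "w ^ ii * (w ^ (k - ii) * mtrace (x * Y)) = w ^ k * mtrace (x * Y)" unfolding wk by (simp add: mult.assoc)
  finally show "\<rho> (mcls w n l (1\<^sub>m n + w ^ k \<cdot>\<^sub>m Y)) *\<^sub>v v = \<phi> (w ^ k * mtrace (x * Y)) \<cdot>\<^sub>v v"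
    by (simp add: r_def)
qed (use v charvec_carrier in auto)

text \<open>For SL the condition on the trace of \<open>x\<close> makes the scalar part removed by
  \<open>pr\<close> invisible to the character.\<close>

lemma charvec_if_contains_char:
  assumes x: "x \<in> carrier_mat n n" "g = SL \<Longrightarrow> w ^ mm dvd mtrace x"
    and c: "contains_char w g n l \<phi> d \<rho> ii x"
  obtains v where "charvec x v" "v \<noteq> 0\<^sub>v d"
proof -
  obtain v where v: "v \<in> carrier_vec d" "v \<noteq> 0\<^sub>v d" and vY: "\<And>Y. Y \<in> carrier_mat n n \<Longrightarrow>
      Glift w g n l (1\<^sub>m n + w ^ ii \<cdot>\<^sub>m Y) \<Longrightarrow>
      \<rho> (mcls w n l (1\<^sub>m n + w ^ ii \<cdot>\<^sub>m Y)) *\<^sub>v v = \<phi> (w ^ ii * mtrace (x * Y)) \<cdot>\<^sub>v v"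
    using c unfolding contains_char_def by blast
  have "sg Z *\<^sub>v v = psi (mtrace (x * Z)) \<cdot>\<^sub>v v" if Z: "Z \<in> carrier_mat n n" for Z
  proof -
    have "Glift w g n l (1\<^sub>m n + w ^ ii \<cdot>\<^sub>m pr Z)" using emb_G0[OF Z] by (simp add: G0_def emb_def)
    then have "sg Z *\<^sub>v v = psi (mtrace (x * pr Z)) \<cdot>\<^sub>v v"
      using vY[OF pr_carrier[OF Z]] by (simp add: sg_def r_def emb_def psi_def)
    moreover have "psi (mtrace (x * pr Z)) = psi (mtrace (x * Z))"
    proof (cases "g = SL")
      case True
      have "x * pr Z = x * Z - x * ((ninv * mtrace Z) \<cdot>\<^sub>m 1\<^sub>m n)"
        unfolding pr_def using True x Z by (simp add: mult_minus_distrib_mat[of _ n n _ n])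
      also have "x * ((ninv * mtrace Z) \<cdot>\<^sub>m 1\<^sub>m n) = (ninv * mtrace Z) \<cdot>\<^sub>m x"
        using x by (subst mult_smult_distrib[of _ n n _ n]) auto
      finally have "mtrace (x * pr Z) = mtrace (x * Z) - ninv * mtrace Z * mtrace x"
        using x Z by (simp add: mtrace_minus[of _ n] mtrace_smult[of _ n])
      then have "w ^ mm dvd mtrace (x * pr Z) - mtrace (x * Z)" using x(2)[OF True] by simp
      then show ?thesis by (rule psi_cong)
    qed (simp add: pr_def)
    ultimately show ?thesis by simp
  qed
  then show ?thesis using that v by (auto simp: charvec_def)
qed

lemma sg_P_commute:
  assumes X: "X \<in> carrier_mat n n" and Z: "Z \<in> carrier_mat n n"
  shows "sg Z * P X = P X * sg Z"
proof -
  have "sg Z * P X = msum d RM (\<lambda>Y. sg Z * (psi (- mtrace (X * Y)) \<cdot>\<^sub>m sg Y))"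
    unfolding P_def using Z RM_carrier by (intro msum_left) auto
  also have "\<dots> = msum d RM (\<lambda>Y. (psi (- mtrace (X * Y)) \<cdot>\<^sub>m sg Y) * sg Z)"
  proof (rule msum_cong[OF refl])
    fix Y assume "Y \<in> RM"
    then have Y: "Y \<in> carrier_mat n n" by (rule RM_carrier)
    have "Y + Z = Z + Y" using Y Z by (intro comm_add_mat)
    then have "sg Z * sg Y = sg Y * sg Z" using Y Z by (simp add: sg_add[symmetric])
    then show "sg Z * (psi (- mtrace (X * Y)) \<cdot>\<^sub>m sg Y) = (psi (- mtrace (X * Y)) \<cdot>\<^sub>m sg Y) * sg Z"
      using Y Z by (simp add: mult_smult_distrib[of _ d d _ d] mult_smult_assoc_mat[of _ d d _ d])
  qed
  also have "\<dots> = P X * sg Z"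
    unfolding P_def using Z RM_carrier by (intro msum_right[symmetric]) auto
  finally show ?thesis .
qed

lemma sg_strict_upper_th:
  assumes F: "F \<in> strict_upper n"
  shows "sg F = r (1\<^sub>m n + w ^ ii \<cdot>\<^sub>m F)" "th (1\<^sub>m n + w ^ ii \<cdot>\<^sub>m F) = psi (mtrace (x0 * F))"
proof -
  show "sg F = r (1\<^sub>m n + w ^ ii \<cdot>\<^sub>m F)" by (simp add: sg_def emb_strict_upper[OF F])
  have Fc: "F \<in> carrier_mat n n" by (rule strict_upper_carrier[OF F])
  have "th (1\<^sub>m n + w ^ ii \<cdot>\<^sub>m F) = \<phi> (mtrace (x0 * (w ^ ii \<cdot>\<^sub>m F)))"
    by (rule th_one_plus[OF strict_upper_smult[OF F]])
  also have "mtrace (x0 * (w ^ ii \<cdot>\<^sub>m F)) = w ^ ii * mtrace (x0 * F)"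
    by (rule mtrace_mult_smult[OF x0_carrier Fc])
  finally show "th (1\<^sub>m n + w ^ ii \<cdot>\<^sub>m F) = psi (mtrace (x0 * F))" by (simp add: psi_def)
qed

text \<open>The projection to a character X of K^ii commutes with K^ii, so the projected vector
  still transforms by theta under the unitriangular part of K^ii. This pins X to \<open>x0\<close>
  below the diagonal modulo \<open>w ^ mm\<close>.\<close>

lemma hess_if_E_nonzero:
  assumes E: "E \<noteq> 0\<^sub>m d d"
  obtains x v where "x \<in> hess" "charvec x v" "v \<noteq> 0\<^sub>v d" "g = SL \<longrightarrow> w ^ mm dvd mtrace x"
proof -
  obtain j where j: "j < d" "E *\<^sub>v unit_vec d j \<noteq> 0\<^sub>v d"
  proof -
    obtain i j where ij: "i < d" "j < d" "E $$ (i, j) \<noteq> 0"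
      using E E_carrier by (metis eq_matI carrier_matD index_zero_mat)
    then have "E *\<^sub>v unit_vec d j \<noteq> 0\<^sub>v d" using mat_mult_unit_vec[OF E_carrier ij(1,2)] by auto
    then show ?thesis using that ij by blast
  qed
  define v0 where "v0 = E *\<^sub>v unit_vec d j"
  have v0: "v0 \<in> carrier_vec d" "v0 \<noteq> 0\<^sub>v d" using j by (auto simp: v0_def)
  have v0_th: "r u *\<^sub>v v0 = th u \<cdot>\<^sub>v v0" if u: "u \<in> uni n" for u
  proof -
    have "r u *\<^sub>v v0 = (r u * E) *\<^sub>v unit_vec d j"
      unfolding v0_def using u by (simp add: assoc_mult_mat_vec[of _ d d _ d])
    then show ?thesis unfolding E_left[OF u] v0_def by (simp add: smult_mat_vec[of _ d])
  qed
  obtain X where X: "X \<in> carrier_mat n n" "P X *\<^sub>v v0 \<noteq> 0\<^sub>v d" using exists_P_nonzero[OF v0] .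
  define y where "y = P X *\<^sub>v v0"
  have y: "charvec X y" "y \<noteq> 0\<^sub>v d" "y \<in> carrier_vec d"
    using charvec_P[OF X(1) v0(1)] X(2) v0 by (auto simp: y_def)
  \<comment> \<open>For SL scalar matrices parametrise the identity, so the character attached to X
    must be trivial on them.\<close>
  have trX: "w ^ mm dvd mtrace X" if g: "g = SL"
  proof (rule psi_nondegenerate)
    fix c
    let ?Z = "c \<cdot>\<^sub>m 1\<^sub>m n :: 'a mat"
    have "ninv * mtrace ?Z = c"
      using ninv[OF g] by (simp add: mtrace_smult[of _ n] mtrace_one mult.left_commute mult.commute[of ninv])
    then have "pr ?Z = 0\<^sub>m n n" unfolding pr_def using g by (auto intro!: eq_matI)
    also have "0\<^sub>m n n = pr (0\<^sub>m n n)" by (rule pr_eq[symmetric]) (auto simp: mtrace_def)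
    finally have "sg ?Z = 1\<^sub>m d" using sg_zero unfolding sg_def emb_def by simp
    then have "1 \<cdot>\<^sub>v y = psi (mtrace (X * ?Z)) \<cdot>\<^sub>v y" using charvecD[OF y(1), of ?Z] y(3) by simp
    moreover have "mtrace (X * ?Z) = c * mtrace X"
      using mtrace_mult_smult[OF X(1) one_carrier_mat] X by simp
    ultimately show "psi (c * mtrace X) = 1" using smult_vec_eq_iff[OF y(3,2)] by metis
  qed
  have low: "w ^ mm dvd X $$ (i, j) - x0 $$ (i, j)" if ij: "i < n" "j < i" for i j
  proof (rule psi_nondegenerate)
    fix c
    \<comment> \<open>An elementary matrix above the diagonal: its trace against X isolates the
      entry (i, j) below the diagonal.\<close>
    let ?F = "mat n n (\<lambda>(r, s). if r = j \<and> s = i then c else 0) :: 'a mat"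
    have F: "?F \<in> strict_upper n" using ij by (auto simp: strict_upper_def)
    have Fc: "?F \<in> carrier_mat n n" by simp
    have u: "1\<^sub>m n + w ^ ii \<cdot>\<^sub>m ?F \<in> uni n" by (intro uni_one_plus strict_upper_smult F)
    have "sg ?F *\<^sub>v y = P X *\<^sub>v (sg ?F *\<^sub>v v0)"
      unfolding y_def using v0 sg_P_commute[OF X(1) Fc] by (simp add: assoc_mult_mat_vec[of _ d d _ d, symmetric])
    also have "sg ?F *\<^sub>v v0 = psi (mtrace (x0 * ?F)) \<cdot>\<^sub>v v0"
      using v0_th[OF u] sg_strict_upper_th[OF F] by simp
    also have "P X *\<^sub>v \<dots> = psi (mtrace (x0 * ?F)) \<cdot>\<^sub>v y"
      unfolding y_def using v0 by (simp add: smult_mat_vec[of _ d])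
    finally have "psi (mtrace (X * ?F)) \<cdot>\<^sub>v y = psi (mtrace (x0 * ?F)) \<cdot>\<^sub>v y" using charvecD[OF y(1) Fc] by simp
    then have "psi (mtrace (X * ?F)) = psi (mtrace (x0 * ?F))" using smult_vec_eq_iff[OF y(3,2)] by blast
    then have e: "psi (c * X $$ (i, j)) = psi (c * x0 $$ (i, j))"
      using mtrace_mult_unit[OF X(1), of i j c] mtrace_mult_unit[OF x0_carrier, of i j c] ij by simp
    have "c * (X $$ (i, j) - x0 $$ (i, j)) = - (c * x0 $$ (i, j)) + c * X $$ (i, j)" by (simp add: algebra_simps)
    then have "psi (c * (X $$ (i, j) - x0 $$ (i, j))) = psi (- (c * x0 $$ (i, j))) * psi (c * X $$ (i, j))"
      by (simp only: psi_add)
    then show "psi (c * (X $$ (i, j) - x0 $$ (i, j))) = 1" unfolding e by (simp only: psi_uminus)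
  qed
  \<comment> \<open>X is Hessenberg only modulo \<open>w ^ mm\<close>; its lower entries are
    replaced by the exact ones, which leaves the trace unchanged.\<close>
  define x where "x = mat n n (\<lambda>(i, j). if j < i then x0 $$ (i, j) else X $$ (i, j))"
  have x: "x \<in> hess" by (auto simp: hess_def x_def)
  have "mcong n (w ^ mm) X x" using X low by (auto simp: mcong_def x_def)
  then have "charvec x y" using y(1) by (rule charvec_cong)
  moreover have "mtrace x = mtrace X"
    using X hess_carrier[OF x] by (simp add: mtrace_eq[of _ n]) (simp add: x_def)
  ultimately show ?thesis using that x y(2) trX by metis
qed

text \<open>Since k is 1 modulo \<open>q\<close>, conjugation by k changes nothing modulo
  \<open>q\<close>. If u fixes \<open>x\<close> under conjugation, then u and 1 both commute with
  \<open>x\<close> and have the same first column, so they coincide.\<close>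

lemma conj_cong_iff:
  assumes x: "x \<in> hess" and u: "u \<in> uni n" "u' \<in> uni n" "u * u' = 1\<^sub>m n" "u' * u = 1\<^sub>m n"
    and k: "k \<in> carrier_mat n n" "k' \<in> carrier_mat n n" "k * k' = 1\<^sub>m n" "k' * k = 1\<^sub>m n"
    and k1: "mcong n q k (1\<^sub>m n)"
  shows "mcong n q ((k' * u * k) * x * (k' * u' * k)) x \<longleftrightarrow> mcong n q u (1\<^sub>m n)"
proof -
  note as = assoc_mult_mat[of _ n n _ n _ n]
  note xc = hess_carrier[OF x] and uc = uni_carrier[OF u(1)] uni_carrier[OF u(2)]
  have k'1: "mcong n q k' (1\<^sub>m n)"
    using mcong_sym[OF mcong_mult_left[OF k(2) k1]] k by simp
  let ?h = "k' * u * k" and ?h' = "k' * u' * k"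
  have hc: "?h \<in> carrier_mat n n" "?h' \<in> carrier_mat n n" using uc k by auto
  have hu: "mcong n q ?h u"
    using mcong_mult[OF mcong_mult_right[OF uc(1) k'1] k1] uc by simp
  have h'u': "mcong n q ?h' u'"
    using mcong_mult[OF mcong_mult_right[OF uc(2) k'1] k1] uc by simp
  have c1: "mcong n q (?h * x * ?h') (u * x * u')" by (intro mcong_mult hu h'u' mcong_refl xc)
  have uxu: "u * x * u' * u = u * x" using u(4) uc xc by (simp add: as)
  show ?thesis
  proof
    assume "mcong n q (?h * x * ?h') x"
    then have "mcong n q (u * x * u') x" using c1 by (metis mcong_sym mcong_trans)
    from mcong_mult_right[OF uc(1) this] have "mcong n q (u * x) (x * u)" unfolding uxu .
    then show "mcong n q u (1\<^sub>m n)"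
    proof (rule cyclic_unique[OF x xc uc(1) one_carrier_mat])
      show "mcong n q (1\<^sub>m n * x) (x * 1\<^sub>m n)" using xc by (simp add: mcong_refl)
      show "q dvd u $$ (i, 0) - 1\<^sub>m n $$ (i, 0)" if "i < n" for i
        using u(1) that by (cases "i = 0") (auto simp: uni_def)
    qed
  next
    assume u1: "mcong n q u (1\<^sub>m n)"
    have "mcong n q (u * x * u') (x * u * u')"
      using mcong_mult_right[OF uc(2) mcong_trans[OF mcong_mult_right[OF xc u1] mcong_sym]] mcong_mult_left[OF xc u1] xc by simp
    also have "x * u * u' = x" using u(3) uc xc by (simp add: as)
    finally show "mcong n q (?h * x * ?h') x" using c1 by (metis mcong_trans)
  qed
qed

text \<open>For u and k in K^mm the commutator is 1 + w^(2 mm) [F, Y] up to third-order terms, which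
  vanish modulo \<open>w ^ l\<close>. It lies in K^ii and acts on v through tr(x [F, Y]) = tr([x, F]
  Y).\<close>

lemma commutator_act:
  assumes x: "x \<in> carrier_mat n n" and v: "charvec x v" and F: "F \<in> strict_upper n" and Y: "Y \<in> carrier_mat n n"
    and u: "u = 1\<^sub>m n + w ^ mm \<cdot>\<^sub>m F" and k: "k = 1\<^sub>m n + w ^ mm \<cdot>\<^sub>m Y" "k \<in> G0" "k' \<in> G0" "k * k' = 1\<^sub>m n" "k' * k = 1\<^sub>m n"
  shows "r (k' * u * k) *\<^sub>v v = \<phi> (w ^ (2 * mm) * mtrace ((x * F - F * x) * Y)) \<cdot>\<^sub>v (r u *\<^sub>v v)"
proof -
  note as = assoc_mult_mat[of _ n n _ n _ n]
  have uu: "u \<in> uni n" unfolding u by (intro uni_one_plus strict_upper_smult F)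
  note Fc = strict_upper_carrier[OF F] and uc = uni_carrier[OF uu] and kc = G0_carrier[OF k(2)] G0_carrier[OF k(3)]
  define D where "D = F * Y - Y * F"
  have Dc: "D \<in> carrier_mat n n" using Fc Y by (auto simp: D_def intro!: minus_carrier_mat)
  have trD: "mtrace D = 0" unfolding D_def using Fc Y mtrace_comm[OF Fc Y] by (simp add: mtrace_minus[of _ n])
  let ?s = "w ^ mm"
  have ss: "w ^ (2 * mm) = ?s * ?s" by (simp add: power_add[symmetric] mult_2)
  have uk: "u * k = k * u + (?s * ?s) \<cdot>\<^sub>m D"
  proof -
    have FY: "F * Y \<in> carrier_mat n n" "Y * F \<in> carrier_mat n n" using Fc Y by auto
    show ?thesis unfolding u k(1) one_plus_mult_eq[OF Fc Y] one_plus_mult_eq[OF Y Fc] D_def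
      using FY Fc Y by (intro eq_matI) (auto simp: algebra_simps simp del: index_mult_mat(1))
  qed
  have k1: "mcong n ?s k (1\<^sub>m n)" unfolding k(1) using Y by (auto simp: mcong_def)
  have u1: "mcong n ?s u (1\<^sub>m n)" unfolding u using Fc by (auto simp: mcong_def)
  have k'1: "mcong n ?s k' (1\<^sub>m n)" using mcong_sym[OF mcong_mult_left[OF kc(2) k1]] k kc by simp
  have "k' * u * k = k' * (k * u + (?s * ?s) \<cdot>\<^sub>m D)" using kc uc uk by (simp add: as)
  also have "\<dots> = k' * (k * u) + k' * ((?s * ?s) \<cdot>\<^sub>m D)" using kc uc Dc by (intro mult_add_distrib_mat) auto
  also have "k' * (k * u) = u" using kc uc k by (simp add: as[symmetric])
  also have "k' * ((?s * ?s) \<cdot>\<^sub>m D) = (?s * ?s) \<cdot>\<^sub>m (k' * D)" using kc Dc by (intro mult_smult_distrib) auto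
  finally have e1: "k' * u * k = u + (?s * ?s) \<cdot>\<^sub>m (k' * D)" .
  \<comment> \<open>Both k' and u are 1 modulo w^mm, so exchanging them next to w^(2 mm) D costs
    only w^(3 mm); u can then be pulled out on the left.\<close>
  have "mcong n ((?s * ?s) * ?s) ((?s * ?s) \<cdot>\<^sub>m (k' * D)) ((?s * ?s) \<cdot>\<^sub>m (u * D))"
    by (intro mcong_smult mcong_mult_right Dc mcong_trans[OF k'1 mcong_sym[OF u1]])
  moreover have "w ^ l dvd (?s * ?s) * ?s"
    using le_imp_power_dvd[OF l_le_3mm, of w] unfolding power_add ss .
  ultimately have "mcong n (w ^ l) ((?s * ?s) \<cdot>\<^sub>m (k' * D)) ((?s * ?s) \<cdot>\<^sub>m (u * D))" by (rule mcong_dvd)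
  then have "mcong n (w ^ l) (k' * u * k) (u + (?s * ?s) \<cdot>\<^sub>m (u * D))"
    unfolding e1 by (intro mcong_add mcong_refl uc)
  moreover have "u + (?s * ?s) \<cdot>\<^sub>m (u * D) = u * (1\<^sub>m n + (?s * ?s) \<cdot>\<^sub>m D)"
    using uc Dc by (simp add: mult_add_distrib_mat[of _ n n _ n] mult_smult_distrib[of _ n n _ n])
  moreover have emb: "1\<^sub>m n + (?s * ?s) \<cdot>\<^sub>m D = emb (w ^ (2 * mm - ii) \<cdot>\<^sub>m D)"
  proof -
    have "pr (w ^ (2 * mm - ii) \<cdot>\<^sub>m D) = w ^ (2 * mm - ii) \<cdot>\<^sub>m D"
      using Dc trD by (intro pr_eq) (auto simp: mtrace_smult[of _ n])
    moreover have "w ^ (2 * mm) = w ^ ii * w ^ (2 * mm - ii)"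
      unfolding power_add[symmetric] using ii_le by simp
    then have "?s * ?s = w ^ ii * w ^ (2 * mm - ii)" unfolding ss .
    ultimately show ?thesis unfolding emb_def by (auto simp: mult.assoc intro!: eq_matI)
  qed
  ultimately have "r (k' * u * k) = r (u * emb (w ^ (2 * mm - ii) \<cdot>\<^sub>m D))" by (simp add: r_cong)
  also have "\<dots> = r u * sg (w ^ (2 * mm - ii) \<cdot>\<^sub>m D)"
    unfolding sg_def using Dc by (intro r_mult uni_G0[OF uu] emb_G0) simp
  finally have "r (k' * u * k) *\<^sub>v v = r u *\<^sub>v (sg (w ^ (2 * mm - ii) \<cdot>\<^sub>m D) *\<^sub>v v)"
    using uu Dc charvec_carrier[OF v] by (simp add: assoc_mult_mat_vec[of _ d d _ d])
  also have "\<dots> = psi (mtrace (x * (w ^ (2 * mm - ii) \<cdot>\<^sub>m D))) \<cdot>\<^sub>v (r u *\<^sub>v v)"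
    using uu Dc charvec_carrier[OF v] charvecD[OF v, of "w ^ (2 * mm - ii) \<cdot>\<^sub>m D"] by (simp add: smult_mat_vec[of _ d])
  also have "mtrace (x * (w ^ (2 * mm - ii) \<cdot>\<^sub>m D)) = w ^ (2 * mm - ii) * mtrace (x * D)"
    by (rule mtrace_mult_smult[OF x Dc])
  also have "mtrace (x * D) = mtrace ((x * F - F * x) * Y)"
  proof -
    have "x * D = x * (F * Y) - x * (Y * F)" unfolding D_def using x Fc Y by (intro mult_minus_distrib_mat) auto
    then have "mtrace (x * D) = mtrace (x * (F * Y)) - mtrace (x * (Y * F))" using x Fc Y by (simp add: mtrace_minus[of _ n])
    also have "mtrace (x * (Y * F)) = mtrace (x * Y * F)" using x Fc Y by (simp add: as)
    also have "\<dots> = mtrace (F * (x * Y))" using x Fc Y by (intro mtrace_comm[of _ n]) auto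
    also have "mtrace (x * (F * Y)) - mtrace (F * (x * Y)) = mtrace ((x * F) * Y - (F * x) * Y)"
      using x Fc Y by (simp add: mtrace_minus[of _ n] as)
    also have "(x * F) * Y - (F * x) * Y = (x * F - F * x) * Y"
      using x Fc Y by (intro minus_mult_distrib_mat[symmetric]) auto
    finally show ?thesis .
  qed
  also have "psi (w ^ (2 * mm - ii) * mtrace ((x * F - F * x) * Y)) = \<phi> (w ^ (2 * mm) * mtrace ((x * F - F * x) * Y))"
  proof -
    have "w ^ (2 * mm) = w ^ ii * w ^ (2 * mm - ii)" unfolding power_add[symmetric] using ii_le by simp
    then show ?thesis by (simp add: psi_def mult.assoc)
  qed
  finally show ?thesis .
qed

end

context whittaker_rep
begin

text \<open>If \<open>E\<close> were zero, all its conjugates by k would kill v; two rounds of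
  character orthogonality reduce this vanishing sum to a positive multiple of v.\<close>

lemma E_nonzero_if_hess:
  assumes x: "x \<in> hess" and v: "charvec x v" "v \<noteq> 0\<^sub>v d"
  shows "E \<noteq> 0\<^sub>m d d"
proof
  assume E0: "E = 0\<^sub>m d d"
  note as = assoc_mult_mat[of _ n n _ n _ n]
  note xc = hess_carrier[OF x] and vc = charvec_carrier[OF v(1)]
  let ?q = "w ^ mm" and ?c = "of_nat (card RM) :: complex"
  define R1 where "R1 = {u \<in> RU. mcong n ?q u (1\<^sub>m n)}"
  have finR1: "finite R1" using finite_RU by (simp add: R1_def)
  have q0: "?q \<noteq> 0" using w_nz by simp
  have R1_uni: "u \<in> uni n" if "u \<in> R1" for u using that RU_uni by (auto simp: R1_def)
  have "\<exists>F. F \<in> strict_upper n \<and> u = 1\<^sub>m n + ?q \<cdot>\<^sub>m F" if "u \<in> R1" for u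
    using uni_cong_one[OF R1_uni[OF that] q0] that unfolding R1_def by blast
  then obtain F where F: "\<And>u. u \<in> R1 \<Longrightarrow> F u \<in> strict_upper n" "\<And>u. u \<in> R1 \<Longrightarrow> u = 1\<^sub>m n + ?q \<cdot>\<^sub>m F u"
    by metis
  have Fc: "F u \<in> carrier_mat n n" if "u \<in> R1" for u by (rule strict_upper_carrier[OF F(1)[OF that]])
  define M where "M u = x * F u - F u * x" for u
  have Mc: "M u \<in> carrier_mat n n" if "u \<in> R1" for u
    using Fc[OF that] xc by (auto simp: M_def intro!: minus_carrier_mat)

  text \<open>Conjugating by k in the kernel of reduction and projecting to the character of x, only the
    u congruent to 1 survive, since the unitriangular group acts freely on Hessenberg matrices.\<close>
  have step1: "(\<Sum>u\<in>R1. inverse (th u) * (r (k' * u * k) *\<^sub>v v) $ j) = 0"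
    if k: "k \<in> G0" "k' \<in> G0" "k * k' = 1\<^sub>m n" "k' * k = 1\<^sub>m n" "mcong n ?q k (1\<^sub>m n)" and j: "j < d" for k k' j
  proof -
    note kc = G0_carrier[OF k(1)] G0_carrier[OF k(2)]
    \<comment> \<open>One coordinate of P x r(k'), taken as a linear functional, so that the sum
      defining \<open>E\<close> can be expanded term by term.\<close>
    define L where "L y = (P x *\<^sub>v (r k' *\<^sub>v y)) $ j" for y
    have dim: "dim_vec (P x *\<^sub>v z) = d" for z using carrier_matD[OF P_carrier] by simp
    have "L (E *\<^sub>v (r k *\<^sub>v v)) = (\<Sum>u\<in>RU. L ((inverse (th u) \<cdot>\<^sub>m r u) *\<^sub>v (r k *\<^sub>v v)))"
      unfolding E_def
    proof (rule linear_msum[OF _ _ finite_RU])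
      show "L (y + z) = L y + L z" if "y \<in> carrier_vec d" "z \<in> carrier_vec d" for y z
        using that k j dim by (simp add: L_def mult_add_distrib_mat_vec[of _ d d])
      show "L (c \<cdot>\<^sub>v y) = c * L y" if "y \<in> carrier_vec d" for c y
        using that k j dim by (simp add: L_def smult_mat_vec[of _ d])
    qed (use RU_uni k vc in auto)
    also have "E *\<^sub>v (r k *\<^sub>v v) = 0 \<cdot>\<^sub>v v"
      unfolding E0 using k vc r_vec_carrier[OF k(1) vc] by (intro eq_vecI) auto
    also have "L (0 \<cdot>\<^sub>v v) = 0" using k j vc dim by (simp add: L_def smult_mat_vec[of _ d])
    also have "(\<Sum>u\<in>RU. L ((inverse (th u) \<cdot>\<^sub>m r u) *\<^sub>v (r k *\<^sub>v v)))
        = (\<Sum>u\<in>RU. if mcong n ?q u (1\<^sub>m n) then ?c * (inverse (th u) * (r (k' * u * k) *\<^sub>v v) $ j) else 0)"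
    proof (rule sum.cong[OF refl])
      fix u assume "u \<in> RU"
      then have u: "u \<in> uni n" by (rule RU_uni)
      obtain ui where ui: "ui \<in> uni n" "u * ui = 1\<^sub>m n" "ui * u = 1\<^sub>m n" using uni_inverse[OF u] .
      note uc = uni_carrier[OF u] uni_carrier[OF ui(1)]
      let ?h = "k' * u * k" and ?h' = "k' * ui * k"
      have hG: "?h \<in> G0" "?h' \<in> G0" using k u ui by (simp_all add: G0_mult uni_G0)
      have cancel: "(k' * s * k) * (k' * t * k) = k' * (s * t) * k" if "s \<in> carrier_mat n n" "t \<in> carrier_mat n n" for s t
      proof -
        have "(k' * s * k) * (k' * t * k) = k' * s * (k * k') * (t * k)" using that kc by (simp add: as)
        then show ?thesis using that kc k by (simp add: as)
      qed
      have hh: "?h * ?h' = 1\<^sub>m n" "?h' * ?h = 1\<^sub>m n"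
        using cancel[OF uc] cancel[OF uc(2,1)] ui kc k by simp_all
      have "r k' *\<^sub>v ((inverse (th u) \<cdot>\<^sub>m r u) *\<^sub>v (r k *\<^sub>v v)) = inverse (th u) \<cdot>\<^sub>v (r k' *\<^sub>v (r u *\<^sub>v (r k *\<^sub>v v)))"
        using k u vc by (simp add: smult_mat_vec[of _ d])
      also have "r k' *\<^sub>v (r u *\<^sub>v (r k *\<^sub>v v)) = r ?h *\<^sub>v v"
        using k u vc kc uc by (simp add: r_mult_vec uni_G0 G0_mult as)
      finally have "L ((inverse (th u) \<cdot>\<^sub>m r u) *\<^sub>v (r k *\<^sub>v v)) = inverse (th u) * (P x *\<^sub>v (r ?h *\<^sub>v v)) $ j"
        using j dim hG vc by (simp add: L_def smult_mat_vec[of _ d])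
      \<comment> \<open>r(h) v belongs to the character h x h^-1, so P x either kills it or
        multiplies it by \<open>card RM\<close>.\<close>
      also have "P x *\<^sub>v (r ?h *\<^sub>v v) = (if mcong n ?q (?h * x * ?h') x then ?c else 0) \<cdot>\<^sub>v (r ?h *\<^sub>v v)"
        using xc hG G0_carrier[OF hG(1)] G0_carrier[OF hG(2)]
        by (intro P_charvec_eigen charvec_conj xc v(1) hG hh) auto
      also have "mcong n ?q (?h * x * ?h') x \<longleftrightarrow> mcong n ?q u (1\<^sub>m n)"
        by (rule conj_cong_iff[OF x u ui kc k(3,4,5)])
      also have "((if mcong n ?q u (1\<^sub>m n) then ?c else 0) \<cdot>\<^sub>v (r ?h *\<^sub>v v)) $ j
          = (if mcong n ?q u (1\<^sub>m n) then ?c else 0) * (r ?h *\<^sub>v v) $ j"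
        using j carrier_vecD[OF r_vec_carrier[OF hG(1) vc]] by (intro index_smult_vec) simp
      finally show "L ((inverse (th u) \<cdot>\<^sub>m r u) *\<^sub>v (r k *\<^sub>v v))
          = (if mcong n ?q u (1\<^sub>m n) then ?c * (inverse (th u) * (r ?h *\<^sub>v v) $ j) else 0)"
        by (simp add: ac_simps)
    qed
    also have "\<dots> = (\<Sum>u\<in>R1. ?c * (inverse (th u) * (r (k' * u * k) *\<^sub>v v) $ j))"
      using finite_RU by (simp add: R1_def sum.inter_filter)
    also have "\<dots> = ?c * (\<Sum>u\<in>R1. inverse (th u) * (r (k' * u * k) *\<^sub>v v) $ j)" by (simp add: sum_distrib_left)
    finally show ?thesis using card_RM by simp
  qed

  have step2: "(\<Sum>u\<in>R1. inverse (th u) * (\<phi> (w ^ (2 * mm) * mtrace (M u * Y)) * (r u *\<^sub>v v) $ j)) = 0"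
    if Y: "Y \<in> carrier_mat n n" and j: "j < d" for Y j
  proof -
    obtain k Y' where k: "k \<in> G0" "Y' \<in> carrier_mat n n" "k = 1\<^sub>m n + ?q \<cdot>\<^sub>m Y'" "mcong n ?q Y' (pr Y)"
      using one_plus_lift[OF Y] .
    obtain k' where k': "k' \<in> G0" "k * k' = 1\<^sub>m n" "k' * k = 1\<^sub>m n" using G0_inverse[OF k(1)] .
    have k1: "mcong n ?q k (1\<^sub>m n)" unfolding k(3) using k(2) by (auto simp: mcong_def)
    have "(r (k' * u * k) *\<^sub>v v) $ j = \<phi> (w ^ (2 * mm) * mtrace (M u * Y)) * (r u *\<^sub>v v) $ j" if u: "u \<in> R1" for u
    proof -
      have "(r (k' * u * k) *\<^sub>v v) $ j = (\<phi> (w ^ (2 * mm) * mtrace (M u * Y')) \<cdot>\<^sub>v (r u *\<^sub>v v)) $ j"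
        using commutator_act[OF xc v(1) F(1)[OF u] k(2) F(2)[OF u] k(3,1) k'] by (simp add: M_def)
      also have "\<dots> = \<phi> (w ^ (2 * mm) * mtrace (M u * Y')) * (r u *\<^sub>v v) $ j"
        using j carrier_vecD[OF r_vec_carrier[OF uni_G0[OF R1_uni[OF u]] vc]] by (intro index_smult_vec) simp
      \<comment> \<open>Y' agrees with pr Y rather than with Y, but M u is a commutator of trace
        zero, so the scalar part of Y does not contribute.\<close>
      also have "\<phi> (w ^ (2 * mm) * mtrace (M u * Y')) = \<phi> (w ^ (2 * mm) * mtrace (M u * Y))"
      proof (rule phi_cong)
        have trM: "mtrace (M u) = 0"
          unfolding M_def using xc Fc[OF u] mtrace_comm[OF xc Fc[OF u]] by (simp add: mtrace_minus[of _ n])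
        have "mtrace (M u * pr Y) = mtrace (M u * Y)"
        proof (cases "g = SL")
          case True
          have "M u * pr Y = M u * Y - M u * ((ninv * mtrace Y) \<cdot>\<^sub>m 1\<^sub>m n)"
            unfolding pr_def using True Mc[OF u] Y by (simp add: mult_minus_distrib_mat[of _ n n _ n])
          also have "M u * ((ninv * mtrace Y) \<cdot>\<^sub>m 1\<^sub>m n) = (ninv * mtrace Y) \<cdot>\<^sub>m M u"
            using Mc[OF u] by (subst mult_smult_distrib[of _ n n _ n]) auto
          finally show ?thesis using Mc[OF u] Y trM by (simp add: mtrace_minus[of _ n] mtrace_smult[of _ n])
        qed (simp add: pr_def)
        then have "?q dvd mtrace (M u * Y') - mtrace (M u * Y)"
          using mtrace_mcong[OF mcong_mult_left[OF Mc[OF u] k(4)]] by simp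
        then have "w ^ (2 * mm) * ?q dvd w ^ (2 * mm) * (mtrace (M u * Y') - mtrace (M u * Y))"
          by (rule mult_dvd_mono[OF dvd_refl])
        then show "w ^ l dvd w ^ (2 * mm) * (mtrace (M u * Y') - mtrace (M u * Y))"
          using le_imp_power_dvd[OF l_le_3mm, of w] unfolding power_add by (rule dvd_trans[rotated])
      qed
      finally show ?thesis .
    qed
    then show ?thesis using step1[OF k(1) k' k1 j] by simp
  qed

  define T where "T u \<longleftrightarrow> (\<forall>i<n. \<forall>j<n. w ^ l dvd w ^ (2 * mm) * M u $$ (i, j))" for u
  text \<open>Summing over Y kills every u outside the deeper congruence subgroup, on which theta and the
    character of x agree.\<close>
  have fix_T: "inverse (th u) * (r u *\<^sub>v v) $ j = v $ j" if u: "u \<in> R1" "T u" and j: "j < d" for u j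
  proof -
    \<comment> \<open>Equal to 1 for even l and to \<open>w\<close> for odd l: exactly the gap
      between the levels mm and ii.\<close>
    let ?p = "w ^ (l - 2 * mm)"
    have wl: "w ^ l = w ^ (2 * mm) * ?p" using mm_le by (simp add: power_add[symmetric])
    have "?p dvd M u $$ (i, j)" if "i < n" "j < n" for i j
      using u(2) that unfolding T_def wl by (auto simp: w_nz)
    then have "mcong n ?p (x * F u) (F u * x)"
      using Fc[OF u(1)] xc unfolding mcong_def M_def by (auto simp del: index_mult_mat(1))
    then have "mcong n ?p (F u * x) (x * F u)" by (rule mcong_sym)
    \<comment> \<open>F u and 0 both commute with \<open>x\<close> modulo this power and have
      vanishing first column, so uniqueness of intertwiners identifies them.\<close>
    then have "mcong n ?p (F u) (0\<^sub>m n n)"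
    proof (rule cyclic_unique[OF x xc Fc[OF u(1)] zero_carrier_mat])
      show "mcong n ?p (0\<^sub>m n n * x) (x * 0\<^sub>m n n)" using xc by (simp add: mcong_refl)
      show "?p dvd F u $$ (i, 0) - 0\<^sub>m n n $$ (i, 0)" if "i < n" for i
        using F(1)[OF u(1)] that by (auto simp: strict_upper_def)
    qed
    then have "?p dvd F u $$ (i, j)" if "i < n" "j < n" for i j using mcongD(3)[of n ?p "F u" "0\<^sub>m n n" i j] that by simp
    moreover have "?p \<noteq> 0" using w_nz by simp
    ultimately obtain F' where F': "F' \<in> strict_upper n" "F u = ?p \<cdot>\<^sub>m F'"
      using strict_upper_divide[OF F(1)[OF u(1)]] by blast
    have "mm + (l - 2 * mm) = ii" using l_eq mm_le by simp
    then have "?q * ?p = w ^ ii" by (simp add: power_add[symmetric])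
    then have "?q \<cdot>\<^sub>m F u = w ^ ii \<cdot>\<^sub>m F'" unfolding F'(2) by (auto simp: mult.assoc[symmetric] intro!: eq_matI)
    then have uF: "u = 1\<^sub>m n + w ^ ii \<cdot>\<^sub>m F'" using F(2)[OF u(1)] by simp
    have "r u *\<^sub>v v = psi (mtrace (x * F')) \<cdot>\<^sub>v v"
      using charvecD[OF v(1) strict_upper_carrier[OF F'(1)]] sg_strict_upper_th(1)[OF F'(1)] uF by simp
    moreover have "psi (mtrace (x * F')) = th u"
      using sg_strict_upper_th(2)[OF F'(1)] tr_hess_strict_upper[OF x F'(1)] uF by simp
    ultimately show ?thesis using th_nz[of u] j vc by simp
  qed
  have total: "of_nat (card {u \<in> R1. T u}) * v $ j = 0" if j: "j < d" for j
  proof -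
    have "0 = (\<Sum>Y\<in>RM. \<Sum>u\<in>R1. inverse (th u) * (\<phi> (w ^ (2 * mm) * mtrace (M u * Y)) * (r u *\<^sub>v v) $ j))"
      using step2[OF RM_carrier j] by simp
    also have "\<dots> = (\<Sum>u\<in>R1. \<Sum>Y\<in>RM. inverse (th u) * (\<phi> (w ^ (2 * mm) * mtrace (M u * Y)) * (r u *\<^sub>v v) $ j))"
      by (rule sum.swap)
    also have "\<dots> = (\<Sum>u\<in>R1. if T u then ?c * v $ j else 0)"
    proof (rule sum.cong[OF refl])
      fix u assume u: "u \<in> R1"
      have "(\<Sum>Y\<in>RM. inverse (th u) * (\<phi> (w ^ (2 * mm) * mtrace (M u * Y)) * (r u *\<^sub>v v) $ j))
          = (\<Sum>Y\<in>RM. \<phi> (w ^ (2 * mm) * mtrace (M u * Y))) * (inverse (th u) * (r u *\<^sub>v v) $ j)"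
        unfolding sum_distrib_right by (intro sum.cong refl) (simp add: ac_simps)
      also have "(\<Sum>Y\<in>RM. \<phi> (w ^ (2 * mm) * mtrace (M u * Y))) = (if T u then ?c else 0)"
        unfolding T_def by (rule character_sum[OF Mc[OF u] l_le_3mm])
      finally show "(\<Sum>Y\<in>RM. inverse (th u) * (\<phi> (w ^ (2 * mm) * mtrace (M u * Y)) * (r u *\<^sub>v v) $ j))
          = (if T u then ?c * v $ j else 0)"
        using fix_T[OF u _ j] by simp
    qed
    also have "\<dots> = (\<Sum>u\<in>{u \<in> R1. T u}. ?c * v $ j)" by (rule sum.inter_filter[symmetric, OF finR1])
    also have "\<dots> = ?c * (of_nat (card {u \<in> R1. T u}) * v $ j)" by simp
    finally show ?thesis using card_RM by simp
  qed
  \<comment> \<open>The class of 1 makes the count positive. Its chosen representative may differ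
    from the identity matrix, so \<open>T\<close> is verified from the congruence.\<close>
  let ?u = "mrep n (w ^ l) (uni n) (1\<^sub>m n)"
  have u1: "mcong n (w ^ l) ?u (1\<^sub>m n)" by (rule mcong_sym[OF mrep(2)[OF uni_sub uni_one]])
  have "?q dvd w ^ l" using l_eq by (intro le_imp_power_dvd) simp
  then have uR1: "?u \<in> R1" using mcong_dvd[OF u1] uni_one by (auto simp: R1_def mreps_def)
  have "T ?u"
  proof -
    let ?F = "F ?u"
    have ss: "w ^ (2 * mm) = ?q * ?q" by (simp add: power_add[symmetric] mult_2)
    note Fu = Fc[OF uR1]
    have "mcong n (w ^ l) (1\<^sub>m n + ?q \<cdot>\<^sub>m ?F) (1\<^sub>m n)" using u1 by (subst F(2)[OF uR1, symmetric])
    then have d: "w ^ l dvd ?q * ?F $$ (i, j)" if "i < n" "j < n" for i j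
      using mcongD(3)[of n "w ^ l" "1\<^sub>m n + ?q \<cdot>\<^sub>m ?F" "1\<^sub>m n" i j] that Fu by simp
    have "w ^ l dvd w ^ (2 * mm) * M ?u $$ (i, j)" if ij: "i < n" "j < n" for i j
    proof -
      have "M ?u $$ (i, j) = (x * ?F) $$ (i, j) - (?F * x) $$ (i, j)"
        unfolding M_def using ij xc Fu by (simp del: index_mult_mat(1))
      also have "\<dots> = (\<Sum>t<n. x $$ (i, t) * ?F $$ (t, j)) - (\<Sum>t<n. ?F $$ (i, t) * x $$ (t, j))"
        using ij xc Fu by (subst (1 2) mat_mult_entry[of _ n n _ n]) auto
      finally have "w ^ (2 * mm) * M ?u $$ (i, j)
          = ?q * ((\<Sum>t<n. x $$ (i, t) * (?q * ?F $$ (t, j))) - (\<Sum>t<n. (?q * ?F $$ (i, t)) * x $$ (t, j)))"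
        unfolding ss by (simp add: right_diff_distrib sum_distrib_left ac_simps)
      also have "w ^ l dvd \<dots>"
      proof (rule dvd_mult, rule dvd_diff)
        show "w ^ l dvd (\<Sum>t<n. x $$ (i, t) * (?q * ?F $$ (t, j)))"
          by (rule dvd_sum, rule dvd_mult) (use d ij in auto)
        show "w ^ l dvd (\<Sum>t<n. (?q * ?F $$ (i, t)) * x $$ (t, j))"
          by (rule dvd_sum, rule dvd_mult2) (use d ij in auto)
      qed
      finally show ?thesis .
    qed
    then show ?thesis by (simp add: T_def)
  qed
  then have "{u \<in> R1. T u} \<noteq> {}" using uR1 by blast
  then have "card {u \<in> R1. T u} \<noteq> 0" using finR1 by simp
  then have "v $ j = 0" if "j < d" for j using total[OF that] by simp
  then have "v = 0\<^sub>v d" using vc by (intro eq_vecI) auto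
  then show False using v(2) by simp
qed

text \<open>The entries are prescribed only modulo \<open>w ^ mm\<close>; an exact Hessenberg matrix
  in the same class defines the same character.\<close>

lemma alpha_regular_elt_hess:
  assumes "alpha_regular_elt w g n mm a xh"
  obtains x where "x \<in> hess" "mcong n (w ^ mm) xh x" "xh \<in> carrier_mat n n" "g = SL \<longrightarrow> w ^ mm dvd mtrace xh"
proof -
  have c: "xh \<in> carrier_mat n n" and t: "g = SL \<Longrightarrow> w ^ mm dvd mtrace xh"
    and e: "\<And>i j. i < n \<Longrightarrow> j < n \<Longrightarrow> j \<noteq> n - 1 \<Longrightarrow> w ^ mm dvd xh $$ (i, j) -
          (if i = 1 \<and> j = 0 then a else if 2 \<le> i \<and> j = i - 1 then 1 else 0)"
    using assms by (auto simp: alpha_regular_elt_def glift_def)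
  define x where "x = mat n n (\<lambda>(i, j). if j < i then x0 $$ (i, j) else xh $$ (i, j))"
  have "x \<in> hess" by (auto simp: hess_def x_def)
  moreover have "mcong n (w ^ mm) xh x"
  proof (rule mcongI)
    fix i j assume ij: "i < n" "j < n"
    show "w ^ mm dvd xh $$ (i, j) - x $$ (i, j)"
    proof (cases "j < i")
      case True
      have "x0 $$ (i, j) = (if i = 1 \<and> j = 0 then a else if 2 \<le> i \<and> j = i - 1 then 1 else 0)"
        using ij True by (auto simp: x0_def)
      then show ?thesis using e[OF ij] True ij by (simp add: x_def)
    qed (use ij in \<open>simp add: x_def\<close>)
  qed (use c in \<open>auto simp: x_def\<close>)
  ultimately show ?thesis using that c t by blast
qed

lemma admits_whittaker_iff_alpha_regular:
  "admits_whittaker (Grp w g n l) (Usub w n l) (theta n \<phi> a) d \<rho> \<longleftrightarrow> alpha_regular_rep w g n l \<phi> a d \<rho>"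
proof
  assume "admits_whittaker (Grp w g n l) (Usub w n l) (theta n \<phi> a) d \<rho>"
  then have E: "E \<noteq> 0\<^sub>m d d" by (simp add: admits_whittaker_iff)
  obtain x v where x: "x \<in> hess" "charvec x v" "v \<noteq> 0\<^sub>v d" "g = SL \<longrightarrow> w ^ mm dvd mtrace x"
    using hess_if_E_nonzero[OF E] .
  \<comment> \<open>The character found so far has arbitrary entries on and above the diagonal; a
    unitriangular conjugation brings it, together with its eigenvector, to companion shape.\<close>
  obtain C u u' where C: "C \<in> hess" "u \<in> uni n" "u' \<in> uni n" "u * u' = 1\<^sub>m n" "u' * u = 1\<^sub>m n" "C = u * x * u'"
    "\<forall>i<n. \<forall>j<n. j \<noteq> n - 1 \<longrightarrow> C $$ (i, j) = x0 $$ (i, j)"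
    using exists_companion[OF x(1)] .
  note xc = hess_carrier[OF x(1)] and Cc = hess_carrier[OF C(1)] and uc = uni_carrier[OF C(2)] uni_carrier[OF C(3)]
  let ?y = "r u *\<^sub>v v"
  have vc: "v \<in> carrier_vec d" by (rule charvec_carrier[OF x(2)])
  have y: "charvec C ?y"
    unfolding C(6) using C x xc by (intro charvec_conj uni_G0)
  have "r u' *\<^sub>v ?y = v" using C uc vc by (simp add: r_mult_vec uni_G0 r_one)
  then have y0: "?y \<noteq> 0\<^sub>v d" using x(3) mat_zero_vec[OF r_uni[OF C(3)]] by metis
  have "mtrace C = mtrace (u' * (u * x))" unfolding C(6) using xc uc by (intro mtrace_comm[of _ n]) auto
  also have "u' * (u * x) = x" using C(5) xc uc by (simp add: assoc_mult_mat[of _ n n _ n _ n, symmetric])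
  finally have tC: "g = SL \<Longrightarrow> w ^ mm dvd mtrace C" using x(4) by simp
  have "w dvd w ^ mm" using mm_pos by (rule dvd_power[OF disjI1])
  then have "glift w g n 1 C" using tC Cc by (auto simp: glift_def intro: dvd_trans)
  \<comment> \<open>K^(l-1) is contained in K^ii, so the same vector witnesses regularity.\<close>
  moreover have "contains_char w g n l \<phi> d \<rho> (l - 1) C"
  proof (rule contains_char_if_charvec[OF Cc y y0])
    show "ii \<le> l - 1" using l2 unfolding ii_def by presburger
  qed
  ultimately have "regular_rep w g n l \<phi> d \<rho>"
    unfolding regular_rep_def using regular_hess[OF C(1)] by blast
  moreover have "alpha_regular_elt w g n (l div 2) a C"
    unfolding alpha_regular_elt_def mm_def[symmetric]
  proof (intro conjI allI impI)
    show "glift w g n mm C" using tC Cc by (simp add: glift_def)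
    fix i j assume ij: "i < n" "j < n" "j \<noteq> n - 1"
    then have "C $$ (i, j) = (if i = 1 \<and> j = 0 then a else if 2 \<le> i \<and> j = i - 1 then 1 else 0)"
      using C(7) by (auto simp: x0_def)
    then show "w ^ mm dvd C $$ (i, j) - (if i = 1 \<and> j = 0 then a else if 2 \<le> i \<and> j = i - 1 then 1 else 0)" by simp
  qed
  moreover have "contains_char w g n l \<phi> d \<rho> ((l + 1) div 2) C"
    using contains_char_if_charvec[OF Cc y y0, of ii] by (simp add: ii_def)
  ultimately show "alpha_regular_rep w g n l \<phi> a d \<rho>" unfolding alpha_regular_rep_def by blast
next
  assume "alpha_regular_rep w g n l \<phi> a d \<rho>"
  then obtain xh where xh: "alpha_regular_elt w g n mm a xh" "contains_char w g n l \<phi> d \<rho> ii xh"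
    unfolding alpha_regular_rep_def mm_def ii_def by blast
  obtain x where x: "x \<in> hess" "mcong n (w ^ mm) xh x" "xh \<in> carrier_mat n n" "g = SL \<longrightarrow> w ^ mm dvd mtrace xh"
    using alpha_regular_elt_hess[OF xh(1)] .
  obtain v where v: "charvec xh v" "v \<noteq> 0\<^sub>v d" using charvec_if_contains_char[OF x(3) x(4)[rule_format] xh(2)] .
  have "E \<noteq> 0\<^sub>m d d" by (rule E_nonzero_if_hess[OF x(1) charvec_cong[OF x(2) v(1)] v(2)])
  then show "admits_whittaker (Grp w g n l) (Usub w n l) (theta n \<phi> a) d \<rho>" by (simp add: admits_whittaker_iff)
qed

end

text \<open>By Bezout a combination of n and p equals 1; since p lies in the maximal ideal, n does
  not.\<close>

lemma of_nat_unit_mod_residue_char: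
  fixes w :: "'a::idom"
  assumes "residue_char w p" "\<not> p dvd n" "local_dvr w"
  shows "\<exists>k. of_nat n * k = (1::'a)"
proof -
  have p: "prime p" "w dvd of_nat p" using assms by (auto simp: residue_char_def)
  then have "coprime p n" using assms by (simp add: prime_imp_coprime)
  then have "coprime (int n) (int p)" by (simp add: coprime_commute)
  then obtain s t where "s * int n + t * int p = 1" using coprime_imp_gcd_eq_1 bezout_int by metis
  then have st: "of_int s * of_nat n + of_int t * of_nat p = (1::'a)"
    by (metis of_int_1 of_int_add of_int_mult of_int_of_nat_eq)
  have "\<not> w dvd of_nat n"
  proof
    assume "w dvd (of_nat n :: 'a)"
    then have "w dvd of_int s * of_nat n + of_int t * of_nat p" using p by auto
    then show False using st local_dvr.w_nonunit[OF assms(3)] by simp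
  qed
  then show ?thesis using local_dvr.unit_if_not_dvd[OF assms(3)] by (metis dvdE)
qed

text \<open>The zero function is a junk value allowed by \<^const>\<open>primitive_char\<close>; then theta vanishes and both
  sides of the equivalence are false.\<close>

lemma zero_character:
  assumes z: "\<And>x. \<phi> x = 0" and irr: "irreducible_rep (Grp w g n l) d \<rho>"
  shows "\<not> admits_whittaker (Grp w g n l) (Usub w n l) (theta n \<phi> a) d \<rho>"
    "\<not> alpha_regular_rep w g n l \<phi> a d \<rho>"
    "at_most_one_whittaker (Grp w g n l) (Usub w n l) (theta n \<phi> a) d \<rho>"
proof -
  have th: "theta n \<phi> a X = 0" for X by (simp add: theta_def z Let_def)
  have T0: "T = (\<lambda>v x. 0)" if T: "ind_hom (Grp w g n l) (Usub w n l) (theta n \<phi> a) d \<rho> T" for T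
  proof (intro ext)
    fix v x
    show "T v x = 0"
    proof (cases "v \<in> carrier_vec d \<and> x \<in> carrier (Grp w g n l)")
      case True
      then obtain A where A: "Glift w g n l A" "x = mcls w n l A" by (auto simp: Grp_def)
      then have c: "A \<in> carrier_mat n n" by (simp add: Glift_def)
      \<comment> \<open>Equivariance under the identity element already forces T v x = 0, because
        theta takes the value 0 there.\<close>
      have "mcls w n l (1\<^sub>m n) \<in> Usub w n l" by (auto simp: Usub_def)
      then have "T v (mcls w n l (1\<^sub>m n) \<otimes>\<^bsub>Grp w g n l\<^esub> x) = theta n \<phi> a (mcls w n l (1\<^sub>m n)) * T v x"
        using T True unfolding ind_hom_def by blast
      moreover have "mcls w n l (1\<^sub>m n) \<otimes>\<^bsub>Grp w g n l\<^esub> x = x" using A c by (simp add: Grp_mult)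
      ultimately show ?thesis by (simp add: th)
    next
      case False
      then show ?thesis using T unfolding ind_hom_def by metis
    qed
  qed
  show "\<not> admits_whittaker (Grp w g n l) (Usub w n l) (theta n \<phi> a) d \<rho>"
    using T0 unfolding admits_whittaker_def by blast
  show "at_most_one_whittaker (Grp w g n l) (Usub w n l) (theta n \<phi> a) d \<rho>"
    unfolding at_most_one_whittaker_def
  proof (intro allI impI)
    fix T1 T2
    assume "ind_hom (Grp w g n l) (Usub w n l) (theta n \<phi> a) d \<rho> T1 \<and> ind_hom (Grp w g n l) (Usub w n l) (theta n \<phi> a) d \<rho> T2"
    then have "T1 = (\<lambda>v x. 0)" "T2 = (\<lambda>v x. 0)" using T0 by auto
    then show "\<exists>c1 c2::complex. (c1, c2) \<noteq> (0, 0) \<and> (\<forall>v x. c1 * T1 v x + c2 * T2 v x = 0)"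
      by (intro exI[of _ 1]) simp
  qed
  show "\<not> alpha_regular_rep w g n l \<phi> a d \<rho>"
  proof
    assume "alpha_regular_rep w g n l \<phi> a d \<rho>"
    then obtain xh i where "contains_char w g n l \<phi> d \<rho> i xh" unfolding alpha_regular_rep_def by blast
    then obtain v where v: "v \<in> carrier_vec d" "v \<noteq> 0\<^sub>v d" and Y: "\<And>Y. Y \<in> carrier_mat n n \<Longrightarrow>
        Glift w g n l (1\<^sub>m n + w ^ i \<cdot>\<^sub>m Y) \<Longrightarrow>
        \<rho> (mcls w n l (1\<^sub>m n + w ^ i \<cdot>\<^sub>m Y)) *\<^sub>v v = \<phi> (w ^ i * mtrace (xh * Y)) \<cdot>\<^sub>v v"
      unfolding contains_char_def by blast
    have e: "1\<^sub>m n + w ^ i \<cdot>\<^sub>m 0\<^sub>m n n = 1\<^sub>m n" by (intro eq_matI) auto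
    have "Glift w g n l (1\<^sub>m n)" by (cases g) (auto simp: Glift_def unit_mod_def intro: exI[of _ 1])
    then have "\<rho> (mcls w n l (1\<^sub>m n)) *\<^sub>v v = 0 \<cdot>\<^sub>v v" using Y[of "0\<^sub>m n n"] unfolding e by (simp add: z)
    moreover have "\<rho> (mcls w n l (1\<^sub>m n)) = 1\<^sub>m d"
      using irr by (simp add: irreducible_rep_def is_rep_def Grp_def)
    ultimately have "v = 0 \<cdot>\<^sub>v v" using v by simp
    moreover have "0 \<cdot>\<^sub>v v = 0\<^sub>v d" using v(1) by (intro eq_vecI) auto
    ultimately show False using v(2) by simp
  qed
qed

theorem theorem4p2:
  fixes w :: "'a::idom" and g :: grp_type and n l p :: nat and a :: 'a
    and \<phi> :: "'a \<Rightarrow> complex"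
  assumes "local_int_ring w" and "residue_char w p"
    and "2 \<le> n"
    and "g = SL \<longrightarrow> odd p \<and> \<not> p dvd n"
    and "2 \<le> l"
    and "unit_mod w l a"
    and "primitive_char w l \<phi>"
  shows "(\<forall>d (\<rho> :: 'a mat set \<Rightarrow> complex mat). irreducible_rep (Grp w g n l) d \<rho> \<longrightarrow>
            (admits_whittaker (Grp w g n l) (Usub w n l) (theta n \<phi> a) d \<rho> \<longleftrightarrow>
             alpha_regular_rep w g n l \<phi> a d \<rho>))
       \<and> (\<forall>d (\<rho> :: 'a mat set \<Rightarrow> complex mat). irreducible_rep (Grp w g n l) d \<rho> \<longrightarrow>
            at_most_one_whittaker (Grp w g n l) (Usub w n l) (theta n \<phi> a) d \<rho>)"
proof (cases "\<phi> 0 = 0")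
  \<comment> \<open>\<open>\<phi> 0\<close> is idempotent, hence 0 or 1; the value 0 forces the zero
    function.\<close>
  case True
  have z: "\<phi> x = 0" for x
    using True assms(7) unfolding primitive_char_def by (metis add.right_neutral mult_zero_right)
  show ?thesis using zero_character[of \<phi>, OF z] by simp
next
  case False
  have dvr: "local_dvr w" using assms(1) by unfold_locales
  have l0: "0 < l" using assms(5) by simp
  obtain b where ab: "a * b = 1" using local_dvr.unit_mod_imp_unit[OF dvr assms(6) l0] .
  have phi: "\<And>x y. \<phi> (x + y) = \<phi> x * \<phi> y" "\<And>x y. w ^ l dvd x - y \<Longrightarrow> \<phi> x = \<phi> y" "\<exists>x. \<phi> (w ^ (l - 1) * x) \<noteq> 1"
    using assms(7) unfolding primitive_char_def by blast+
  have "\<phi> 0 = 1" using phi(1)[of 0 0] False by simp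
  moreover have "\<exists>k. of_nat n * k = (1::'a)" if "g = SL"
    using of_nat_unit_mod_residue_char[OF assms(2) _ dvr] assms(4) that by blast
  ultimately have wh: "whittaker w n a b g l \<phi>"
    using assms ab phi by unfold_locales auto
  have rep: "whittaker_rep w n a b g l \<phi> d \<rho>" if "irreducible_rep (Grp w g n l) d \<rho>" for d \<rho>
    using wh that by (simp add: whittaker_rep_def whittaker_rep_axioms_def irreducible_rep_def)
  show ?thesis
    using whittaker_rep.admits_whittaker_iff_alpha_regular[OF rep] whittaker_rep.at_most_one[OF rep] by blast
qed


end
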